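(* Let $\lambda>0$, $\ell>0$, let $\gamma\in A_\ell$ be a penalized pinned elastica and let $\tilde\gamma$ denote its arclength parametrization. (i) If $0<\lambda\ell^2<\hat\lambda$ and $\tilde\gamma=\gamma_{\rm larc}^{\lambda,\ell,1}$, then $\gamma$ is stable. (ii) If $0<\lambda\ell^2<\hat\lambda$ and $\tilde\gamma=\gamma_{\rm sarc}^{\lambda,\ell,1}$, then $\gamma$ is unstable. (iii) If $\lambda\ell^2=\hat\lambda$ and $\tilde\gamma=\gamma_{\rm sarc}^{\lambda,\ell,1}=\gamma_{\rm larc}^{\lambda,\ell,1}$, then $\gamma$ is unstable. (iv) If $\tilde\gamma=\gamma_{\rm loop}^{\lambda,\ell,1}$, then $\gamma$ is unstable.
   Context: Elliptic functions: for $q\in[0,1)$, $x\in\mathbb{R}$, $\mathrm{F}(x,q)=\int_0^x(1-q^2\sin^2\theta)^{-1/2}\,d\theta$, $\mathrm{E}(x,q)=\int_0^x(1-q^2\sin^2\theta)^{1/2}\,d\theta$, $\mathrm{K}(q)=\mathrm{F}(\pi/2,q)$, $\mathrm{E}(q)=\mathrm{E}(\pi/2,q)$; $\mathrm{am}(\cdot,q)$ is the inverse of $x\mapsto\mathrm{F}(x,q)$, $\mathrm{cn}(x,q)=\cos\mathrm{am}(x,q)$. The function $q\mapsto2\mathrm{E}(q)-\mathrm{K}(q)$ is strictly decreasing on $[0,1)$ with unique zero $q_*\in(0,1)$. On $[1/\sqrt2,1)$ let $f(q)=(4q^4-5q^2+1)\mathrm{K}(q)+(-8q^4+8q^2-1)\mathrm{E}(q)$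 and $g(q)=8(2\mathrm{E}(q)-\mathrm{K}(q))^2(2q^2-1)$. $f$ has a unique zero $\hat q\in[1/\sqrt2,1)$ (in $(1/\sqrt2,q_* )$); $\hat\lambda:=g(\hat q)\approx0.70107$. $g(1/\sqrt2)=0$, $g$ is strictly increasing on $[1/\sqrt2,\hat q]$, strictly decreasing on $[\hat q,q_*]$ with $g(q_* )=0$, strictly increasing on $[q_*,1)$ with $g\to\infty$ at $1$. For $c\in(0,\hat\lambda]$ let $q_1(c)\in(1/\sqrt2,\hat q]$, $q_2(c)\in[\hat q,q_* )$ be the solutions of $g(q)=c$ in these intervals; for every $c>0$ let $q_3(c)$ be the unique solution of $g(q)=c$ in $(q_*,1)$. Setting: $A_\ell=\{\gamma\in W^{2,2}(0,1;\mathbb{R}^2): |\gamma'|\neq0$ on $[0,1]$, $\gamma(0)=(0,0),\ \gamma(1)=(\ell,0)\}$; $\mathcal{E}_\lambda[\gamma]=\int_\gamma k^2\,ds+\lambda L[\gamma]$. A penalized pinned elastica is $\gamma\in A_\ell$ with $\frac{d}{d\varepsilon}\mathcal{E}_\lambda[\gamma+\varepsilon\eta]|_{\varepsilon=0}=0$ for all $\eta\in W^{2,2}(0,1;\mathbb{R}^2)\cap W^{1,2}_0(0,1;\mathbb{R}^2)$. It is stable if it is a local minimizer of $\mathcal{E}_\lambda$ in $A_\ell$ w.r.t. the $W^{2,2}$-norm, and unstable otherwise. Curves (arclength parametrized on $[0,2\mathrm{K}(q)/\alpha]$), for $\lambda\ell^2\le\hat\lambda$: $\gamma_{\rm sarc}^{\lambda,\ell,1}(s)=\frac1\alpha\big(2\mathrm{E}(\mathrm{am}(\alpha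 s-\mathrm{K}(q),q),q)+2\mathrm{E}(q)-\alpha s,\ 2q\,\mathrm{cn}(\alpha s-\mathrm{K}(q),q)\big)$ with $q=q_1(\lambda\ell^2)$, $\alpha=\frac{2}{\ell}(2\mathrm{E}(q)-\mathrm{K}(q))$; $\gamma_{\rm larc}^{\lambda,\ell,1}$ is the same formula with $q=q_2(\lambda\ell^2)$. For all $\lambda\ell^2>0$: $\gamma_{\rm loop}^{\lambda,\ell,1}(s)=\frac1\alpha\big(-2\mathrm{E}(\mathrm{am}(\alpha s-\mathrm{K}(q),q),q)-2\mathrm{E}(q)+\alpha s,\ 2q\,\mathrm{cn}(\alpha s-\mathrm{K}(q),q)\big)$ with $q=q_3(\lambda\ell^2)$, $\alpha=\frac{2}{\ell}(\mathrm{K}(q)-2\mathrm{E}(q))$. *)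

theory Defs
  imports "HOL-Analysis.Analysis"
begin

definition oint :: "real \<Rightarrow> (real \<Rightarrow> real) \<Rightarrow> real" where
  "oint x f = (if 0 \<le> x then integral {0..x} f else - integral {x..0} f)"

definition ellF :: "real \<Rightarrow> real \<Rightarrow> real" where
  "ellF x q = oint x (\<lambda>\<theta>. 1 / sqrt (1 - q\<^sup>2 * (sin \<theta>)\<^sup>2))"

definition ellE :: "real \<Rightarrow> real \<Rightarrow> real" where
  "ellE x q = oint x (\<lambda>\<theta>. sqrt (1 - q\<^sup>2 * (sin \<theta>)\<^sup>2))"

definition ellK :: "real \<Rightarrow> real" where
  "ellK q = ellF (pi/2) q"

definition ellEc :: "real \<Rightarrow> real" where
  "ellEc q = ellE (pi/2) q"

definition am :: "real \<Rightarrow> real \<Rightarrow> real" where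
  "am u q = (THE x. ellF x q = u)"

definition cn :: "real \<Rightarrow> real \<Rightarrow> real" where
  "cn u q = cos (am u q)"

definition qstar :: real where
  "qstar = (THE q. 0 < q \<and> q < 1 \<and> 2 * ellEc q - ellK q = 0)"

definition fq :: "real \<Rightarrow> real" where
  "fq q = (4*q^4 - 5*q\<^sup>2 + 1) * ellK q + (-8*q^4 + 8*q\<^sup>2 - 1) * ellEc q"

definition gq :: "real \<Rightarrow> real" where
  "gq q = 8 * (2 * ellEc q - ellK q)\<^sup>2 * (2*q\<^sup>2 - 1)"

definition qhat :: real where
  "qhat = (THE q. 1 / sqrt 2 \<le> q \<and> q < 1 \<and> fq q = 0)"

definition lamhat :: real where
  "lamhat = gq qhat"

definition q1 :: "real \<Rightarrow> real" where
  "q1 c = (THE q. 1 / sqrt 2 < q \<and> q \<le> qhat \<and> gq q = c)"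

definition q2 :: "real \<Rightarrow> real" where
  "q2 c = (THE q. qhat \<le> q \<and> q < qstar \<and> gq q = c)"

definition q3 :: "real \<Rightarrow> real" where
  "q3 c = (THE q. qstar < q \<and> q < 1 \<and> gq q = c)"

section \<open>Explicit curves (arclength parametrized on [0, 2K(q)/alpha])\<close>

definition arc_alpha :: "real \<Rightarrow> real \<Rightarrow> real" where
  "arc_alpha l q = 2 / l * (2 * ellEc q - ellK q)"

definition loop_alpha :: "real \<Rightarrow> real \<Rightarrow> real" where
  "loop_alpha l q = 2 / l * (ellK q - 2 * ellEc q)"

definition arc_curve :: "real \<Rightarrow> real \<Rightarrow> real \<Rightarrow> real \<times> real" where
  "arc_curve l q s =
     (let a = arc_alpha l q in
      ((2 * ellE (am (a * s - ellK q) q) q + 2 * ellEc q - a * s) / a,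
       (2 * q * cn (a * s - ellK q) q) / a))"

definition loop_curve :: "real \<Rightarrow> real \<Rightarrow> real \<Rightarrow> real \<times> real" where
  "loop_curve l q s =
     (let a = loop_alpha l q in
      ((- 2 * ellE (am (a * s - ellK q) q) q - 2 * ellEc q + a * s) / a,
       (2 * q * cn (a * s - ellK q) q) / a))"

definition gamma_sarc :: "real \<Rightarrow> real \<Rightarrow> real \<Rightarrow> real \<times> real" where
  "gamma_sarc lam l = arc_curve l (q1 (lam * l\<^sup>2))"

definition gamma_larc :: "real \<Rightarrow> real \<Rightarrow> real \<Rightarrow> real \<times> real" where
  "gamma_larc lam l = arc_curve l (q2 (lam * l\<^sup>2))"

definition gamma_loop :: "real \<Rightarrow> real \<Rightarrow> real \<Rightarrow> real \<times> real" where
  "gamma_loop lam l = loop_curve l (q3 (lam * l\<^sup>2))"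

definition sarc_len :: "real \<Rightarrow> real \<Rightarrow> real" where
  "sarc_len lam l = 2 * ellK (q1 (lam*l\<^sup>2)) / arc_alpha l (q1 (lam*l\<^sup>2))"

definition larc_len :: "real \<Rightarrow> real \<Rightarrow> real" where
  "larc_len lam l = 2 * ellK (q2 (lam*l\<^sup>2)) / arc_alpha l (q2 (lam*l\<^sup>2))"

definition loop_len :: "real \<Rightarrow> real \<Rightarrow> real" where
  "loop_len lam l = 2 * ellK (q3 (lam*l\<^sup>2)) / loop_alpha l (q3 (lam*l\<^sup>2))"

type_synonym curve = "real \<Rightarrow> real \<times> real"

text \<open>First and second derivative on [0,1] (the second exists a.e. for W^{2,2} curves).\<close>
definition d1 :: "curve \<Rightarrow> real \<Rightarrow> real \<times> real" where
  "d1 \<gamma> t = vector_derivative \<gamma> (at t within {0..1})"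

definition d2 :: "curve \<Rightarrow> real \<Rightarrow> real \<times> real" where
  "d2 \<gamma> t = vector_derivative (d1 \<gamma>) (at t within {0..1})"

text \<open>W^{2,2}(0,1;R^2) (continuous representative): gamma is C^1 on [0,1] and its
  derivative is the integral of an L^2 function.\<close>
definition W22 :: "curve \<Rightarrow> bool" where
  "W22 \<gamma> \<longleftrightarrow> (\<exists>v h.
      (\<forall>t\<in>{0..1}. (\<gamma> has_vector_derivative v t) (at t within {0..1})) \<and>
      h absolutely_integrable_on {0..1} \<and>
      (\<lambda>t. (norm (h t))\<^sup>2) integrable_on {0..1} \<and>
      (\<forall>t\<in>{0..1}. v t = v 0 + integral {0..t} h))"

definition W22_norm :: "curve \<Rightarrow> real" where
  "W22_norm \<gamma> = sqrt (integral {0..1}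
      (\<lambda>t. (norm (\<gamma> t))\<^sup>2 + (norm (d1 \<gamma> t))\<^sup>2 + (norm (d2 \<gamma> t))\<^sup>2))"

definition A_ell :: "real \<Rightarrow> curve set" where
  "A_ell l = {\<gamma>. W22 \<gamma> \<and> (\<forall>t\<in>{0..1}. d1 \<gamma> t \<noteq> 0) \<and>
                 \<gamma> 0 = (0, 0) \<and> \<gamma> 1 = (l, 0)}"

definition curv :: "curve \<Rightarrow> real \<Rightarrow> real" where
  "curv \<gamma> t = (fst (d1 \<gamma> t) * snd (d2 \<gamma> t) - snd (d1 \<gamma> t) * fst (d2 \<gamma> t))
                / (norm (d1 \<gamma> t))^3"

definition curve_length :: "curve \<Rightarrow> real" where
  "curve_length \<gamma> = integral {0..1} (\<lambda>t. norm (d1 \<gamma> t))"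

definition bending :: "curve \<Rightarrow> real" where
  "bending \<gamma> = integral {0..1} (\<lambda>t. (curv \<gamma> t)\<^sup>2 * norm (d1 \<gamma> t))"

definition energy :: "real \<Rightarrow> curve \<Rightarrow> real" where
  "energy lam \<gamma> = bending \<gamma> + lam * curve_length \<gamma>"

definition penalized_pinned_elastica :: "real \<Rightarrow> real \<Rightarrow> curve \<Rightarrow> bool" where
  "penalized_pinned_elastica lam l \<gamma> \<longleftrightarrow> \<gamma> \<in> A_ell l \<and>
     (\<forall>\<eta>. W22 \<eta> \<and> \<eta> 0 = 0 \<and> \<eta> 1 = 0 \<longrightarrow>
        ((\<lambda>\<epsilon>. energy lam (\<lambda>t. \<gamma> t + \<epsilon> *\<^sub>R \<eta> t)) has_real_derivative 0) (at 0))"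

definition stable :: "real \<Rightarrow> real \<Rightarrow> curve \<Rightarrow> bool" where
  "stable lam l \<gamma> \<longleftrightarrow> (\<exists>\<delta>>0. \<forall>\<eta>\<in>A_ell l.
      W22_norm (\<lambda>t. \<eta> t - \<gamma> t) < \<delta> \<longrightarrow> energy lam \<gamma> \<le> energy lam \<eta>)"

definition arclen_fun :: "curve \<Rightarrow> real \<Rightarrow> real" where
  "arclen_fun \<gamma> t = integral {0..t} (\<lambda>\<tau>. norm (d1 \<gamma> \<tau>))"

definition arclength_param :: "curve \<Rightarrow> real \<Rightarrow> real \<times> real" where
  "arclength_param \<gamma> s = \<gamma> (inv_into {0..1} (arclen_fun \<gamma>) s)"

definition arclength_param_is :: "curve \<Rightarrow> (real \<Rightarrow> real \<times> real) \<Rightarrow> real \<Rightarrow> bool" where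
  "arclength_param_is \<gamma> c Lc \<longleftrightarrow> curve_length \<gamma> = Lc \<and>
     (\<forall>s\<in>{0..Lc}. arclength_param \<gamma> s = c s)"

end

theory Submission
  imports Defs
begin

text \<open>Parametrized by the amplitude, every arc and every loop is a fixed smooth curve composed with a
  Sobolev reparametrization, so that smooth changes of the modulus \<open>q\<close> give admissible competitors.
  The energy \<open>e q\<close> of the arc of modulus \<open>q\<close> satisfies \<open>e' q = D q * (lam * l\<^sup>2 - gq q)\<close> with
  \<open>D q > 0\<close>: it increases up to \<open>q1\<close>, which gives the instability of the short arc (also at \<open>lamhat\<close>),
  and has a strict local minimum at \<open>q2\<close>. The long arc is then stable because an arc minimizes the bending
  energy among all admissible curves of the same length: in terms of the tangent angle, measured from
  its value at the midpoint of the curve, this is a calibration argument resting on the convexity of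
  \<open>x \<mapsto> cos (sqrt x)\<close>. A loop is unstable since sliding the window along the elastica keeps bending and
  length but increases the distance of the endpoints.\<close>

text \<open>For stability, closeness in \<open>W22_norm\<close> enters only through the length: a
  competitor near the long arc has the length of some arc of modulus \<open>q\<close> between
  \<open>qhat\<close> and \<open>qstar\<close>, its bending is at least that of this arc, and a
  one-variable comparison of \<open>arc_energy\<close> remains. No second variation appears. Fixing
  the length turns the chord into a term \<open>cos th\<close> with multiplier
  \<open>al\<^sup>2\<close>. On half of the curve the angle is pinned at the midpoint and free at
  the end, where the curvature of the arc vanishes. The obstacle is that cosine is not convex; its
  tangent bound in the variable \<open>th\<^sup>2\<close> leaves a quadratic functional, which a
  Riccati equation handles. For instability, the given curve may have a parametrization that is
  merely Sobolev. Each competitor therefore reuses the parametrization by amplitude of the given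
  curve and changes only the outer smooth curve. Closeness then reduces to uniform closeness of
  smooth functions on the amplitude interval from -pi/2 to pi/2.\<close>

section \<open>Elliptic integrals and the amplitude\<close>

text \<open>At the amplitude \<open>am u q\<close> this is Jacobi's function dn.\<close>

definition Del :: "real \<Rightarrow> real \<Rightarrow> real" where
  "Del q x = sqrt (1 - q\<^sup>2 * (sin x)\<^sup>2)"

lemma Del_arg_pos:
  fixes q x :: real
  assumes "\<bar>q\<bar> < 1"
  shows "0 < 1 - q\<^sup>2 * (sin x)\<^sup>2"
proof -
  have "q\<^sup>2 < 1" using assms by (simp add: abs_square_less_1)
  moreover have "q\<^sup>2 * (sin x)\<^sup>2 \<le> q\<^sup>2 * 1"
    by (intro mult_left_mono) (auto simp: abs_square_le_1)
  ultimately show ?thesis by linarith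
qed

lemma Del_pos: "\<bar>q\<bar> < 1 \<Longrightarrow> 0 < Del q x"
  unfolding Del_def using Del_arg_pos by simp

lemma Del_le_1: "Del q x \<le> 1"
  unfolding Del_def by simp

lemma Del_sq: "\<bar>q\<bar> < 1 \<Longrightarrow> (Del q x)\<^sup>2 = 1 - q\<^sup>2 * (sin x)\<^sup>2"
  unfolding Del_def using Del_arg_pos[of q x] by simp

lemma DERIV_Del [derivative_intros]:
  assumes "\<bar>q\<bar> < 1" "(g has_real_derivative g') (at x within S)"
  shows "((\<lambda>x. Del q (g x)) has_real_derivative
           (- (q\<^sup>2 * sin (g x) * cos (g x) / Del q (g x))) * g') (at x within S)"
  using Del_arg_pos[OF assms(1), of "g x"] unfolding Del_def
  by (auto intro!: derivative_eq_intros assms(2) simp: field_simps)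

lemma continuous_on_Del [continuous_intros]:
  fixes f g :: "'a::t2_space \<Rightarrow> real"
  assumes "continuous_on S f" "continuous_on S g"
  shows "continuous_on S (\<lambda>x. Del (f x) (g x))"
  unfolding Del_def by (intro continuous_intros continuous_on_sin assms)

text \<open>The definition of \<open>oint\<close> splits at 0. A base point below both 0 and
  \<open>x\<close> gives one formula for both signs, which can be differentiated at 0 as
  well.\<close>

lemma oint_eq:
  fixes f :: "real \<Rightarrow> real"
  assumes f: "continuous_on UNIV f" and a: "a \<le> x" "a \<le> 0"
  shows "oint x f = integral {a..x} f - integral {a..0} f"
proof -
  have i: "f integrable_on {u..v}" for u v
    using integrable_continuous_real continuous_on_subset[OF f] by blast
  show ?thesis
    using Henstock_Kurzweil_Integration.integral_combine[of a 0 x f]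
      Henstock_Kurzweil_Integration.integral_combine[of a x 0 f] a i
    by (auto simp: oint_def)
qed

lemma DERIV_oint:
  fixes f :: "real \<Rightarrow> real"
  assumes f: "continuous_on UNIV f"
  shows "((\<lambda>x. oint x f) has_real_derivative f x) (at x)"
proof -
  define a where "a = - \<bar>x\<bar> - 1"
  define b where "b = \<bar>x\<bar> + 1"
  have ab: "a < x" "x < b" "a < 0" by (auto simp: a_def b_def)
  have "((\<lambda>x. integral {a..x} f) has_real_derivative f x) (at x within {a..b})"
    using ab by (intro integral_has_real_derivative continuous_on_subset[OF f]) auto
  then have "((\<lambda>x. integral {a..x} f) has_real_derivative f x) (at x)"
    using ab by (simp add: at_within_Icc_at)
  then have "((\<lambda>x. integral {a..x} f - integral {a..0} f) has_real_derivative f x) (at x)"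
    by (auto intro!: derivative_eq_intros)
  moreover have "\<forall>\<^sub>F y in nhds x. oint y f = integral {a..y} f - integral {a..0} f"
    by (rule eventually_mono[OF eventually_nhds_in_open[of "{a<..}" x]])
      (use ab in \<open>auto intro!: oint_eq f\<close>)
  ultimately show ?thesis
    by (subst DERIV_cong_ev[OF refl _ refl]) auto
qed

lemma ellF_eq: "ellF x q = oint x (\<lambda>\<theta>. 1 / Del q \<theta>)"
  by (simp add: ellF_def Del_def)

lemma ellE_eq: "ellE x q = oint x (Del q)"
  by (simp add: ellE_def Del_def[abs_def])

lemma continuous_on_inverse_Del:
  "\<bar>q\<bar> < 1 \<Longrightarrow> continuous_on S (\<lambda>x. 1 / Del q x)"
  by (auto intro!: continuous_intros dest: Del_pos simp: less_imp_neq[symmetric] Del_pos)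

lemma DERIV_ellF:
  assumes "\<bar>q\<bar> < 1"
  shows "((\<lambda>x. ellF x q) has_real_derivative 1 / Del q x) (at x)"
  unfolding ellF_eq by (rule DERIV_oint[OF continuous_on_inverse_Del[OF assms]])

lemma DERIV_ellE:
  shows "((\<lambda>x. ellE x q) has_real_derivative Del q x) (at x)"
  unfolding ellE_eq by (rule DERIV_oint) (intro continuous_intros)

lemmas DERIV_ellF' [derivative_intros] = DERIV_chain2[OF DERIV_ellF]
lemmas DERIV_ellE' [derivative_intros] = DERIV_chain2[OF DERIV_ellE]

lemma ellF_0 [simp]: "ellF 0 q = 0" and ellE_0 [simp]: "ellE 0 q = 0"
  by (auto simp: ellF_def ellE_def oint_def)

lemma ellF_minus:
  assumes "\<bar>q\<bar> < 1" shows "ellF (- x) q = - ellF x q"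
proof -
  have "((\<lambda>x. ellF (-x) q + ellF x q) has_real_derivative 0) (at y)" for y
    using assms by (auto intro!: derivative_eq_intros simp: Del_def)
  from DERIV_const_ratio_const[OF _ this, of "0" "x"] show ?thesis
    by (cases "x = 0") auto
qed

lemma ellE_minus: "ellE (- x) q = - ellE x q"
proof -
  have "((\<lambda>x. ellE (-x) q + ellE x q) has_real_derivative 0) (at y)" for y
    by (auto intro!: derivative_eq_intros simp: Del_def)
  from DERIV_const_ratio_const[OF _ this, of "0" "x"] show ?thesis
    by (cases "x = 0") auto
qed

lemma ellF_pi_half [simp]: "ellF (pi/2) q = ellK q" and ellE_pi_half [simp]: "ellE (pi/2) q = ellEc q"
  by (auto simp: ellK_def ellEc_def)

text \<open>The integrand \<open>1 / Del\<close> is at least 1. This expansion bound yields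
  existence and uniqueness of the amplitude as well as its Lipschitz continuity.\<close>

lemma ellF_diff_ge:
  assumes "\<bar>q\<bar> < 1" "x \<le> y"
  shows "y - x \<le> ellF y q - ellF x q"
proof -
  have "(\<lambda>z. ellF z q - z) x \<le> (\<lambda>z. ellF z q - z) y"
  proof (rule DERIV_nonneg_imp_nondecreasing[OF assms(2)])
    fix z
    show "\<exists>d. ((\<lambda>z. ellF z q - z) has_real_derivative d) (at z) \<and> 0 \<le> d"
      using Del_pos[OF assms(1), of z] Del_le_1[of q z] assms(1)
      by (intro exI[of _ "1 / Del q z - 1"]) (auto intro!: derivative_eq_intros)
  qed
  then show ?thesis by simp
qed

lemma ex1_ellF:
  assumes "\<bar>q\<bar> < 1"
  shows "\<exists>!x. ellF x q = u"
proof (rule ex_ex1I)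
  have c: "continuous_on S (\<lambda>x. ellF x q)" for S
    by (rule DERIV_continuous_on, rule has_field_derivative_at_within, rule DERIV_ellF[OF assms])
  have "\<exists>x. -\<bar>u\<bar> \<le> x \<and> x \<le> \<bar>u\<bar> \<and> ellF x q = u"
    using ellF_diff_ge[OF assms, of "0" "\<bar>u\<bar>"] ellF_diff_ge[OF assms, of "-\<bar>u\<bar>" 0]
    by (intro IVT' c) auto
  then show "\<exists>x. ellF x q = u" by blast
next
  show "x = y" if "ellF x q = u" "ellF y q = u" for x y
    using ellF_diff_ge[OF assms, of x y] ellF_diff_ge[OF assms, of y x] that by linarith
qed

lemma ellF_am: "\<bar>q\<bar> < 1 \<Longrightarrow> ellF (am u q) q = u"
  unfolding am_def by (rule theI'[OF ex1_ellF])

lemma am_eqI: "\<bar>q\<bar> < 1 \<Longrightarrow> ellF x q = u \<Longrightarrow> am u q = x"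
  using ex1_ellF ellF_am by metis

lemma am_K: "\<bar>q\<bar> < 1 \<Longrightarrow> am (ellK q) q = pi/2" "\<bar>q\<bar> < 1 \<Longrightarrow> am (- ellK q) q = - (pi/2)"
    "\<bar>q\<bar> < 1 \<Longrightarrow> am 0 q = 0"
  by (rule am_eqI; simp add: ellF_minus[of q "pi/2", simplified])+

lemma am_diff_le:
  assumes "\<bar>q\<bar> < 1" shows "\<bar>am u q - am v q\<bar> \<le> \<bar>u - v\<bar>"
  using ellF_diff_ge[OF assms, of "am u q" "am v q"] ellF_diff_ge[OF assms, of "am v q" "am u q"]
    ellF_am[OF assms, of u] ellF_am[OF assms, of v] by linarith

lemma am_mono:
  assumes "\<bar>q\<bar> < 1" "u \<le> v" shows "am u q \<le> am v q"
proof (rule ccontr)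
  assume "\<not> am u q \<le> am v q"
  then show False using ellF_diff_ge[OF assms(1), of "am v q" "am u q"]
    ellF_am[OF assms(1), of u] ellF_am[OF assms(1), of v] assms(2) by linarith
qed

lemma am_strict_mono:
  assumes "\<bar>q\<bar> < 1" "u < v" shows "am u q < am v q"
  using am_mono[OF assms(1), of u v] ellF_am[OF assms(1), of u] ellF_am[OF assms(1), of v] assms(2)
  by (cases "am u q = am v q") auto

lemma DERIV_am:
  assumes "\<bar>q\<bar> < 1"
  shows "((\<lambda>u. am u q) has_real_derivative Del q (am u q)) (at u)"
proof -
  have "isCont (\<lambda>u. am u q) u"
    unfolding continuous_at_eps_delta dist_real_def
    using am_diff_le[OF assms] by (meson le_less_trans)
  then have "((\<lambda>u. am u q) has_real_derivative inverse (1 / Del q (am u q))) (at u)"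
    using assms DERIV_ellF[OF assms] Del_pos[OF assms, of "am u q"]
    by (intro DERIV_inverse_function[where f = "\<lambda>x. ellF x q" and a = "u - 1" and b = "u + 1"])
      (auto simp: ellF_am)
  then show ?thesis by simp
qed

lemmas DERIV_am' [derivative_intros] = DERIV_chain2[OF DERIV_am]

section \<open>Complete integrals, their derivatives in the modulus, and their growth\<close>

lemma ellK_integral: "ellK q = integral {0..pi/2} (\<lambda>x. 1 / Del q x)"
  unfolding ellK_def ellF_eq oint_def by simp

lemma ellEc_integral: "ellEc q = integral {0..pi/2} (Del q)"
  unfolding ellEc_def ellE_eq oint_def by simp

text \<open>The classical identity \<open>p / \<Delta>\<^sup>3 = \<Delta> - q\<^sup>2 (sin cos / \<Delta>)'\<close> with \<open>p = 1 - q\<^sup>2\<close>.\<close>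

lemma integral_inverse_Del_cubed:
  assumes "\<bar>q\<bar> < 1"
  shows "((\<lambda>x. 1 / Del q x ^ 3) has_integral ellEc q / (1 - q\<^sup>2)) {0..pi/2}"
proof -
  have p: "1 - q\<^sup>2 > 0" using assms by (simp add: abs_square_less_1)
  define G where "G = (\<lambda>x. (ellE x q - q\<^sup>2 * (sin x * cos x / Del q x)) / (1 - q\<^sup>2))"
  have "((\<lambda>x. 1 / Del q x ^ 3) has_integral (G (pi/2) - G 0)) {0..pi/2}"
  proof (rule fundamental_theorem_of_calculus)
    fix x :: real
    have D: "Del q x > 0" using Del_pos assms by blast
    let ?N = "((cos x)\<^sup>2 - (sin x)\<^sup>2) * (Del q x)\<^sup>2 + q\<^sup>2 * (sin x)\<^sup>2 * (cos x)\<^sup>2"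
    have 1: "((\<lambda>x. sin x * cos x / Del q x) has_real_derivative ?N / Del q x ^ 3) (at x within {0..pi/2})"
      using D assms by (auto intro!: derivative_eq_intros simp: field_simps power2_eq_square power3_eq_cube)
    have "Del q x ^ 4 - q\<^sup>2 * ?N = 1 - q\<^sup>2"
    proof -
      have "Del q x ^ 4 = ((Del q x)\<^sup>2)\<^sup>2" by simp
      then show ?thesis unfolding cos_squared_eq Del_sq[OF assms]
        by (simp add: algebra_simps power2_eq_square)
    qed
    then have "Del q x - q\<^sup>2 * (?N / Del q x ^ 3) = (1 - q\<^sup>2) / Del q x ^ 3"
      using D by (simp add: field_simps eval_nat_numeral)
    then have "(G has_real_derivative 1 / Del q x ^ 3) (at x within {0..pi/2})"
      unfolding G_def using p
      by (intro DERIV_cong[OF DERIV_cdivide[OF DERIV_diff[OF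
            DERIV_ellE[THEN has_field_derivative_at_within] DERIV_cmult[OF 1]]]]) simp
    then show "(G has_vector_derivative 1 / Del q x ^ 3) (at x within {0..pi/2})"
      by (simp add: has_real_derivative_iff_has_vector_derivative)
  qed auto
  then show ?thesis by (simp add: G_def)
qed

text \<open>Differentiating under the integral produces \<open>q * sin^2 / Del^3\<close>, which
  equals \<open>(1/q) * (1 / Del^3 - 1 / Del)\<close>; the first term is evaluated by the preceding
  lemma, the second is \<open>ellK\<close>.\<close>

lemma DERIV_ellK:
  assumes q: "0 < q" "q < 1"
  shows "(ellK has_real_derivative (ellEc q - (1 - q\<^sup>2) * ellK q) / (q * (1 - q\<^sup>2))) (at q)"
proof -
  have p: "1 - q\<^sup>2 > 0" using q by (simp add: abs_square_less_1)
  have q1: "\<bar>q\<bar> < 1" using q by auto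
  have D: "Del x t > 0" if "x \<in> {0<..<1}" for x t using that by (intro Del_pos) auto
  have "((\<lambda>q. integral (cbox 0 (pi/2)) (\<lambda>t. 1 / Del q t)) has_field_derivative
      integral (cbox 0 (pi/2)) (\<lambda>t. q * (sin t)\<^sup>2 / Del q t ^ 3)) (at q within {0<..<1})"
  proof (rule leibniz_rule_field_derivative)
    fix x t :: real assume x: "x \<in> {0<..<1}"
    have "0 < 1 - x\<^sup>2 * (sin t)\<^sup>2" using Del_arg_pos[of x t] x by auto
    then show "((\<lambda>x. 1 / Del x t) has_field_derivative x * (sin t)\<^sup>2 / Del x t ^ 3) (at x within {0<..<1})"
      unfolding Del_def
      by (auto intro!: derivative_eq_intros simp: field_simps power3_eq_cube power2_eq_square)
    show "(\<lambda>t. 1 / Del x t) integrable_on cbox 0 (pi/2)"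
      using continuous_on_inverse_Del[of x] x by (auto intro!: integrable_continuous_real)
  next
    show "continuous_on ({0<..<1} \<times> cbox 0 (pi/2)) (\<lambda>(x, t). x * (sin t)\<^sup>2 / Del x t ^ 3)"
      unfolding case_prod_unfold
      by (intro continuous_intros) (use D in \<open>auto simp: less_imp_neq[symmetric]\<close>)
  qed (use q in auto)
  moreover have "((\<lambda>t. (1/q) * (1 / Del q t ^ 3 - 1 / Del q t)) has_integral
     (1/q) * (ellEc q / (1 - q\<^sup>2) - ellK q)) {0..pi/2}"
    unfolding ellK_integral
    by (intro has_integral_mult_right has_integral_diff integral_inverse_Del_cubed q1 integrable_integral
        integrable_continuous_real continuous_on_inverse_Del)
  moreover have "(1/q) * (1 / Del q t ^ 3 - 1 / Del q t) = q * (sin t)\<^sup>2 / Del q t ^ 3" for t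
  proof -
    have "1 / Del q t ^ 3 - 1 / Del q t = (1 - (Del q t)\<^sup>2) / Del q t ^ 3"
      using D[of q t] q by (simp add: field_simps power2_eq_square power3_eq_cube)
    then show ?thesis using q by (simp add: Del_sq[OF q1]) (simp add: power2_eq_square)
  qed
  ultimately have "((\<lambda>q. integral {0..pi/2} (\<lambda>t. 1 / Del q t)) has_field_derivative
      (1/q) * (ellEc q / (1 - q\<^sup>2) - ellK q)) (at q within {0<..<1})"
    by (simp add: integral_unique)
  moreover have "(1/q) * (ellEc q / (1 - q\<^sup>2) - ellK q) = (ellEc q - (1 - q\<^sup>2) * ellK q) / (q * (1 - q\<^sup>2))"
    using q p by (simp add: field_simps)
  ultimately show ?thesis
    using q by (simp add: ellK_integral[abs_def] at_within_open[of q "{0<..<1}"])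
qed

lemma DERIV_ellEc:
  assumes q: "0 < q" "q < 1"
  shows "(ellEc has_real_derivative (ellEc q - ellK q) / q) (at q)"
proof -
  have q1: "\<bar>q\<bar> < 1" using q by auto
  have D: "Del x t > 0" if "x \<in> {0<..<1}" for x t using that by (intro Del_pos) auto
  have "((\<lambda>q. integral (cbox 0 (pi/2)) (\<lambda>t. Del q t)) has_field_derivative
      integral (cbox 0 (pi/2)) (\<lambda>t. - q * (sin t)\<^sup>2 / Del q t)) (at q within {0<..<1})"
  proof (rule leibniz_rule_field_derivative)
    fix x t :: real assume x: "x \<in> {0<..<1}"
    have "0 < 1 - x\<^sup>2 * (sin t)\<^sup>2" using Del_arg_pos[of x t] x by auto
    then show "((\<lambda>x. Del x t) has_field_derivative - x * (sin t)\<^sup>2 / Del x t) (at x within {0<..<1})"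
      unfolding Del_def
      by (auto intro!: derivative_eq_intros simp: field_simps power2_eq_square)
    show "(\<lambda>t. Del x t) integrable_on cbox 0 (pi/2)"
      by (auto intro!: integrable_continuous_real continuous_intros)
  next
    show "continuous_on ({0<..<1} \<times> cbox 0 (pi/2)) (\<lambda>(x, t). - x * (sin t)\<^sup>2 / Del x t)"
      unfolding case_prod_unfold
      by (intro continuous_intros) (use D in \<open>auto simp: less_imp_neq[symmetric]\<close>)
  qed (use q in auto)
  moreover have "((\<lambda>t. (1/q) * (Del q t - 1 / Del q t)) has_integral
     (1/q) * (ellEc q - ellK q)) {0..pi/2}"
    unfolding ellK_integral ellEc_integral
    by (intro has_integral_mult_right has_integral_diff q1 integrable_integral
        integrable_continuous_real continuous_on_inverse_Del continuous_intros)
  moreover have "(1/q) * (Del q t - 1 / Del q t) = - q * (sin t)\<^sup>2 / Del q t" for t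
  proof -
    have "Del q t - 1 / Del q t = ((Del q t)\<^sup>2 - 1) / Del q t"
      using D[of q t] q by (simp add: field_simps power2_eq_square)
    then show ?thesis using q by (simp add: Del_sq[OF q1]) (simp add: power2_eq_square)
  qed
  ultimately have "((\<lambda>q. integral {0..pi/2} (\<lambda>t. Del q t)) has_field_derivative
      (1/q) * (ellEc q - ellK q)) (at q within {0<..<1})"
    by (simp only: cbox_interval integral_unique)
  then show ?thesis
    using q by (simp add: ellEc_integral[abs_def] at_within_open[of q "{0<..<1}"])
qed

lemma ellK_pos: assumes "\<bar>q\<bar> < 1" shows "ellK q > 0"
  using ellF_diff_ge[OF assms, of 0 "pi/2"] pi_half_gt_zero by (simp add: less_le_trans[OF pi_half_gt_zero])

lemma ellEc_le_ellK: assumes "\<bar>q\<bar> < 1" shows "ellEc q \<le> ellK q"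
  unfolding ellK_integral ellEc_integral
proof (intro integral_le integrable_continuous_real continuous_on_inverse_Del assms continuous_intros)
  fix x show "Del q x \<le> 1 / Del q x"
    using Del_pos[OF assms, of x] Del_le_1[of q x] by (simp add: field_simps mult_le_one)
qed

lemma ellEc_pos: assumes "\<bar>q\<bar> < 1" shows "ellEc q > 0"
proof -
  have "((\<lambda>x. ellE x q) 0) < (\<lambda>x. ellE x q) (pi/2)"
    by (rule DERIV_pos_imp_increasing[OF pi_half_gt_zero]) (use Del_pos[OF assms] DERIV_ellE in blast)
  then show ?thesis by simp
qed

lemma ellEc_le: "ellEc q \<le> pi/2"
proof -
  have "ellEc q \<le> integral {0..pi/2} (\<lambda>x. 1)"
    unfolding ellEc_integral
    by (intro integral_le integrable_continuous_real continuous_intros) (auto simp: Del_le_1)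
  then show ?thesis by simp
qed

text \<open>With the complementary modulus \<open>r\<close>, \<open>Del\<close> is at most
  \<open>r + (pi/2 - x)\<close>, because cos x <= pi/2 - x. Integrating the reciprocal gives a lower
  bound that diverges logarithmically as \<open>r\<close> tends to 0.\<close>

lemma ellK_unbounded:
  assumes "q0 < 1"
  shows "\<exists>q. q0 < q \<and> 0 < q \<and> q < 1 \<and> ellK q > C"
proof -
  have lower: "ln (1 + pi / (2 * r)) \<le> ellK (sqrt (1 - r\<^sup>2))" if r: "0 < r" "r < 1" for r
  proof -
    define q where "q = sqrt (1 - r\<^sup>2)"
    have r2: "r\<^sup>2 < 1" using r by (simp add: abs_square_less_1)
    have q: "\<bar>q\<bar> < 1" "q\<^sup>2 = 1 - r\<^sup>2" using r r2 by (auto simp: q_def)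
    have "((\<lambda>x. 1 / (r + (pi/2 - x))) has_integral
        (- ln (r + (pi/2 - pi/2)) - - ln (r + (pi/2 - 0)))) {0..pi/2}"
      using r by (intro fundamental_theorem_of_calculus)
        (auto intro!: derivative_eq_intros simp: has_real_derivative_iff_has_vector_derivative[symmetric] divide_simps)
    moreover have "((\<lambda>x. 1 / Del q x) has_integral ellK q) {0..pi/2}"
      unfolding ellK_integral
      by (intro integrable_integral integrable_continuous_real continuous_on_inverse_Del q)
    ultimately have "- ln (r + (pi/2 - pi/2)) - - ln (r + (pi/2 - 0)) \<le> ellK q"
    proof (rule has_integral_le)
      fix x assume x: "x \<in> {0..pi/2}"
      have "0 \<le> cos x" using x by (intro cos_ge_zero) auto
      moreover have "cos x \<le> pi/2 - x"
        using x sin_x_le_x[of "pi/2 - x"] by (simp add: sin_diff)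
      ultimately have "(cos x)\<^sup>2 \<le> (pi/2 - x)\<^sup>2" by (intro power_mono) auto
      then have "(cos x)\<^sup>2 * (1 - r\<^sup>2) \<le> (pi/2 - x)\<^sup>2"
        using mult_left_mono[of "1 - r\<^sup>2" 1 "(cos x)\<^sup>2"] by simp
      then have "1 - q\<^sup>2 * (sin x)\<^sup>2 \<le> r\<^sup>2 + (pi/2 - x)\<^sup>2"
        unfolding q(2) sin_squared_eq by (simp add: algebra_simps)
      also have "\<dots> \<le> (r + (pi/2 - x))\<^sup>2" using r x by (simp add: power2_sum)
      finally have "Del q x \<le> r + (pi/2 - x)"
        unfolding Del_def using r x by (intro real_le_lsqrt) auto
      then show "1 / (r + (pi/2 - x)) \<le> 1 / Del q x"
        using Del_pos[OF q(1), of x] by (intro divide_left_mono) auto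
    qed
    moreover have "ln (r + pi/2) - ln r = ln (1 + pi / (2*r))"
    proof -
      have "ln (r + pi/2) - ln r = ln ((r + pi/2) / r)" using r by (intro ln_divide_pos[symmetric]) (auto simp: add_pos_pos)
      also have "(r + pi/2) / r = 1 + pi / (2*r)" using r by (simp add: field_simps)
      finally show ?thesis .
    qed
    ultimately show ?thesis by (simp add: q_def)
  qed
  define m where "m = max q0 0"
  \<comment> \<open>The three bounds put the modulus above \<open>m\<close>, keep \<open>r\<close>
    below 1, and make the logarithm at least \<open>\<bar>C\<bar> + 1\<close>.\<close>
  define r where "r = min (sqrt ((1 - m\<^sup>2) / 2)) (min (1/2) (pi / (2 * exp (\<bar>C\<bar> + 1))))"
  have m: "0 \<le> m" "m < 1" "m\<^sup>2 < 1" using assms by (auto simp: m_def abs_square_less_1)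
  have r: "0 < r" "r < 1" using m by (auto simp: r_def)
  have "r\<^sup>2 \<le> (sqrt ((1 - m\<^sup>2) / 2))\<^sup>2" using r by (intro power_mono) (auto simp: r_def)
  then have r2: "r\<^sup>2 < 1 - m\<^sup>2" using m by (simp add: )
  have "m < sqrt (1 - r\<^sup>2)" using r2 m by (intro real_less_rsqrt) auto
  moreover have "sqrt (1 - r\<^sup>2) < 1" using r by simp
  moreover have "C < ellK (sqrt (1 - r\<^sup>2))"
  proof -
    have "r \<le> pi / (2 * exp (\<bar>C\<bar> + 1))" by (simp add: r_def)
    then have "exp (\<bar>C\<bar> + 1) \<le> pi / (2 * r)" using r by (simp add: field_simps)
    then have "exp (\<bar>C\<bar> + 1) \<le> 1 + pi / (2 * r)" by simp
    then have "\<bar>C\<bar> + 1 \<le> ln (1 + pi / (2 * r))"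
      using r by (subst ln_ge_iff) (auto simp: add_pos_pos)
    then show ?thesis using lower[OF r] by linarith
  qed
  moreover have "q0 < sqrt (1 - r\<^sup>2)" "0 < sqrt (1 - r\<^sup>2)"
    using \<open>m < sqrt (1 - r\<^sup>2)\<close> m by (auto simp: m_def)
  ultimately show ?thesis by blast
qed

section \<open>Dependence on the modulus\<close>

text \<open>Half the chord of the arc of modulus \<open>q\<close> when it is scaled to have
  half-length \<open>ellK q\<close>.\<close>

definition ellP :: "real \<Rightarrow> real" where
  "ellP q = 2 * ellEc q - ellK q"

text \<open>In the same scale, \<open>8 * ellH q\<close> is the bending energy of the arc, the
  integral of (2 q cn)^2 from -K to K.\<close>

definition ellH :: "real \<Rightarrow> real" where
  "ellH q = ellEc q - (1 - q\<^sup>2) * ellK q"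

lemma DERIV_ellP:
  assumes q: "0 < q" "q < 1"
  shows "(ellP has_real_derivative ((1 - 2 * q\<^sup>2) * ellEc q - (1 - q\<^sup>2) * ellK q) / (q * (1 - q\<^sup>2))) (at q)"
proof -
  have p: "1 - q\<^sup>2 > 0" using q by (simp add: abs_square_less_1)
  have "(ellP has_real_derivative 2 * ((ellEc q - ellK q) / q)
      - (ellEc q - (1 - q\<^sup>2) * ellK q) / (q * (1 - q\<^sup>2))) (at q)"
    unfolding ellP_def[abs_def]
    by (intro DERIV_diff DERIV_cmult DERIV_ellEc DERIV_ellK q)
  moreover have "2 * ((ellEc q - ellK q) / q) - (ellEc q - (1 - q\<^sup>2) * ellK q) / (q * (1 - q\<^sup>2))
     = ((1 - 2 * q\<^sup>2) * ellEc q - (1 - q\<^sup>2) * ellK q) / (q * (1 - q\<^sup>2))"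
    using q p by (simp add: divide_simps) (simp add: algebra_simps)
  ultimately show ?thesis by (rule DERIV_cong)
qed

lemma DERIV_ellH:
  assumes q: "0 < q" "q < 1"
  shows "(ellH has_real_derivative q * ellK q) (at q)"
proof -
  have p: "1 - q\<^sup>2 > 0" using q by (simp add: abs_square_less_1)
  have "(ellH has_real_derivative (ellEc q - ellK q) / q
     - ((0 - 2 * q) * ellK q + ((ellEc q - (1 - q\<^sup>2) * ellK q) / (q * (1 - q\<^sup>2))) * (1 - q\<^sup>2))) (at q)"
    unfolding ellH_def[abs_def]
    by (intro DERIV_diff DERIV_mult DERIV_ellEc DERIV_ellK q) (auto intro!: derivative_eq_intros)
  moreover have "(ellEc q - ellK q) / q
     - ((0 - 2 * q) * ellK q + ((ellEc q - (1 - q\<^sup>2) * ellK q) / (q * (1 - q\<^sup>2))) * (1 - q\<^sup>2)) = q * ellK q"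
    using q p by (simp add: divide_simps) (simp add: algebra_simps power2_eq_square)
  ultimately show ?thesis by (rule DERIV_cong)
qed

lemma ellP_deriv_neg:
  assumes q: "0 < q" "q < 1"
  shows "((1 - 2 * q\<^sup>2) * ellEc q - (1 - q\<^sup>2) * ellK q) / (q * (1 - q\<^sup>2)) < 0"
proof -
  have p: "1 - q\<^sup>2 > 0" using q by (simp add: abs_square_less_1)
  have K: "ellK q > 0" "ellEc q > 0" "ellEc q \<le> ellK q"
    using q ellK_pos ellEc_pos ellEc_le_ellK by auto
  have "(1 - 2 * q\<^sup>2) * ellEc q < (1 - q\<^sup>2) * ellEc q" using q K by simp
  also have "\<dots> \<le> (1 - q\<^sup>2) * ellK q" using p K by simp
  finally show ?thesis using p q by (simp add: divide_neg_pos)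
qed

lemma ellP_strict_anti:
  assumes "0 < x" "x < y" "y < 1"
  shows "ellP y < ellP x"
proof (rule DERIV_neg_imp_decreasing[OF assms(2)])
  fix z assume "x \<le> z" "z \<le> y"
  then show "\<exists>d. (ellP has_real_derivative d) (at z) \<and> d < 0"
    using DERIV_ellP[of z] ellP_deriv_neg[of z] assms by auto
qed

lemma isCont_ell:
  assumes "0 < q" "q < 1"
  shows "isCont ellP q" "isCont ellH q" "isCont ellK q" "isCont ellEc q"
  using DERIV_ellP DERIV_ellH DERIV_ellK DERIV_ellEc assms DERIV_isCont by blast+

lemma continuous_on_ell:
  assumes "\<And>q. q \<in> S \<Longrightarrow> 0 < q \<and> q < 1"
  shows "continuous_on S ellP" "continuous_on S ellH" "continuous_on S ellK" "continuous_on S ellEc"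
  using isCont_ell assms by (simp_all add: continuous_at_imp_continuous_on)

text \<open>For q^2 <= 1/2 one has cos^2 <= 2 Del^2 - 1, and Del <= 1 then gives cos^2 <= 2 Del -
  1/Del. The integral of the left side is pi/4.\<close>

lemma ellP_pos_half:
  assumes q: "\<bar>q\<bar> < 1" "q\<^sup>2 \<le> 1/2"
  shows "ellP q > 0"
proof -
  have P: "((\<lambda>x. 2 * Del q x - 1 / Del q x) has_integral ellP q) {0..pi/2}"
    unfolding ellP_def ellEc_integral ellK_integral
    by (intro has_integral_diff has_integral_mult_right integrable_integral integrable_continuous_real
        continuous_on_inverse_Del continuous_intros q)
  have "((\<lambda>x. (cos x)\<^sup>2) has_integral ((pi/2 + sin (pi/2) * cos (pi/2)) / 2 - (0 + sin 0 * cos 0) / 2)) {0..pi/2}"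
  proof (rule fundamental_theorem_of_calculus)
    fix x :: real
    have "((\<lambda>x. (x + sin x * cos x) / 2) has_real_derivative (cos x)\<^sup>2) (at x within {0..pi/2})"
      by (auto intro!: derivative_eq_intros simp: power2_eq_square[symmetric] cos_squared_eq)
    then show "((\<lambda>x. (x + sin x * cos x) / 2) has_vector_derivative (cos x)\<^sup>2) (at x within {0..pi/2})"
      by (simp add: has_real_derivative_iff_has_vector_derivative)
  qed simp
  from this P have "((pi/2 + sin (pi/2) * cos (pi/2)) / 2 - (0 + sin 0 * cos 0) / 2) \<le> ellP q"
  proof (rule has_integral_le)
    fix x
    have D: "0 < Del q x" "Del q x \<le> 1" using Del_pos[OF q(1)] Del_le_1 by auto
    have "(cos x)\<^sup>2 * Del q x \<le> (cos x)\<^sup>2 * 1" using D by (intro mult_left_mono) auto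
    also have "(cos x)\<^sup>2 * 1 \<le> 2 * (Del q x)\<^sup>2 - 1"
      unfolding Del_sq[OF q(1)] cos_squared_eq using mult_right_mono[OF q(2), of "(sin x)\<^sup>2"] by simp
    finally show "(cos x)\<^sup>2 \<le> 2 * Del q x - 1 / Del q x"
      using D by (simp add: field_simps power2_eq_square)
  qed
  then show ?thesis using pi_gt_zero by (simp del: pi_gt_zero)
qed

section \<open>The special moduli \<open>qstar\<close> and \<open>qhat\<close>\<close>

lemma inverse_sqrt2: "0 < 1 / sqrt 2" "1 / sqrt 2 < 1" "(1 / sqrt 2)\<^sup>2 = 1 / 2"
  by (auto simp: power_divide)

lemma inverse_sqrt2_le_pos: "1 / sqrt 2 \<le> q \<Longrightarrow> 0 < q"
  by (rule less_le_trans[OF inverse_sqrt2(1)])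

lemma half_le_sq: "1 / sqrt 2 \<le> q \<Longrightarrow> 1/2 \<le> q\<^sup>2"
  using power_mono[of "1 / sqrt 2" q 2] inverse_sqrt2 by simp

lemma half_less_sq: "1 / sqrt 2 < q \<Longrightarrow> 1/2 < q\<^sup>2"
  using power_strict_mono[of "1 / sqrt 2" q 2] inverse_sqrt2 by simp

text \<open>\<open>ellEc\<close> never exceeds \<open>pi/2\<close> while \<open>ellK\<close> is
  unbounded, so \<open>ellP\<close>, still positive at \<open>1 / sqrt 2\<close>, changes sign
  further right.\<close>

lemma qstar_props: "1 / sqrt 2 < qstar" "qstar < 1" "ellP qstar = 0"
proof -
  let ?r = "1 / sqrt 2"
  have Pr: "ellP ?r > 0" using inverse_sqrt2 by (intro ellP_pos_half) auto
  obtain q where q: "?r < q" "q < 1" "ellK q > pi" using ellK_unbounded[OF inverse_sqrt2(2)] by blast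
  have "ellP q < 0" using q(3) ellEc_le[of q] by (simp add: ellP_def)
  then have "\<exists>x. ?r \<le> x \<and> x \<le> q \<and> ellP x = 0"
    using Pr q by (intro IVT2' continuous_on_ell) (auto dest: inverse_sqrt2_le_pos)
  then obtain x where x: "?r \<le> x" "x \<le> q" "ellP x = 0" by blast
  have "?r \<noteq> x" using x Pr by auto
  moreover have "qstar = x"
    unfolding qstar_def
  proof (rule the_equality)
    show "0 < x \<and> x < 1 \<and> 2 * ellEc x - ellK x = 0" using x q inverse_sqrt2_le_pos unfolding ellP_def by auto
    fix y assume "0 < y \<and> y < 1 \<and> 2 * ellEc y - ellK y = 0"
    then show "y = x" using ellP_strict_anti[of x y] ellP_strict_anti[of y x] x q inverse_sqrt2_le_pos[of x]
      unfolding ellP_def[symmetric] by force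
  qed
  ultimately show "?r < qstar" "qstar < 1" "ellP qstar = 0" using x q by auto
qed

lemma qstar_pos: "0 < qstar" using qstar_props inverse_sqrt2 by linarith

lemma ellP_pos: "0 < q \<Longrightarrow> q < qstar \<Longrightarrow> ellP q > 0"
  using ellP_strict_anti[of q qstar] qstar_props by auto

lemma ellP_neg: "qstar < q \<Longrightarrow> q < 1 \<Longrightarrow> ellP q < 0"
  using ellP_strict_anti[of qstar q] qstar_props qstar_pos by auto

lemma DERIV_fq:
  assumes q: "0 < q" "q < 1"
  shows "(fq has_real_derivative q * ((20 * q\<^sup>2 - 13) * ellK q + (20 - 40 * q\<^sup>2) * ellEc q)) (at q)"
proof -
  have p: "1 - q\<^sup>2 > 0" using q by (simp add: abs_square_less_1)
  define K E where "K = ellK q" and "E = ellEc q"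
  have "(fq has_real_derivative ((16 * q^3 - 10 * q) * ellK q
      + (ellEc q - (1 - q\<^sup>2) * ellK q) / (q * (1 - q\<^sup>2)) * (4*q^4 - 5*q\<^sup>2 + 1))
      + ((-32 * q^3 + 16 * q) * ellEc q + (ellEc q - ellK q) / q * (-8*q^4 + 8*q\<^sup>2 - 1))) (at q)"
    unfolding fq_def[abs_def]
    by (intro DERIV_add DERIV_mult DERIV_ellEc DERIV_ellK q) (auto intro!: derivative_eq_intros)
  moreover have "((16 * q^3 - 10 * q) * K
      + (E - (1 - q\<^sup>2) * K) / (q * (1 - q\<^sup>2)) * (4*q^4 - 5*q\<^sup>2 + 1))
      + ((-32 * q^3 + 16 * q) * E + (E - K) / q * (-8*q^4 + 8*q\<^sup>2 - 1))
      = q * ((20 * q\<^sup>2 - 13) * K + (20 - 40 * q\<^sup>2) * E)"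
  proof -
    have "4*q^4 - 5*q\<^sup>2 + 1 = (1 - q\<^sup>2) * (1 - 4 * q\<^sup>2)" by (simp add: algebra_simps eval_nat_numeral)
    then have "(E - (1 - q\<^sup>2) * K) / (q * (1 - q\<^sup>2)) * (4*q^4 - 5*q\<^sup>2 + 1) = (E - (1 - q\<^sup>2) * K) / q * (1 - 4 * q\<^sup>2)"
      using p by simp
    then show ?thesis
      using q by (simp add: field_simps) (simp add: algebra_simps eval_nat_numeral)
  qed
  ultimately show ?thesis unfolding K_def E_def by (rule DERIV_cong)
qed

text \<open>Here K >= 2E, and the coefficient of K in \<open>fq\<close> factors as -(1 - q^2)(4 q^2
  - 1) < 0. Replacing K by 2E therefore gives an upper bound, and this bound collapses to (1 - 2
  q^2) E.\<close>

lemma fq_neg_right: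
  assumes "qstar \<le> q" "q < 1"
  shows "fq q < 0"
proof -
  have q: "0 < q" "1/2 < q\<^sup>2" "q\<^sup>2 < 1"
    using assms qstar_props half_less_sq[of q] qstar_pos by (auto simp: abs_square_less_1)
  have P: "2 * ellEc q \<le> ellK q"
    using ellP_neg[of q] qstar_props assms by (cases "q = qstar") (auto simp: ellP_def)
  have E: "ellEc q > 0" using ellEc_pos assms q by auto
  have "4*q^4 - 5*q\<^sup>2 + 1 = - ((1 - q\<^sup>2) * (4 * q\<^sup>2 - 1))" by (simp add: algebra_simps eval_nat_numeral)
  moreover have "(1 - q\<^sup>2) * (4 * q\<^sup>2 - 1) > 0" using q by (intro mult_pos_pos) auto
  ultimately have "(4*q^4 - 5*q\<^sup>2 + 1) * ellK q \<le> (4*q^4 - 5*q\<^sup>2 + 1) * (2 * ellEc q)"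
    using P by (intro mult_left_mono_neg) auto
  then have "fq q \<le> (1 - 2 * q\<^sup>2) * ellEc q" unfolding fq_def by (simp add: algebra_simps)
  also have "\<dots> < 0" using q E by (intro mult_neg_pos) auto
  finally show ?thesis .
qed

text \<open>Left of \<open>qstar\<close> one has K <= 2E. As 20 - 40 z^2 <= 0, replacing 2E by K in
  the derivative bounds it by -3 z K.\<close>

lemma fq_anti:
  assumes "1 / sqrt 2 \<le> x" "x < y" "y \<le> qstar"
  shows "fq y < fq x"
proof (rule DERIV_neg_imp_decreasing[OF assms(2)])
  fix z assume z: "x \<le> z" "z \<le> y"
  have z0: "0 < z" "z < 1" "1/2 \<le> z\<^sup>2"
    using z assms inverse_sqrt2_le_pos[of z] qstar_props half_le_sq[of z] by auto
  have P: "ellK z \<le> 2 * ellEc z"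
    using ellP_pos[of z] qstar_props z0 z assms by (cases "z = qstar") (auto simp: ellP_def)
  have K: "ellK z > 0" using ellK_pos z0 by auto
  have "(10 - 20 * z\<^sup>2) * (2 * ellEc z) \<le> (10 - 20 * z\<^sup>2) * ellK z"
    using P z0 by (intro mult_left_mono_neg) auto
  then have "(20 * z\<^sup>2 - 13) * ellK z + (20 - 40 * z\<^sup>2) * ellEc z \<le> - 3 * ellK z" by (simp add: algebra_simps)
  then have "(20 * z\<^sup>2 - 13) * ellK z + (20 - 40 * z\<^sup>2) * ellEc z < 0" using K by linarith
  then have "z * ((20 * z\<^sup>2 - 13) * ellK z + (20 - 40 * z\<^sup>2) * ellEc z) < 0" using z0 by (simp add: mult_pos_neg)
  then show "\<exists>d. (fq has_real_derivative d) (at z) \<and> d < 0" using DERIV_fq z0 by blast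
qed

text \<open>At \<open>1 / sqrt 2\<close> the value of \<open>fq\<close> is half of
  \<open>ellP\<close>, hence positive. Uniqueness combines strict decrease up to
  \<open>qstar\<close> with negativity beyond it.\<close>

lemma qhat_props: "1 / sqrt 2 < qhat" "qhat < qstar" "fq qhat = 0"
proof -
  let ?r = "1 / sqrt 2"
  have "?r ^ 4 = (?r\<^sup>2)\<^sup>2" by (simp only: power_mult[symmetric]) simp
  then have r4: "?r ^ 4 = 1/4" unfolding inverse_sqrt2(3) by (simp add: power2_eq_square)
  have "fq ?r = ellP ?r / 2" unfolding fq_def r4 inverse_sqrt2(3) ellP_def by (simp add: field_simps)
  then have fr: "fq ?r > 0" using ellP_pos_half[of ?r] inverse_sqrt2 by auto
  have fs: "fq qstar < 0" using fq_neg_right qstar_props by simp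
  have "\<exists>x. ?r \<le> x \<and> x \<le> qstar \<and> fq x = 0"
  proof (rule IVT2')
    show "continuous_on {?r..qstar} fq"
      unfolding fq_def[abs_def] using qstar_props(2)
      by (intro continuous_intros continuous_on_ell) (auto dest: inverse_sqrt2_le_pos)
  qed (use fr fs qstar_props in auto)
  then obtain x where x: "?r \<le> x" "x \<le> qstar" "fq x = 0" by blast
  have "?r \<noteq> x" "x \<noteq> qstar" using x fr fs by auto
  moreover have "qhat = x"
    unfolding qhat_def
  proof (rule the_equality)
    show "?r \<le> x \<and> x < 1 \<and> fq x = 0" using x qstar_props by auto
    fix y assume y: "?r \<le> y \<and> y < 1 \<and> fq y = 0"
    then have "y < qstar" using fq_neg_right[of y] by force
    then show "y = x" using fq_anti[of x y] fq_anti[of y x] x y by force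
  qed
  ultimately show "?r < qhat" "qhat < qstar" "fq qhat = 0" using x by auto
qed

lemma qhat_bounds: "0 < qhat" "qhat < 1" using qhat_props qstar_props inverse_sqrt2 by linarith+

lemma fq_pos: "1 / sqrt 2 \<le> q \<Longrightarrow> q < qhat \<Longrightarrow> fq q > 0"
  using fq_anti[of q qhat] qhat_props by auto

lemma fq_neg: "qhat < q \<Longrightarrow> q < 1 \<Longrightarrow> fq q < 0"
  using fq_anti[of qhat q] qhat_props fq_neg_right[of q] by (cases "q < qstar") auto

section \<open>The shape of \<open>gq\<close> and its three inverse branches\<close>

lemma gq_eq: "gq q = 8 * (ellP q)\<^sup>2 * (2 * q\<^sup>2 - 1)"
  by (simp add: gq_def ellP_def)

text \<open>This is the origin of \<open>fq\<close>: it is the factor left in the derivative of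
  \<open>gq\<close> once \<open>ellP\<close> and the positive factor 16 / (q (1 - q^2)) are taken
  out.\<close>

lemma DERIV_gq:
  assumes q: "0 < q" "q < 1"
  shows "(gq has_real_derivative 16 * ellP q * fq q / (q * (1 - q\<^sup>2))) (at q)"
proof -
  have p: "1 - q\<^sup>2 > 0" using q by (simp add: abs_square_less_1)
  have q0: "q \<noteq> 0" "1 - q\<^sup>2 \<noteq> 0" using q p by auto
  let ?d = "((1 - 2 * q\<^sup>2) * ellEc q - (1 - q\<^sup>2) * ellK q) / (q * (1 - q\<^sup>2))"
  have "(gq has_real_derivative 8 * (2 * ellP q * ?d) * (2 * q\<^sup>2 - 1) + (2 * (2 * q)) * (8 * (ellP q)\<^sup>2)) (at q)"
    unfolding gq_eq[abs_def]
    by (intro DERIV_mult DERIV_cmult) (auto intro!: derivative_eq_intros DERIV_ellP q)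
  moreover have "8 * (2 * ellP q * ?d) * (2 * q\<^sup>2 - 1) + (2 * (2 * q)) * (8 * (ellP q)\<^sup>2) = 16 * ellP q * fq q / (q * (1 - q\<^sup>2))"
  proof -
    have f: "fq q = ((1 - 2 * q\<^sup>2) * ellEc q - (1 - q\<^sup>2) * ellK q) * (2 * q\<^sup>2 - 1) + 2 * q * (q * (1 - q\<^sup>2)) * ellP q"
      unfolding fq_def ellP_def by (simp add: algebra_simps eval_nat_numeral)
    have eq: "?d * (2 * q\<^sup>2 - 1) + 2 * q * ellP q = fq q / (q * (1 - q\<^sup>2))"
      unfolding f using q0 by (simp add: add_divide_distrib)
    have alg: "8 * (2 * P * d) * t + (2 * (2 * q)) * (8 * P\<^sup>2) = 16 * P * (d * t + 2 * q * P)" for P d t :: real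
      by (simp add: algebra_simps power2_eq_square)
    show ?thesis unfolding alg eq by simp
  qed
  ultimately show ?thesis by (rule DERIV_cong)
qed

lemma isCont_gq: "0 < q \<Longrightarrow> q < 1 \<Longrightarrow> isCont gq q"
  using DERIV_gq DERIV_isCont by blast

lemma continuous_on_gq: "0 < a \<Longrightarrow> b < 1 \<Longrightarrow> continuous_on {a..b} gq"
  using isCont_gq by (simp add: continuous_at_imp_continuous_on)

text \<open>The derivative has the sign of \<open>ellP z * fq z\<close>, whose factors change sign
  at \<open>qstar\<close> and \<open>qhat\<close>; this accounts for the three intervals of
  monotonicity. Since the derivative vanishes at these two points, only interior points are
  tested.\<close>

lemma gq_increasing_left:
  assumes "1 / sqrt 2 \<le> x" "x < y" "y \<le> qhat"
  shows "gq x < gq y"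
proof (rule DERIV_pos_imp_increasing_open[OF assms(2)])
  fix z assume z: "x < z" "z < y"
  have "0 < z" "z < 1" "z < qstar"
    using z assms inverse_sqrt2_le_pos[of z] qhat_props qstar_props by auto
  moreover have "z\<^sup>2 < 1" using calculation by (simp add: abs_square_less_1)
  moreover have "fq z > 0" using fq_pos z assms by auto
  ultimately have "16 * ellP z * fq z / (z * (1 - z\<^sup>2)) > 0"
    using ellP_pos[of z] by (intro divide_pos_pos mult_pos_pos) auto
  then show "\<exists>d. (gq has_real_derivative d) (at z) \<and> 0 < d"
    using DERIV_gq[of z] \<open>0 < z\<close> \<open>z < 1\<close> by blast
next
  have "0 < x" "y < 1" using assms inverse_sqrt2_le_pos[of x] qhat_props qstar_props by auto
  then show "continuous_on {x..y} gq" by (rule continuous_on_gq)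
qed

lemma gq_decreasing_mid:
  assumes "qhat \<le> x" "x < y" "y \<le> qstar"
  shows "gq y < gq x"
proof (rule DERIV_neg_imp_decreasing_open[OF assms(2)])
  fix z assume z: "x < z" "z < y"
  have "0 < z" "z < 1" "z < qstar"
    using z assms inverse_sqrt2_le_pos[of z] qhat_props qstar_props by auto
  moreover have "z\<^sup>2 < 1" using calculation by (simp add: abs_square_less_1)
  moreover have "fq z < 0" using fq_neg z assms calculation by auto
  ultimately have "16 * ellP z * fq z / (z * (1 - z\<^sup>2)) < 0" 
    using ellP_pos[of z] by (intro divide_neg_pos mult_pos_neg) auto
  then show "\<exists>d. (gq has_real_derivative d) (at z) \<and> d < 0"
    using DERIV_gq[of z] \<open>0 < z\<close> \<open>z < 1\<close> by blast
next
  have "0 < x" "y < 1" using assms inverse_sqrt2_le_pos[of x] qhat_props qstar_props by auto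
  then show "continuous_on {x..y} gq" by (rule continuous_on_gq)
qed

lemma gq_increasing_right:
  assumes "qstar \<le> x" "x < y" "y < 1"
  shows "gq x < gq y"
proof (rule DERIV_pos_imp_increasing_open[OF assms(2)])
  fix z assume z: "x < z" "z < y"
  have "0 < z" "z < 1" "qstar < z" using z assms qstar_pos by auto
  moreover have "z\<^sup>2 < 1" using calculation by (simp add: abs_square_less_1)
  moreover have "fq z < 0" using fq_neg_right[of z] calculation by auto
  ultimately have "16 * ellP z * fq z / (z * (1 - z\<^sup>2)) > 0"
    using ellP_neg[of z] by (intro divide_pos_pos mult_neg_neg mult_pos_pos) auto
  then show "\<exists>d. (gq has_real_derivative d) (at z) \<and> 0 < d"
    using DERIV_gq[of z] \<open>0 < z\<close> \<open>z < 1\<close> by blast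
next
  have "0 < x" "y < 1" using assms qstar_pos by auto
  then show "continuous_on {x..y} gq" by (rule continuous_on_gq)
qed

lemma q1_props:
  assumes "0 < c" "c \<le> lamhat"
  shows "1 / sqrt 2 < q1 c" "q1 c \<le> qhat" "gq (q1 c) = c"
proof -
  let ?r = "1 / sqrt 2"
  have g: "gq ?r = 0" unfolding gq_def inverse_sqrt2(3) by simp
  have "\<exists>x. ?r \<le> x \<and> x \<le> qhat \<and> gq x = c"
    using assms g qhat_props inverse_sqrt2 qhat_bounds by (intro IVT' continuous_on_gq) (auto simp: lamhat_def)
  then obtain x where x: "?r \<le> x" "x \<le> qhat" "gq x = c" by blast
  have "?r \<noteq> x" using x g assms by auto
  moreover have "q1 c = x" unfolding q1_def
  proof (rule the_equality)
    show "?r < x \<and> x \<le> qhat \<and> gq x = c" using x \<open>?r \<noteq> x\<close> by auto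
    fix y assume "?r < y \<and> y \<le> qhat \<and> gq y = c"
    then show "y = x" using gq_increasing_left[of x y] gq_increasing_left[of y x] x by (cases x y rule: linorder_cases) auto
  qed
  ultimately show "?r < q1 c" "q1 c \<le> qhat" "gq (q1 c) = c" using x by auto
qed

lemma q2_props:
  assumes "0 < c" "c < lamhat"
  shows "qhat < q2 c" "q2 c < qstar" "gq (q2 c) = c"
proof -
  have g: "gq qstar = 0" unfolding gq_eq qstar_props(3) by simp
  have "\<exists>x. qhat \<le> x \<and> x \<le> qstar \<and> gq x = c"
    using assms g qhat_props inverse_sqrt2 qhat_bounds qstar_props by (intro IVT2' continuous_on_gq) (auto simp: lamhat_def)
  then obtain x where x: "qhat \<le> x" "x \<le> qstar" "gq x = c" by blast
  have n: "qhat \<noteq> x" "x \<noteq> qstar" using x g assms by (auto simp: lamhat_def)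
  moreover have "q2 c = x" unfolding q2_def
  proof (rule the_equality)
    show "qhat \<le> x \<and> x < qstar \<and> gq x = c" using x n by auto
    fix y assume "qhat \<le> y \<and> y < qstar \<and> gq y = c"
    then show "y = x" using gq_decreasing_mid[of x y] gq_decreasing_mid[of y x] x by (cases x y rule: linorder_cases) auto
  qed
  ultimately show "qhat < q2 c" "q2 c < qstar" "gq (q2 c) = c" using x by auto
qed

lemma q3_props:
  assumes "0 < c"
  shows "qstar < q3 c" "q3 c < 1" "gq (q3 c) = c"
proof -
  have g: "gq qstar = 0" unfolding gq_eq qstar_props(3) by simp
  \<comment> \<open>The bound 3/4 on s^2 makes \<open>2 * s\<^sup>2 - 1\<close> at least 1/2, and
    the bound on \<open>ellK s\<close> makes \<open>- ellP s\<close> at least c + 1; together they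
    force \<open>gq s >= c\<close>.\<close>
  obtain s where s: "max qstar (sqrt (3/4)) < s" "s < 1" "ellK s > pi + (c + 1)"
    using ellK_unbounded[of "max qstar (sqrt (3/4))" "pi + (c + 1)"] qstar_props by auto
  have "(sqrt (3/4))\<^sup>2 < s\<^sup>2" using s by (intro power_strict_mono) auto
  then have s2: "1/2 \<le> 2 * s\<^sup>2 - 1" by simp
  have "c + 1 \<le> - ellP s" using s(3) ellEc_le[of s] by (simp add: ellP_def)
  then have "(c + 1)\<^sup>2 \<le> (ellP s)\<^sup>2" using power_mono[of "c + 1" "- ellP s" 2] assms by simp
  moreover have "c \<le> (c + 1)\<^sup>2" using assms zero_le_power2[of c] by (simp add: power2_sum del: zero_le_power2)
  ultimately have "c * (1/2) \<le> (ellP s)\<^sup>2 * (2 * s\<^sup>2 - 1)" using s2 assms by (intro mult_mono) auto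
  then have "c \<le> gq s" using assms unfolding gq_eq by simp
  then have "\<exists>x. qstar \<le> x \<and> x \<le> s \<and> gq x = c"
    using assms g s qstar_pos by (intro IVT' continuous_on_gq) auto
  then obtain x where x: "qstar \<le> x" "x \<le> s" "gq x = c" by blast
  have n: "qstar \<noteq> x" using x g assms by (auto simp: lamhat_def)
  moreover have "q3 c = x" unfolding q3_def
  proof (rule the_equality)
    show "qstar < x \<and> x < 1 \<and> gq x = c" using x n s by auto
    fix y assume "qstar < y \<and> y < 1 \<and> gq y = c"
    then show "y = x" using gq_increasing_right[of x y] gq_increasing_right[of y x] x s by (cases x y rule: linorder_cases) auto
  qed
  ultimately show "qstar < q3 c" "q3 c < 1" "gq (q3 c) = c" using x s by auto
qed

section \<open>Length and energy of the arc with chord \<open>l\<close> as functions of its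
  modulus\<close>

definition arc_energy :: "real \<Rightarrow> real \<Rightarrow> real \<Rightarrow> real" where
  "arc_energy lam l q = 16 / l * (ellP q * ellH q) + lam * l * (ellK q / ellP q)"

text \<open>The numerator of the quotient rule is rearranged into a positive combination of squares.
  Thus the length \<open>l * (ellK q / ellP q)\<close> grows strictly with the modulus, and lengths
  can be translated back into moduli.\<close>

lemma ellK_ellP_deriv:
  assumes q: "0 < q" "q < qstar"
  shows "((\<lambda>q. ellK q / ellP q) has_real_derivative
     2 * ((ellH q)\<^sup>2 + (1 - q\<^sup>2) * q\<^sup>2 * (ellK q)\<^sup>2) / (q * (1 - q\<^sup>2) * (ellP q)\<^sup>2)) (at q)"
proof -
  have q': "q < 1" using q qstar_props by auto
  have p: "1 - q\<^sup>2 > 0" using q q' by (simp add: abs_square_less_1)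
  have P: "ellP q > 0" using ellP_pos q by auto
  define K E Pq p where d: "K = ellK q" "E = ellEc q" "Pq = ellP q" "p = 1 - q\<^sup>2"
  let ?d = "((1 - 2 * q\<^sup>2) * ellEc q - (1 - q\<^sup>2) * ellK q) / (q * (1 - q\<^sup>2))"
  have "((\<lambda>q. ellK q / ellP q) has_real_derivative
     (ellH q / (q * (1 - q\<^sup>2)) * ellP q - ellK q * ?d) / (ellP q * ellP q)) (at q)"
    using P unfolding ellH_def by (intro DERIV_divide DERIV_ellK DERIV_ellP q q') auto
  moreover have "(ellH q / (q * (1 - q\<^sup>2)) * ellP q - ellK q * ?d) / (ellP q * ellP q)
     = 2 * ((ellH q)\<^sup>2 + (1 - q\<^sup>2) * q\<^sup>2 * (ellK q)\<^sup>2) / (q * (1 - q\<^sup>2) * (ellP q)\<^sup>2)"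
  proof -
    have n: "ellH q * ellP q - ellK q * ((1 - 2 * q\<^sup>2) * ellEc q - (1 - q\<^sup>2) * ellK q)
       = 2 * ((ellH q)\<^sup>2 + (1 - q\<^sup>2) * q\<^sup>2 * (ellK q)\<^sup>2)"
      unfolding ellH_def ellP_def by (simp add: algebra_simps eval_nat_numeral)
    have "(ellH q / (q * (1 - q\<^sup>2)) * ellP q - ellK q * ?d) / (ellP q * ellP q)
        = (ellH q * ellP q - ellK q * ((1 - 2 * q\<^sup>2) * ellEc q - (1 - q\<^sup>2) * ellK q)) / (q * (1 - q\<^sup>2) * (ellP q)\<^sup>2)"
    proof -
      have "(h / w * P - K * (d / w)) / (P * P) = (h * P - K * d) / (w * P\<^sup>2)" for h w P K d :: real
        by (simp add: diff_divide_distrib power2_eq_square)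
      then show ?thesis .
    qed
    then show ?thesis unfolding n .
  qed
  ultimately show ?thesis by (rule DERIV_cong)
qed

lemma ellK_ellP_deriv_pos:
  assumes q: "0 < q" "q < qstar"
  shows "2 * ((ellH q)\<^sup>2 + (1 - q\<^sup>2) * q\<^sup>2 * (ellK q)\<^sup>2) / (q * (1 - q\<^sup>2) * (ellP q)\<^sup>2) > 0"
proof -
  have q': "q < 1" using q qstar_props by auto
  have p: "1 - q\<^sup>2 > 0" using q q' by (simp add: abs_square_less_1)
  have P: "ellP q > 0" "ellK q > 0" using ellP_pos ellK_pos q q' by auto
  show ?thesis using p P q
    by (intro divide_pos_pos mult_pos_pos add_nonneg_pos) auto
qed

text \<open>The derivative of \<open>ellP * ellH\<close> is (1 - 2 q^2) times the same combination
  of squares that occurs in the derivative of \<open>ellK / ellP\<close>, divided by q (1 - q^2).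
  Taking out this common factor leaves the difference of \<open>lam * l\<^sup>2\<close> and
  \<open>gq q\<close>.\<close>

lemma DERIV_arc_energy:
  assumes q: "0 < q" "q < qstar" and l: "l > 0"
  shows "(arc_energy lam l has_real_derivative
     2 * ((ellH q)\<^sup>2 + (1 - q\<^sup>2) * q\<^sup>2 * (ellK q)\<^sup>2) / (q * (1 - q\<^sup>2) * (ellP q)\<^sup>2)
      * (lam * l\<^sup>2 - gq q) / l) (at q)"
proof -
  have q': "q < 1" using q qstar_props by auto
  have p: "1 - q\<^sup>2 > 0" using q q' by (simp add: abs_square_less_1)
  have P: "ellP q > 0" using ellP_pos q by auto
  let ?d = "((1 - 2 * q\<^sup>2) * ellEc q - (1 - q\<^sup>2) * ellK q) / (q * (1 - q\<^sup>2))"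
  let ?M = "(ellH q)\<^sup>2 + (1 - q\<^sup>2) * q\<^sup>2 * (ellK q)\<^sup>2"
  have "(arc_energy lam l has_real_derivative
     16 / l * (?d * ellH q + q * ellK q * ellP q) + lam * l * (2 * ?M / (q * (1 - q\<^sup>2) * (ellP q)\<^sup>2))) (at q)"
    unfolding arc_energy_def[abs_def]
    by (intro DERIV_add DERIV_cmult DERIV_mult DERIV_ellH DERIV_ellP ellK_ellP_deriv q q')
  moreover have "?d * ellH q + q * ellK q * ellP q = (1 - 2 * q\<^sup>2) * ?M / (q * (1 - q\<^sup>2))"
  proof -
    have "?d * ellH q + q * ellK q * ellP q
      = (((1 - 2 * q\<^sup>2) * ellEc q - (1 - q\<^sup>2) * ellK q) * ellH q + q\<^sup>2 * (1 - q\<^sup>2) * ellK q * ellP q) / (q * (1 - q\<^sup>2))"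
      using p q by (simp add: add_divide_distrib power2_eq_square)
    also have "((1 - 2 * q\<^sup>2) * ellEc q - (1 - q\<^sup>2) * ellK q) * ellH q + q\<^sup>2 * (1 - q\<^sup>2) * ellK q * ellP q
      = (1 - 2 * q\<^sup>2) * ?M"
      unfolding ellH_def ellP_def by (simp add: algebra_simps eval_nat_numeral)
    finally show ?thesis .
  qed
  moreover have "16 / l * ((1 - 2 * q\<^sup>2) * ?M / (q * (1 - q\<^sup>2))) + lam * l * (2 * ?M / (q * (1 - q\<^sup>2) * (ellP q)\<^sup>2))
     = 2 * ?M / (q * (1 - q\<^sup>2) * (ellP q)\<^sup>2) * (lam * l\<^sup>2 - gq q) / l"
  proof -
    define M where "M = ?M"
    define w where "w = q * (1 - q\<^sup>2)"
    have w: "w > 0" using p q by (simp add: w_def)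
    show ?thesis unfolding gq_eq M_def[symmetric] w_def[symmetric]
      using w P l by (simp add: field_simps power2_eq_square)
  qed
  ultimately show ?thesis by (simp only:)
qed

section \<open>Absolutely continuous functions on an interval\<close>

text \<open>The function \<open>f\<close> is absolutely continuous on \<open>{a..b}\<close> with derivative \<open>h\<close>.\<close>

definition prim_on :: "real \<Rightarrow> real \<Rightarrow> (real \<Rightarrow> real) \<Rightarrow> (real \<Rightarrow> real) \<Rightarrow> bool" where
  "prim_on a b f h \<longleftrightarrow> h absolutely_integrable_on {a..b} \<and> (\<forall>t\<in>{a..b}. f t = f a + integral {a..t} h)"

lemma absolutely_integrable_continuous_mult:
  fixes c h :: "real \<Rightarrow> real"
  assumes "continuous_on {a..b} c" "h absolutely_integrable_on {a..b}"
  shows "(\<lambda>t. c t * h t) absolutely_integrable_on {a..b}"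
proof (rule absolutely_integrable_bounded_measurable_product_real)
  show "c \<in> borel_measurable (lebesgue_on {a..b})"
    using assms(1) by (rule continuous_imp_measurable_on_sets_lebesgue) simp
  show "bounded (c ` {a..b})"
    using assms(1) by (intro compact_imp_bounded compact_continuous_image) auto
qed (use assms in auto)

lemma prim_onD:
  assumes "prim_on a b f h"
  shows "h absolutely_integrable_on {a..b}" "h integrable_on {a..b}"
    "\<And>t. t \<in> {a..b} \<Longrightarrow> f t = f a + integral {a..t} h"
  using assms set_lebesgue_integral_eq_integral(1) unfolding prim_on_def by blast+

lemma prim_on_integrable:
  assumes "prim_on a b f h" "a \<le> s" "t \<le> b"
  shows "h absolutely_integrable_on {s..t}" "h integrable_on {s..t}"
proof -
  show "h absolutely_integrable_on {s..t}"
    using absolutely_integrable_on_subinterval[OF prim_onD(1)[OF assms(1)]] assms by auto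
  then show "h integrable_on {s..t}" by (rule set_lebesgue_integral_eq_integral(1))
qed

lemma prim_on_diff:
  assumes "prim_on a b f h" "a \<le> s" "s \<le> t" "t \<le> b"
  shows "integral {s..t} h = f t - f s"
proof -
  have "integral {a..s} h + integral {s..t} h = integral {a..t} h"
    using assms by (intro Henstock_Kurzweil_Integration.integral_combine prim_on_integrable[OF assms(1)]) auto
  then show ?thesis using prim_onD(3)[OF assms(1), of s] prim_onD(3)[OF assms(1), of t] assms by auto
qed

lemma prim_on_continuous:
  assumes "prim_on a b f h"
  shows "continuous_on {a..b} f"
proof -
  have "continuous_on {a..b} (\<lambda>t. f a + integral {a..t} h)"
    by (intro continuous_intros indefinite_integral_continuous_1 prim_onD(2)[OF assms])
  then show ?thesis
    by (rule continuous_on_eq) (simp add: prim_onD(3)[OF assms, symmetric])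
qed

lemma prim_on_subset:
  assumes "prim_on a b f h" "a \<le> c" "d \<le> b"
  shows "prim_on c d f h"
  unfolding prim_on_def
  using prim_on_integrable(1)[OF assms] prim_on_diff[OF assms(1,2)] assms by auto

lemma prim_on_C1:
  assumes "\<And>t. t \<in> {a..b} \<Longrightarrow> (f has_real_derivative f' t) (at t within {a..b})" "continuous_on {a..b} f'"
  shows "prim_on a b f f'"
  unfolding prim_on_def
proof (intro conjI ballI)
  show "f' absolutely_integrable_on {a..b}" using assms(2) by (rule absolutely_integrable_continuous_real)
  fix t assume t: "t \<in> {a..b}"
  have "(f' has_integral (f t - f a)) {a..t}"
    using t by (intro fundamental_theorem_of_calculus)
      (auto simp: has_real_derivative_iff_has_vector_derivative[symmetric]
        intro!: has_field_derivative_subset[OF assms(1)])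
  then show "f t = f a + integral {a..t} f'" by (simp add: integral_unique)
qed

lemma prim_on_add:
  assumes "prim_on a b f h" "prim_on a b g k"
  shows "prim_on a b (\<lambda>t. f t + g t) (\<lambda>t. h t + k t)"
  unfolding prim_on_def
proof (intro conjI ballI)
  show "(\<lambda>t. h t + k t) absolutely_integrable_on {a..b}"
    using assms by (intro set_integral_add(1) prim_onD)
  fix t assume t: "t \<in> {a..b}"
  have "integral {a..t} (\<lambda>t. h t + k t) = integral {a..t} h + integral {a..t} k"
    using t by (intro Henstock_Kurzweil_Integration.integral_add prim_on_integrable[OF assms(1)] prim_on_integrable[OF assms(2)]) auto
  then show "f t + g t = f a + g a + integral {a..t} (\<lambda>t. h t + k t)"
    using prim_onD(3)[OF assms(1) t] prim_onD(3)[OF assms(2) t] by simp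
qed

lemma prim_on_cmult:
  assumes "prim_on a b f h"
  shows "prim_on a b (\<lambda>t. c * f t) (\<lambda>t. c * h t)"
  unfolding prim_on_def
proof (intro conjI ballI)
  show "(\<lambda>t. c * h t) absolutely_integrable_on {a..b}"
    using prim_onD(1)[OF assms] by (intro absolutely_integrable_continuous_mult) auto
  fix t assume t: "t \<in> {a..b}"
  then show "c * f t = c * f a + integral {a..t} (\<lambda>t. c * h t)"
    using prim_onD(3)[OF assms t] by (simp add: algebra_simps)
qed

lemma prim_on_cong:
  assumes "prim_on a b f h" "\<And>t. t \<in> {a..b} \<Longrightarrow> f t = g t" "\<And>t. t \<in> {a..b} \<Longrightarrow> h t = k t"
  shows "prim_on a b g k"
  unfolding prim_on_def
proof (intro conjI ballI)
  show "k absolutely_integrable_on {a..b}"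
    by (rule absolutely_integrable_spike[OF prim_onD(1)[OF assms(1)], of "{}"]) (auto simp: assms(3))
  fix t assume t: "t \<in> {a..b}"
  have "integral {a..t} h = integral {a..t} k" using t assms(3) by (intro integral_cong) auto
  then show "g t = g a + integral {a..t} k"
    using prim_onD(3)[OF assms(1) t] assms(2)[OF t] assms(2)[of a] t by auto
qed

text \<open>The increments are summed over a uniform partition finer than \<open>d\<close>, and the
  right sides telescope. In the chain rule \<open>w\<close> is the composite minus the candidate
  primitive, and \<open>H\<close> is the indefinite integral of the absolute value of the
  derivative.\<close>

lemma constant_of_small_increments:
  fixes w H :: "real \<Rightarrow> real"
  assumes small: "\<And>e. e > 0 \<Longrightarrow> \<exists>d>0. \<forall>s t. a \<le> s \<and> s \<le> t \<and> t \<le> b \<and> t < s + d \<longrightarrow>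
      \<bar>w t - w s\<bar> \<le> e * (H t - H s)"
    and T: "a \<le> T" "T \<le> b"
  shows "w T = w a"
proof -
  have "\<bar>w T - w a\<bar> \<le> e * (H T - H a)" if e: "e > 0" for e
  proof -
    obtain d where d: "d > 0"
      "\<And>s t. a \<le> s \<Longrightarrow> s \<le> t \<Longrightarrow> t \<le> b \<Longrightarrow> t < s + d \<Longrightarrow> \<bar>w t - w s\<bar> \<le> e * (H t - H s)"
      using small[OF e] by blast
    obtain n where n: "(T - a) / d < real n" using reals_Archimedean2 by blast
    have n0: "0 < n"
    proof (rule ccontr)
      assume "\<not> 0 < n" then show False using n T d by (simp add: divide_less_0_iff)
    qed
    define D where "D = (T - a) / n"
    define x where "x k = a + real k * D" for k
    have D: "0 \<le> D" "real n * D = T - a" using T n0 by (auto simp: D_def)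
    have step: "x (Suc k) = x k + D" for k by (simp add: x_def algebra_simps)
    have sm: "D < d" using n n0 d by (simp add: D_def field_simps)
    have "\<bar>w (x k) - w a\<bar> \<le> e * (H (x k) - H a)" if "k \<le> n" for k
      using that
    proof (induction k)
      case 0 then show ?case by (simp add: x_def)
    next
      case (Suc k)
      have "real (Suc k) * D \<le> real n * D" using Suc.prems D by (intro mult_right_mono) auto
      then have "x (Suc k) \<le> b" using D T by (simp add: x_def)
      moreover have "a \<le> x k" using D by (simp add: x_def)
      ultimately have "\<bar>w (x (Suc k)) - w (x k)\<bar> \<le> e * (H (x (Suc k)) - H (x k))"
        using sm D step by (intro d) auto
      then show ?case using Suc by (simp add: algebra_simps)
    qed
    from this[of n] show ?thesis using D by (simp add: x_def)
  qed
  note * = this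
  have "\<bar>w T - w a\<bar> \<le> 0"
  proof (rule field_le_epsilon)
    fix e :: real assume e: "e > 0"
    define k where "k = \<bar>H T - H a\<bar> + 1"
    have k: "k > 0" "H T - H a \<le> k" by (auto simp: k_def)
    have "\<bar>w T - w a\<bar> \<le> e / k * (H T - H a)" using e k by (intro *) auto
    also have "\<dots> \<le> e / k * k" using e k by (intro mult_left_mono) auto
    finally show "\<bar>w T - w a\<bar> \<le> 0 + e" using k by simp
  qed
  then show ?thesis by simp
qed

text \<open>No differentiation almost everywhere is involved. On a short interval the mean value
  theorem writes the increment of N(u) as N'(u z) times the integral of \<open>h\<close>; replacing
  N'(u z) by N'(u r) under the integral costs at most \<open>e\<close> times the integral of |h|, by
  uniform continuity.\<close>

lemma prim_on_chain:
  assumes u: "prim_on a b u h"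
    and N: "\<And>x. x \<in> u ` {a..b} \<Longrightarrow> (N has_real_derivative N' x) (at x within u ` {a..b})"
    and N': "continuous_on (u ` {a..b}) N'"
  shows "prim_on a b (\<lambda>t. N (u t)) (\<lambda>t. N' (u t) * h t)"
proof -
  have cu: "continuous_on {a..b} u" by (rule prim_on_continuous[OF u])
  have cN'u: "continuous_on {a..b} (\<lambda>t. N' (u t))"
    using continuous_on_compose2[OF N' cu] by auto
  have ai: "(\<lambda>t. N' (u t) * h t) absolutely_integrable_on {a..b}"
    by (rule absolutely_integrable_continuous_mult[OF cN'u prim_onD(1)[OF u]])
  have ii: "(\<lambda>t. N' (u t) * h t) integrable_on {s..t}" if "a \<le> s" "t \<le> b" for s t
    using absolutely_integrable_on_subinterval[OF ai, of s t] that set_lebesgue_integral_eq_integral(1)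
    by fastforce
  have iabs: "(\<lambda>t. \<bar>h t\<bar>) integrable_on {s..t}" if "a \<le> s" "t \<le> b" for s t
    using absolutely_integrable_norm[OF prim_on_integrable(1)[OF u that]] set_lebesgue_integral_eq_integral(1)
    by (fastforce simp: o_def)
  define w where "w t = N (u t) - integral {a..t} (\<lambda>t. N' (u t) * h t)" for t
  define H where "H t = integral {a..t} (\<lambda>t. \<bar>h t\<bar>)" for t
  have uc: "uniformly_continuous_on (u ` {a..b}) N'"
    by (intro compact_uniformly_continuous N' compact_continuous_image cu) auto
  have "w t = w a" if t: "t \<in> {a..b}" for t
  proof (rule constant_of_small_increments[where w = w and a = a and T = t and H = H and b = b])
    fix e :: real assume e: "e > 0"
    obtain d1 where d1: "d1 > 0" "\<And>x y. x \<in> u ` {a..b} \<Longrightarrow> y \<in> u ` {a..b} \<Longrightarrow> \<bar>x - y\<bar> < d1 \<Longrightarrow> \<bar>N' x - N' y\<bar> < e"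
      using uniformly_continuous_onE[OF uc e] unfolding dist_real_def by metis
    have "uniformly_continuous_on {a..b} u" by (intro compact_uniformly_continuous cu) auto
    then obtain d where d: "d > 0" "\<And>x y. x \<in> {a..b} \<Longrightarrow> y \<in> {a..b} \<Longrightarrow> \<bar>x - y\<bar> < d \<Longrightarrow> \<bar>u x - u y\<bar> < d1 / 2"
      using uniformly_continuous_onE[of "{a..b}" u "d1/2"] d1(1) unfolding dist_real_def by (metis half_gt_zero)
    have "\<bar>w t - w s\<bar> \<le> e * (H t - H s)" if st: "a \<le> s" "s \<le> t" "t \<le> b" "t < s + d" for s t
    proof -
      have sub: "u ` {s..t} \<subseteq> u ` {a..b}" using st by auto
      have "\<exists>xi\<in>u ` {s..t}. N (u t) - N (u s) = N' xi * (u t - u s)"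
      proof (cases "u t = u s")
        case True then show ?thesis using st by auto
      next
        case False
        \<comment> \<open>\<open>N\<close> is controlled only on the image of \<open>u\<close>. By
          connectedness the image of \<open>{s..t}\<close> contains all values between
          \<open>u s\<close> and \<open>u t\<close>, so the mean value point is itself a value of
          \<open>u\<close>.\<close>
        have conn: "closed_segment (u s) (u t) \<subseteq> u ` {s..t}"
        proof -
          have "is_interval (u ` {s..t})"
            unfolding is_interval_connected_1
            by (intro connected_continuous_image continuous_on_subset[OF cu]) (use st in auto)
          then have "convex (u ` {s..t})" by (rule is_interval_convex)
          then show ?thesis using st by (intro closed_segment_subset) auto
        qed
        define p r where "p = min (u s) (u t)" and "r = max (u s) (u t)"
        have pr: "p < r" using False by (auto simp: p_def r_def)
        have sub2: "{p..r} \<subseteq> u ` {s..t}" using conn unfolding p_def r_def closed_segment_eq_real_ivl by (auto split: if_splits)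
        have in_ab: "x \<in> u ` {a..b}" if "p \<le> x" "x \<le> r" for x
          using that sub sub2 by (meson atLeastAtMost_iff subset_iff)
        have "\<exists>xi. p < xi \<and> xi < r \<and> N r - N p = (r - p) * N' xi"
        proof -
          have "\<exists>xi>p. xi < r \<and> N r - N p = (\<lambda>x. x * N' xi) (r - p)"
          proof (rule mvt[OF pr, of N "\<lambda>x h. h * N' x"])
            show "continuous_on {p..r} N"
              by (rule DERIV_continuous_on[of _ _ N'], rule has_field_derivative_subset[OF N]) (use in_ab in auto)
            fix x assume x: "p < x" "x < r"
            have "(N has_real_derivative N' x) (at x within {p..r})"
              by (rule has_field_derivative_subset[OF N]) (use in_ab x in auto)
            then have "(N has_real_derivative N' x) (at x)" using x by (simp add: at_within_Icc_at)
            then show "(N has_derivative (\<lambda>h. h * N' x)) (at x)"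
              unfolding has_field_derivative_def
              by (rule has_derivative_eq_rhs) (simp add: fun_eq_iff mult.commute)
          qed blast
          then show ?thesis by auto
        qed
        then obtain xi where xi: "p < xi" "xi < r" "N r - N p = (r - p) * N' xi" by blast
        have "N (u t) - N (u s) = N' xi * (u t - u s)"
          using xi(3) unfolding p_def r_def by (cases "u s \<le> u t") (auto simp: algebra_simps)
        then show ?thesis using xi sub2 by (intro bexI[of _ xi]) auto
      qed
      then obtain z where z: "z \<in> {s..t}" "N (u t) - N (u s) = N' (u z) * (u t - u s)" by blast
      have c: "integral {a..s} (\<lambda>t. N' (u t) * h t) + integral {s..t} (\<lambda>t. N' (u t) * h t) = integral {a..t} (\<lambda>t. N' (u t) * h t)"
        using st by (intro Henstock_Kurzweil_Integration.integral_combine ii) auto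
      have cH: "H s + integral {s..t} (\<lambda>t. \<bar>h t\<bar>) = H t"
        unfolding H_def using st by (intro Henstock_Kurzweil_Integration.integral_combine iabs) auto
      have hi: "h integrable_on {s..t}" using prim_on_integrable(2)[OF u] st by auto
      have hi': "(\<lambda>r. N' (u z) * h r) integrable_on {s..t}"
        by (rule integrable_on_mult_right[OF hi])
      have "w t - w s = N' (u z) * integral {s..t} h - integral {s..t} (\<lambda>t. N' (u t) * h t)"
        unfolding w_def using c z(2) prim_on_diff[OF u, of s t] st by simp
      also have "\<dots> = integral {s..t} (\<lambda>r. N' (u z) * h r - N' (u r) * h r)"
        using st by (subst Henstock_Kurzweil_Integration.integral_diff[OF hi']) (auto intro!: ii)
      finally have eq: "w t - w s = integral {s..t} (\<lambda>r. N' (u z) * h r - N' (u r) * h r)" .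
      have "norm (integral {s..t} (\<lambda>r. N' (u z) * h r - N' (u r) * h r)) \<le> integral {s..t} (\<lambda>r. e * \<bar>h r\<bar>)"
      proof (rule integral_norm_bound_integral)
        show "(\<lambda>r. N' (u z) * h r - N' (u r) * h r) integrable_on {s..t}"
          using st by (intro integrable_diff ii hi') auto
        show "(\<lambda>r. e * \<bar>h r\<bar>) integrable_on {s..t}" using st by (intro integrable_on_mult_right iabs) auto
        fix r assume r: "r \<in> {s..t}"
        have "\<bar>z - r\<bar> < d" using r z st by auto
        then have "\<bar>u z - u r\<bar> < d1 / 2" using r z st by (intro d) auto
        then have "\<bar>N' (u z) - N' (u r)\<bar> < e" using r z st d1 by (intro d1) auto
        then have "\<bar>N' (u z) - N' (u r)\<bar> * \<bar>h r\<bar> \<le> e * \<bar>h r\<bar>" by (intro mult_right_mono) auto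
        then show "norm (N' (u z) * h r - N' (u r) * h r) \<le> e * \<bar>h r\<bar>"
          by (simp add: abs_mult[symmetric] left_diff_distrib)
      qed
      moreover have "integral {s..t} (\<lambda>t. \<bar>h t\<bar>) = H t - H s" using cH by linarith
      ultimately show ?thesis unfolding eq by simp
    qed
    then show "\<exists>d>0. \<forall>s t. a \<le> s \<and> s \<le> t \<and> t \<le> b \<and> t < s + d \<longrightarrow> \<bar>w t - w s\<bar> \<le> e * (H t - H s)"
      using d(1) by blast
  qed (use t in auto)
  then have "N (u t) = N (u a) + integral {a..t} (\<lambda>t. N' (u t) * h t)" if "t \<in> {a..b}" for t
    using that unfolding w_def by fastforce
  then show ?thesis unfolding prim_on_def using ai by blast
qed

lemma prim_on_chain_UNIV:
  assumes u: "prim_on a b u h"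
    and N: "\<And>x. (N has_real_derivative N' x) (at x)"
    and N': "continuous_on UNIV N'"
  shows "prim_on a b (\<lambda>t. N (u t)) (\<lambda>t. N' (u t) * h t)"
  by (rule prim_on_chain[OF u]) (auto intro: has_field_derivative_at_within N continuous_on_subset[OF N'])

text \<open>Polarization: f g = ((f + g)^2 - f^2 - g^2) / 2, and squares are covered by the chain
  rule.\<close>

lemma prim_on_mult:
  assumes f: "prim_on a b f h" and g: "prim_on a b g k"
  shows "prim_on a b (\<lambda>t. f t * g t) (\<lambda>t. f t * k t + h t * g t)"
proof -
  have sq: "prim_on a b (\<lambda>t. (u t)\<^sup>2) (\<lambda>t. 2 * u t * k t)" if "prim_on a b u k" for u k
    by (rule prim_on_chain_UNIV[OF that]) (auto intro!: derivative_eq_intros continuous_intros)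
  have "prim_on a b (\<lambda>t. 1/2 * (f t + g t)\<^sup>2 + ((-1/2) * (f t)\<^sup>2 + (-1/2) * (g t)\<^sup>2))
     (\<lambda>t. 1/2 * (2 * (f t + g t) * (h t + k t)) + ((-1/2) * (2 * f t * h t) + (-1/2) * (2 * g t * k t)))"
    by (intro prim_on_add prim_on_cmult sq f g)
  then show ?thesis
    by (rule prim_on_cong) (auto simp: power2_eq_square algebra_simps)
qed

lemma prim_on_zero:
  assumes "prim_on a b f h" "\<And>t. t \<in> {a..b} \<Longrightarrow> h t = 0" "t \<in> {a..b}"
  shows "f t = f a"
proof -
  have "integral {a..t} h = integral {a..t} (\<lambda>_. 0)" using assms by (intro integral_cong) auto
  then show ?thesis using prim_onD(3)[OF assms(1,3)] by simp
qed

text \<open>Lebesgue's differentiation theorem is used for averages over intervals to the right of a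
  point. Applying it also to the reflected function gives the left derivative. The lemma is needed
  because \<open>d2\<close> is a pointwise derivative, whereas the second derivative of a Sobolev
  curve is given as an integrand.\<close>

lemma prim_on_ae_derivative:
  assumes f: "prim_on a b f h"
  obtains N where "negligible N"
    "\<And>t. t \<in> {a..b} - N \<Longrightarrow> (f has_real_derivative h t) (at t within {a..b})"
proof -
  \<comment> \<open>Extension by zero, since the differentiation theorem asks for integrability on
    every interval of the line.\<close>
  define g where "g = (\<lambda>t. if t \<in> {a..b} then h t else 0)"
  have gi: "g integrable_on cbox c d" for c d
  proof -
    have "g integrable_on UNIV" unfolding g_def using prim_onD(2)[OF f] integrable_restrict_UNIV by blast
    then show ?thesis using integrable_on_subcbox by blast
  qed
  have gi': "(\<lambda>x. g (-x)) integrable_on cbox c d" for c d :: real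
    using gi[of "-d" "-c"] Henstock_Kurzweil_Integration.integrable_reflect_real[of g "-c" "-d"] by simp
  obtain N1 where N1: "negligible N1" "\<And>x e. x \<notin> N1 \<Longrightarrow> 0 < e \<Longrightarrow>
      \<exists>d>0. \<forall>r. 0 < r \<and> r < d \<longrightarrow> norm (integral (cbox x (x + r *\<^sub>R One)) g /\<^sub>R r ^ DIM(real) - g x) < e"
    using integrable_ccontinuous_explicit[of g] gi by blast
  obtain N2 where N2: "negligible N2" "\<And>x e. x \<notin> N2 \<Longrightarrow> 0 < e \<Longrightarrow>
      \<exists>d>0. \<forall>r. 0 < r \<and> r < d \<longrightarrow> norm (integral (cbox x (x + r *\<^sub>R One)) (\<lambda>x. g (-x)) /\<^sub>R r ^ DIM(real) - g (-x)) < e"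
    using integrable_ccontinuous_explicit[of "\<lambda>x. g (-x)"] gi' by blast
  define N where "N = N1 \<union> uminus ` N2"
  show ?thesis
  proof
    show "negligible N"
      unfolding N_def using N1(1) N2(1)
      by (intro negligible_Un negligible_differentiable_image_negligible)
        (auto intro!: derivative_intros simp: differentiable_on_def)
    fix x assume x: "x \<in> {a..b} - N"
    have "- x \<notin> N2"
    proof
      assume "- x \<in> N2" then have "- (- x) \<in> uminus ` N2" by (rule imageI)
      then show False using x by (simp add: N_def)
    qed
    have xN1: "x \<notin> N1" using x by (simp add: N_def)
    show "(f has_real_derivative h x) (at x within {a..b})"
      unfolding has_field_derivative_iff Lim_within
    proof (intro allI impI)
      fix e :: real assume e: "e > 0"
      obtain d1 where d1: "d1 > 0" "\<And>r. 0 < r \<Longrightarrow> r < d1 \<Longrightarrow> \<bar>integral {x..x+r} g / r - g x\<bar> < e"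
        using N1(2)[OF xN1 e] by (auto simp: divide_inverse mult.commute)
      obtain d2 where d2: "d2 > 0" "\<And>r. 0 < r \<Longrightarrow> r < d2 \<Longrightarrow> \<bar>integral {-x..-x+r} (\<lambda>x. g (-x)) / r - g x\<bar> < e"
        using N2(2)[OF \<open>- x \<notin> N2\<close> e] by (auto simp: divide_inverse mult.commute)
      show "\<exists>d>0. \<forall>y\<in>{a..b}. 0 < dist y x \<and> dist y x < d \<longrightarrow> dist ((f y - f x) / (y - x)) (h x) < e"
      proof (intro exI[of _ "min d1 d2"] conjI ballI impI)
        show "0 < min d1 d2" using d1 d2 by simp
        fix y assume y: "y \<in> {a..b}" "0 < dist y x \<and> dist y x < min d1 d2"
        have gx: "g x = h x" using x by (simp add: g_def)
        show "dist ((f y - f x) / (y - x)) (h x) < e"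
        proof (cases "x < y")
          case True
          have "integral {x..x + (y - x)} g = f y - f x"
            using prim_on_diff[OF f, of x y] x y True
            by (subst integral_cong[of "{x..x+(y-x)}" g h]) (auto simp: g_def)
          then show ?thesis using d1(2)[of "y - x"] y True gx by (auto simp: dist_real_def)
        next
          case False
          then have yx: "y < x" using y by auto
          have "integral {-x..-x + (x - y)} (\<lambda>x. g (-x)) = integral {y..x} g"
            using Henstock_Kurzweil_Integration.integral_reflect_real[of x y g] by simp
          also have "\<dots> = f x - f y"
            using prim_on_diff[OF f, of y x] x y yx
            by (subst integral_cong[of "{y..x}" g h]) (auto simp: g_def)
          finally have eq: "integral {-x..-x + (x - y)} (\<lambda>x. g (-x)) = f x - f y" .
          have "(f x - f y) / (x - y) = (f y - f x) / (y - x)" using yx by (simp add: divide_simps) (simp add: algebra_simps)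
          then show ?thesis using d2(2)[of "x - y"] y yx gx eq by (auto simp: dist_real_def)
        qed
      qed
    qed
  qed
qed

text \<open>Absolute integrability carries the measurability of \<open>h\<close>, which
  integrability of the square alone would not provide.\<close>

definition L2_on :: "real \<Rightarrow> real \<Rightarrow> (real \<Rightarrow> real) \<Rightarrow> bool" where
  "L2_on a b h \<longleftrightarrow> h absolutely_integrable_on {a..b} \<and> (\<lambda>t. (h t)\<^sup>2) integrable_on {a..b}"

lemma L2_on_continuous: "continuous_on {a..b} h \<Longrightarrow> L2_on a b h"
  unfolding L2_on_def
  by (intro conjI absolutely_integrable_continuous_real integrable_continuous_real continuous_intros)

lemma L2_on_mult:
  assumes "continuous_on {a..b} c" "L2_on a b h"
  shows "L2_on a b (\<lambda>t. c t * h t)"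
  unfolding L2_on_def
proof
  show "(\<lambda>t. c t * h t) absolutely_integrable_on {a..b}"
    using assms unfolding L2_on_def by (intro absolutely_integrable_continuous_mult) auto
  have "(\<lambda>t. (h t)\<^sup>2) absolutely_integrable_on {a..b}"
    using assms unfolding L2_on_def by (intro nonnegative_absolutely_integrable_1) auto
  then have "(\<lambda>t. (c t)\<^sup>2 * (h t)\<^sup>2) absolutely_integrable_on {a..b}"
    by (intro absolutely_integrable_continuous_mult continuous_intros assms)
  then show "(\<lambda>t. (c t * h t)\<^sup>2) integrable_on {a..b}"
    using set_lebesgue_integral_eq_integral(1) by (simp add: power_mult_distrib)
qed

lemma absolutely_integrable_mult_L2:
  assumes "L2_on a b f" "L2_on a b h"
  shows "(\<lambda>t. f t * h t) absolutely_integrable_on {a..b}"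
proof (rule measurable_bounded_by_integrable_imp_absolutely_integrable)
  have "f \<in> borel_measurable (lebesgue_on {a..b})" "h \<in> borel_measurable (lebesgue_on {a..b})"
    using assms absolutely_integrable_measurable[of "{a..b}" f] absolutely_integrable_measurable[of "{a..b}" h]
    unfolding L2_on_def by auto
  then show "(\<lambda>t. f t * h t) \<in> borel_measurable (lebesgue_on {a..b})" by simp
  show "(\<lambda>t. (f t)\<^sup>2 + (h t)\<^sup>2) integrable_on {a..b}"
    using assms unfolding L2_on_def by (intro integrable_add) auto
  show "norm (f t * h t) \<le> (f t)\<^sup>2 + (h t)\<^sup>2" for t
  proof -
    have "2 * (\<bar>f t\<bar> * \<bar>h t\<bar>) \<le> (f t)\<^sup>2 + (h t)\<^sup>2" using zero_le_power2[of "\<bar>f t\<bar> - \<bar>h t\<bar>"] by (simp add: power2_diff)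
    moreover have "0 \<le> \<bar>f t\<bar> * \<bar>h t\<bar>" by simp
    ultimately have "\<bar>f t\<bar> * \<bar>h t\<bar> \<le> (f t)\<^sup>2 + (h t)\<^sup>2" by linarith
    then show ?thesis by (simp add: abs_mult)
  qed
qed auto

lemma L2_on_add:
  assumes "L2_on a b f" "L2_on a b h"
  shows "L2_on a b (\<lambda>t. f t + h t)"
  unfolding L2_on_def
proof
  show "(\<lambda>t. f t + h t) absolutely_integrable_on {a..b}"
    using assms unfolding L2_on_def by (intro set_integral_add(1)) auto
  have "(\<lambda>t. (f t)\<^sup>2 + 2 * (f t * h t) + (h t)\<^sup>2) integrable_on {a..b}"
    using assms absolutely_integrable_mult_L2[OF assms, THEN set_lebesgue_integral_eq_integral(1)]
    unfolding L2_on_def by (intro integrable_add integrable_on_mult_right) auto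
  then show "(\<lambda>t. (f t + h t)\<^sup>2) integrable_on {a..b}"
    by (simp add: power2_sum algebra_simps)
qed

lemma L2_on_cmult: "L2_on a b f \<Longrightarrow> L2_on a b (\<lambda>t. c * f t)"
  by (rule L2_on_mult) auto

lemma L2_on_diff: "L2_on a b f \<Longrightarrow> L2_on a b h \<Longrightarrow> L2_on a b (\<lambda>t. f t - h t)"
  using L2_on_add[of a b f "\<lambda>t. (-1) * h t"] L2_on_cmult[of a b h "-1"] by simp

section \<open>The calibration inequality\<close>

text \<open>This is the decrease of sin x / x up to \<open>pi\<close>, a consequence of x cos x <=
  sin x. The form without division includes y = 0.\<close>

lemma sin_ratio_antimono:
  fixes y w :: real
  assumes "0 \<le> y" "y \<le> w" "w \<le> pi"
  shows "y * sin w \<le> w * sin y"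
proof -
  have *: "x * cos x \<le> sin x" if "0 \<le> x" "x \<le> pi" for x :: real
  proof -
    have "(\<lambda>x. sin x - x * cos x) 0 \<le> (\<lambda>x. sin x - x * cos x) x"
    proof (rule DERIV_nonneg_imp_nondecreasing[OF that(1)])
      fix z assume "0 \<le> z" "z \<le> x"
      then show "\<exists>d. ((\<lambda>x. sin x - x * cos x) has_real_derivative d) (at z) \<and> 0 \<le> d"
        using that sin_ge_zero[of z]
        by (intro exI[of _ "z * sin z"]) (auto intro!: derivative_eq_intros)
    qed
    then show ?thesis by simp
  qed
  show ?thesis
  proof (cases "y = 0")
    case False
    then have y: "y > 0" using assms by simp
    have "(\<lambda>x. sin x / x) w \<le> (\<lambda>x. sin x / x) y"
    proof (rule DERIV_nonpos_imp_nonincreasing[OF assms(2)])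
      fix z assume z: "y \<le> z" "z \<le> w"
      have "((\<lambda>x. sin x / x) has_real_derivative (cos z * z - sin z * 1) / (z * z)) (at z)"
        using z y by (intro derivative_intros) auto
      moreover have "(cos z * z - sin z * 1) / (z * z) \<le> 0"
        using *[of z] z y assms by (intro divide_nonpos_pos) (auto simp: mult.commute)
      ultimately show "\<exists>d. ((\<lambda>x. sin x / x) has_real_derivative d) (at z) \<and> d \<le> 0" by blast
    qed
    then show ?thesis using y assms by (simp add: field_simps)
  qed simp
qed

text \<open>This expresses that \<open>x \<mapsto> cos (sqrt x)\<close> lies above its tangent at \<open>w\<^sup>2\<close>.\<close>

lemma cos_sqrt_tangent:
  fixes y w :: real
  assumes w: "0 < w" "w < pi"
  shows "cos w + w * sin w / 2 - sin w / (2 * w) * y\<^sup>2 \<le> cos y"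
proof -
  define c where "c = sin w / w"
  define h where "h = (\<lambda>y. cos y + c / 2 * y\<^sup>2)"
  have sw: "sin w > 0" using w by (intro sin_gt_zero) auto
  have c: "c > 0" using sw w by (simp add: c_def)
  have dh: "(h has_real_derivative (c * z - sin z)) (at z)" for z
    unfolding h_def by (auto intro!: derivative_eq_intros)
  have left: "h w \<le> h z" if "0 \<le> z" "z \<le> w" for z
  proof (rule DERIV_nonpos_imp_nonincreasing[OF that(2)])
    fix x assume x: "z \<le> x" "x \<le> w"
    have "c * x - sin x \<le> 0" using sin_ratio_antimono[of x w] x that w by (simp add: c_def field_simps)
    then show "\<exists>d. (h has_real_derivative d) (at x) \<and> d \<le> 0" using dh by blast
  qed
  have right: "h w \<le> h z" if "w \<le> z" "z \<le> pi" for z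
  proof (rule DERIV_nonneg_imp_nondecreasing[OF that(1)])
    fix x assume x: "w \<le> x" "x \<le> z"
    have "0 \<le> c * x - sin x" using sin_ratio_antimono[of w x] x that w by (simp add: c_def field_simps)
    then show "\<exists>d. (h has_real_derivative d) (at x) \<and> 0 \<le> d" using dh by blast
  qed
  \<comment> \<open>Beyond \<open>pi\<close> a cruder argument suffices: the cosine is at least cos
    pi, and the quadratic term keeps growing.\<close>
  have all: "h w \<le> h z" if "0 \<le> z" for z
  proof (cases "z \<le> pi")
    case True then show ?thesis using left right that by (cases "z \<le> w") auto
  next
    case False
    have "h w \<le> h pi" using right[of pi] w by simp
    also have "\<dots> \<le> h z"
      unfolding h_def using False c by (intro add_mono mult_left_mono power_mono) auto
    finally show ?thesis .
  qed
  have "h w \<le> h \<bar>y\<bar>" by (rule all) simp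
  then have "cos w + c / 2 * w\<^sup>2 \<le> cos y + c / 2 * y\<^sup>2" by (simp add: h_def)
  moreover have "c / 2 * w\<^sup>2 = w * sin w / 2" using w by (simp add: c_def power2_eq_square)
  ultimately show ?thesis by (simp add: c_def)
qed

text \<open>The tangent angle of the elastica of modulus \<open>q\<close> at rescaled arclength \<open>u\<close>, counted from the midpoint.\<close>

definition Om :: "real \<Rightarrow> real \<Rightarrow> real" where
  "Om q u = 2 * arcsin (q * sin (am u q))"

lemma q_sin_bounds:
  fixes q x :: real
  assumes "0 < q" "q < 1" shows "- 1 < q * sin x" "q * sin x < 1"
proof -
  have "\<bar>q * sin x\<bar> \<le> q * 1" using assms by (auto simp: abs_mult intro!: mult_left_mono)
  then show "- 1 < q * sin x" "q * sin x < 1" using assms by auto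
qed

lemma DERIV_Om:
  assumes q: "0 < q" "q < 1"
  shows "((\<lambda>u. Om q u) has_real_derivative 2 * q * cos (am u q)) (at u)"
proof -
  have D: "Del q (am u q) > 0" using q by (intro Del_pos) auto
  have "((\<lambda>u. Om q u) has_real_derivative
     2 * (inverse (sqrt (1 - (q * sin (am u q))\<^sup>2)) * (q * (cos (am u q) * Del q (am u q))))) (at u)"
    unfolding Om_def
    by (intro DERIV_cmult DERIV_chain2[OF DERIV_arcsin] DERIV_chain2[OF DERIV_sin] DERIV_am q_sin_bounds q) (use q in auto)
  moreover have "sqrt (1 - (q * sin (am u q))\<^sup>2) = Del q (am u q)"
    by (simp add: Del_def power_mult_distrib)
  ultimately show ?thesis using D by (simp only:) (simp add: field_simps)
qed

lemma sin_Om: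
  assumes q: "0 < q" "q < 1"
  shows "sin (Om q u) = 2 * q * sin (am u q) * Del q (am u q)"
proof -
  have "cos (arcsin (q * sin (am u q))) = Del q (am u q)"
    using q_sin_bounds[OF q, of "am u q"] by (subst cos_arcsin) (auto simp: Del_def power_mult_distrib)
  then show ?thesis
    unfolding Om_def sin_double using q_sin_bounds[OF q, of "am u q"] by simp
qed

lemma cos_Om:
  assumes q: "0 < q" "q < 1"
  shows "cos (Om q u) = 1 - 2 * q\<^sup>2 * (sin (am u q))\<^sup>2"
  unfolding Om_def cos_double_sin using q_sin_bounds[OF q, of "am u q"] by (simp add: power_mult_distrib)

text \<open>Together with \<open>DERIV_Om\<close> this is the pendulum equation Om'' = - sin Om, the
  Euler-Lagrange equation of the elastica.\<close>

lemma DERIV_Om_slope: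
  assumes q: "0 < q" "q < 1"
  shows "((\<lambda>u. 2 * q * cos (am u q)) has_real_derivative - sin (Om q u)) (at u)"
  unfolding sin_Om[OF q] using q by (auto intro!: derivative_eq_intros)

lemma am_bounds:
  assumes q: "\<bar>q\<bar> < 1" and u: "0 < u" "u \<le> ellK q"
  shows "0 < am u q" "am u q \<le> pi/2"
  using am_strict_mono[OF q u(1)] am_mono[OF q u(2)] am_K[OF q] by auto

lemma Om_bounds:
  assumes q: "0 < q" "q < 1" and u: "0 < u" "u \<le> ellK q"
  shows "0 < Om q u" "Om q u < pi" "0 \<le> cos (am u q)"
proof -
  have a: "0 < am u q" "am u q \<le> pi/2" using am_bounds[OF _ u] q by auto
  have "sin (am u q) > 0" using a pi_gt_zero by (intro sin_gt_zero) (auto simp del: pi_gt_zero)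
  then have "0 < q * sin (am u q)" using q by simp
  then show "0 < Om q u" unfolding Om_def using q_sin_bounds[OF q, of "am u q"]
    by (simp add: arcsin_less_arcsin[of 0, simplified])
  show "Om q u < pi" unfolding Om_def using q_sin_bounds[OF q, of "am u q"]
    arcsin_lt_bounded[of "q * sin (am u q)"] by simp
  show "0 \<le> cos (am u q)" using a by (intro cos_ge_zero) auto
qed

text \<open>\<open>Om\<close> starts at 0 and is concave on the half arc, because its second
  derivative - sin Om is nonpositive there. The inequality controls the calibration at its singular
  end.\<close>

lemma Om_slope_le:
  assumes q: "0 < q" "q < 1" and u: "0 < u" "u \<le> ellK q"
  shows "u * (2 * q * cos (am u q)) \<le> Om q u"
proof -
  let ?f = "\<lambda>u. Om q u - u * (2 * q * cos (am u q))"
  have "?f 0 \<le> ?f u"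
  proof (rule DERIV_nonneg_imp_nondecreasing[where f = ?f and a = 0 and b = u])
    show "0 \<le> u" using u by simp
    fix z assume z: "0 \<le> z" "z \<le> u"
    have "(?f has_real_derivative (2 * q * cos (am z q) - (1 * (2 * q * cos (am z q)) + - sin (Om q z) * z))) (at z)"
      by (intro DERIV_diff DERIV_mult DERIV_Om DERIV_Om_slope q DERIV_ident)
    moreover have "sin (Om q z) \<ge> 0"
    proof (cases "z = 0")
      case True then show ?thesis using am_K(3)[of q] q by (simp add: Om_def)
    next
      case False then show ?thesis using Om_bounds[OF q, of z] z u by (intro sin_ge_zero) auto
    qed
    ultimately show "\<exists>d. (?f has_real_derivative d) (at z) \<and> 0 \<le> d"
      using z by (intro exI conjI) (assumption, simp)
  qed
  then show ?thesis using am_K(3)[of q] q by (simp add: Om_def)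
qed

text \<open>A closed form for the integral from 0 to \<open>u\<close> of cos Om + Om sin Om / 2, the
  part of the tangent bound for the cosine that does not involve the competitor. The last term is -
  Om Om' / 2 and vanishes at u = K, where the curvature is 0.\<close>

definition Cal :: "real \<Rightarrow> real \<Rightarrow> real" where
  "Cal q u = 4 * ellE (am u q) q - (3 - 2 * q\<^sup>2) * u - 1/2 * (Om q u * (2 * q * cos (am u q)))"

lemma DERIV_Cal:
  assumes q: "0 < q" "q < 1"
  shows "((\<lambda>u. Cal q u) has_real_derivative (cos (Om q u) + Om q u * sin (Om q u) / 2)) (at u)"
proof -
  have "((\<lambda>u. Cal q u) has_real_derivative
     4 * (Del q (am u q) * Del q (am u q)) - (3 - 2 * q\<^sup>2) * 1
      - 1/2 * ((2 * q * cos (am u q)) * (2 * q * cos (am u q)) + - sin (Om q u) * Om q u)) (at u)"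
    unfolding Cal_def
    by (intro DERIV_diff DERIV_cmult DERIV_mult DERIV_Om DERIV_Om_slope q DERIV_ident DERIV_chain2[OF DERIV_ellE] DERIV_am)
      (use q in auto)
  moreover have "4 * (Del q (am u q) * Del q (am u q)) - (3 - 2 * q\<^sup>2) * 1
      - 1/2 * ((2 * q * cos (am u q)) * (2 * q * cos (am u q)) + - sin (Om q u) * Om q u)
      = cos (Om q u) + Om q u * sin (Om q u) / 2"
  proof -
    have D: "Del q (am u q) * Del q (am u q) = 1 - q\<^sup>2 * (sin (am u q))\<^sup>2"
      using Del_sq[of q "am u q"] q by (simp add: power2_eq_square)
    have c: "(2 * q * cos (am u q)) * (2 * q * cos (am u q)) = 4 * q\<^sup>2 * (1 - (sin (am u q))\<^sup>2)"
      unfolding cos_squared_eq[symmetric] by (simp add: power2_eq_square)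
    show ?thesis unfolding D c cos_Om[OF q] by (simp add: field_simps)
  qed
  ultimately show ?thesis by (rule DERIV_cong)
qed

lemma Cal_0: "0 < q \<Longrightarrow> q < 1 \<Longrightarrow> Cal q 0 = 0"
  using am_K(3)[of q] by (simp add: Cal_def Om_def)

lemma Cal_K: "0 < q \<Longrightarrow> q < 1 \<Longrightarrow> Cal q (ellK q) = 4 * ellEc q - (3 - 2 * q\<^sup>2) * ellK q"
  by (simp add: Cal_def am_K(1))

text \<open>The calibration \<open>S(u, th) = r u * th\<^sup>2 / 2 + Cal q u\<close>, with \<open>r = Om' / Om\<close> solving the
  Riccati equation \<open>r' = - sin Om / Om - r\<^sup>2\<close>. It is singular at \<open>u = 0\<close>, whence the limit
  \<open>t1 \<rightarrow> a\<close>; on \<open>{a..t1}\<close> the Cauchy-Schwarz inequality and \<open>r u \<le> 1 / u\<close> are enough.\<close>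

lemma half_arc_bound:
  assumes q: "0 < q" "q < 1" and al: "0 < al" and ab: "a < b"
    and th: "prim_on a b th p" "th a = 0"
    and m: "continuous_on {a..b} m" "\<And>t. t \<in> {a..b} \<Longrightarrow> 0 < m t"
    and int: "(\<lambda>t. (p t)\<^sup>2 / m t) integrable_on {a..b}"
    and K: "al * integral {a..b} m = ellK q"
  shows "al * (4 * ellEc q - (3 - 2 * q\<^sup>2) * ellK q)
     \<le> 1/2 * integral {a..b} (\<lambda>t. (p t)\<^sup>2 / m t) + al\<^sup>2 * integral {a..b} (\<lambda>t. cos (th t) * m t)"
proof -
  \<comment> \<open>The rescaled arclength, running from 0 to \<open>ellK q\<close>. The estimate is
    made in the given parameter, with the speed \<open>m\<close> as weight.\<close>
  define s where "s t = al * integral {a..t} m" for t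
  define cm where "cm = (\<lambda>t. cos (th t) * m t)"
  have cth: "continuous_on {a..b} th" by (rule prim_on_continuous[OF th(1)])
  have ccm: "continuous_on {a..b} cm" unfolding cm_def by (intro continuous_intros cth m)
  have sp: "(s has_real_derivative al * m t) (at t within {a..b})" if "t \<in> {a..b}" for t
    unfolding s_def using that by (intro DERIV_cmult integral_has_real_derivative m)
  have mi: "m integrable_on {c..d}" if "a \<le> c" "d \<le> b" for c d
    using that by (intro integrable_continuous_real continuous_on_subset[OF m(1)]) auto
  have s_mono: "s x < s y" if "a \<le> x" "x < y" "y \<le> b" for x y
  proof -
    have "integral {a..x} m + integral {x..y} m = integral {a..y} m"
      using that by (intro Henstock_Kurzweil_Integration.integral_combine mi) auto
    moreover have "0 < integral {x..y} m"
    proof -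
      have "continuous_on {x..y} m" "{x..y} \<noteq> {}"
        using that by (auto intro!: continuous_on_subset[OF m(1)])
      then obtain z where z: "z \<in> {x..y}" "\<And>t. t \<in> {x..y} \<Longrightarrow> m z \<le> m t"
        using continuous_attains_inf[OF compact_Icc, of x y m] by blast
      have "0 < (y - x) * m z" using z(1) m(2)[of z] that by simp
      also have "\<dots> = integral {x..y} (\<lambda>_. m z)" using that by simp
      also have "\<dots> \<le> integral {x..y} m" using z(2) that by (intro integral_le mi) auto
      finally show ?thesis .
    qed
    ultimately have "integral {a..x} m < integral {a..y} m" by linarith
    then show ?thesis unfolding s_def using al by simp
  qed
  have s_a: "s a = 0" and s_b: "s b = ellK q" using K by (auto simp: s_def)
  have cs: "continuous_on {a..b} s"
    by (rule DERIV_continuous_on[OF sp])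
  let ?I = "integral {a..b} (\<lambda>t. (p t)\<^sup>2 / m t)"
  have inti: "(\<lambda>t. (p t)\<^sup>2 / m t) integrable_on {c..d}" if "a \<le> c" "d \<le> b" for c d
    using integrable_on_subinterval[OF int, of c d] that by auto
  have main: "0 \<le> 1/2 * ?I + al\<^sup>2 * (integral {a..b} cm - integral {a..t1} cm) - al * Cal q (ellK q) + al * Cal q (s t1)"
    if t1: "t1 \<in> {a<..<b}" for t1
  proof -
    define W where "W t = Om q (s t)" for t
    define r where "r u = 2 * q * cos (am u q) / Om q u" for u
    define r' where "r' u = - sin (Om q u) / Om q u - (r u)\<^sup>2" for u
    have s_pos: "0 < s t" "s t \<le> ellK q" if "t \<in> {t1..b}" for t
      using s_mono[of a t] s_mono[of t b] that t1 s_a s_b by (cases "t = b"; auto)+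
    have Wb: "0 < W t" "W t < pi" if "t \<in> {t1..b}" for t
      using Om_bounds[OF q s_pos[OF that]] by (auto simp: W_def)
    have dr: "(r has_real_derivative r' u) (at u)" if "0 < u" "u \<le> ellK q" for u
    proof -
      have O: "Om q u > 0" using Om_bounds[OF q that] by simp
      have "(r has_real_derivative (- sin (Om q u) * Om q u - (2 * q * cos (am u q)) * (2 * q * cos (am u q))) / (Om q u * Om q u)) (at u)"
        unfolding r_def[abs_def] using O by (intro DERIV_divide DERIV_Om DERIV_Om_slope q) auto
      moreover have "(- sin (Om q u) * Om q u - (2 * q * cos (am u q)) * (2 * q * cos (am u q))) / (Om q u * Om q u) = r' u"
        unfolding r'_def r_def using O by (simp add: diff_divide_distrib power2_eq_square)
      ultimately show ?thesis by (rule DERIV_cong)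
    qed
    have sp1: "(s has_real_derivative al * m t) (at t within {t1..b})" if "t \<in> {t1..b}" for t
      using has_field_derivative_subset[OF sp, of t "{t1..b}"] that t1 by auto
    have cm1: "continuous_on {t1..b} m" "continuous_on {t1..b} s" "continuous_on {t1..b} th" "continuous_on {t1..b} cm"
      using t1 by (auto intro: continuous_on_subset[OF m(1)] continuous_on_subset[OF cs] continuous_on_subset[OF cth] continuous_on_subset[OF ccm])
    have cOm: "continuous_on T (\<lambda>u. Om q u)" for T
      by (rule DERIV_continuous_on[OF has_field_derivative_at_within[OF DERIV_Om[OF q]]])
    have "\<bar>q\<bar> < 1" using q by simp
    then have cam: "continuous_on T (\<lambda>u. am u q)" for T
      by (rule DERIV_continuous_on[OF has_field_derivative_at_within[OF DERIV_am]])
    have cW: "continuous_on {t1..b} W" unfolding W_def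
      by (rule continuous_on_compose2[OF cOm[of UNIV] cm1(2)]) simp
    have cams: "continuous_on {t1..b} (\<lambda>t. am (s t) q)"
      by (rule continuous_on_compose2[OF cam[of UNIV] cm1(2)]) simp
    have crs: "continuous_on {t1..b} (\<lambda>t. r (s t))" unfolding r_def W_def[symmetric]
      by (intro continuous_intros cW cams) (insert Wb, force+)
    have cr's: "continuous_on {t1..b} (\<lambda>t. r' (s t))" unfolding r'_def W_def[symmetric]
      by (intro continuous_intros cW crs) (insert Wb, force+)
    have pr: "prim_on t1 b (\<lambda>t. r (s t)) (\<lambda>t. r' (s t) * (al * m t))"
      by (intro prim_on_C1 DERIV_chain2[OF dr] sp1 continuous_intros cr's cm1 s_pos)
    have pC: "prim_on t1 b (\<lambda>t. Cal q (s t)) (\<lambda>t. (cos (W t) + W t * sin (W t) / 2) * (al * m t))"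
      unfolding W_def by (intro prim_on_C1 DERIV_chain2[OF DERIV_Cal] q sp1 continuous_intros cm1
          cW[unfolded W_def] s_pos) auto
    have pth: "prim_on t1 b th p" using prim_on_subset[OF th(1), of t1 b] t1 by auto
    \<comment> \<open>\<open>al\<close> times the calibration, evaluated along the competitor. Its
      derivative will be dominated pointwise by the integrand.\<close>
    define F where "F t = al / 2 * (r (s t) * (th t * th t)) + al * Cal q (s t)" for t
    define F' where "F' t = al / 2 * (r (s t) * (th t * p t + p t * th t) + r' (s t) * (al * m t) * (th t * th t))
         + al * ((cos (W t) + W t * sin (W t) / 2) * (al * m t))" for t
    have pF: "prim_on t1 b F F'" unfolding F_def F'_def
      by (intro prim_on_add prim_on_cmult prim_on_mult pr pC pth)
    have "integral {t1..b} F' \<le> integral {t1..b} (\<lambda>t. 1/2 * ((p t)\<^sup>2 / m t) + al\<^sup>2 * cm t)"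
    proof (rule integral_le)
      show "F' integrable_on {t1..b}" by (rule prim_onD(2)[OF pF])
      show "(\<lambda>t. 1/2 * ((p t)\<^sup>2 / m t) + al\<^sup>2 * cm t) integrable_on {t1..b}"
        using t1 by (intro integrable_add integrable_on_mult_right inti integrable_continuous_real cm1) auto
      fix t assume t: "t \<in> {t1..b}"
      have mt: "m t > 0" using m(2)[of t] t t1 by auto
      define R T where "R = r (s t)" and "T = th t"
      \<comment> \<open>The square completed here vanishes when the competitor is the arc itself:
        then \<open>T\<close> equals Om and p = al Om' m = al R T m.\<close>
      have 1: "al * R * T * p t \<le> 1/2 * ((p t)\<^sup>2 / m t) + 1/2 * (al\<^sup>2 * R\<^sup>2 * T\<^sup>2 * m t)"
      proof -
        have "0 \<le> (p t - al * R * T * m t)\<^sup>2 / m t" using mt by simp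
        also have "\<dots> = (p t)\<^sup>2 / m t - 2 * (al * R * T * p t) + al\<^sup>2 * R\<^sup>2 * T\<^sup>2 * m t"
          using mt by (simp add: power2_diff field_simps power2_eq_square)
        finally show ?thesis by simp
      qed
      have "cos (W t) + W t * sin (W t) / 2 - sin (W t) / (2 * W t) * T\<^sup>2 \<le> cos T"
        unfolding T_def using Wb[OF t] by (rule cos_sqrt_tangent)
      then have 2: "al\<^sup>2 * m t * (cos (W t) + W t * sin (W t) / 2 - sin (W t) / (2 * W t) * T\<^sup>2) \<le> al\<^sup>2 * m t * cos T"
        using mt al by (intro mult_left_mono) auto
      \<comment> \<open>The Riccati equation enters here: its -r^2 matches the remainder of the
        completed square, and its - sin Om / Om supplies the quadratic term of the tangent
        bound.\<close>
      have "F' t = al * R * T * p t - 1/2 * (al\<^sup>2 * R\<^sup>2 * T\<^sup>2 * m t)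
         + al\<^sup>2 * m t * (cos (W t) + W t * sin (W t) / 2 - sin (W t) / (2 * W t) * T\<^sup>2)"
        unfolding F'_def r'_def W_def[symmetric] R_def[symmetric] T_def[symmetric]
        by (simp add: algebra_simps power2_eq_square)
      then show "F' t \<le> 1/2 * ((p t)\<^sup>2 / m t) + al\<^sup>2 * cm t"
        using 1 2 unfolding cm_def T_def[symmetric] by (simp add: mult_ac)
    qed
    also have "\<dots> = 1/2 * integral {t1..b} (\<lambda>t. (p t)\<^sup>2 / m t) + al\<^sup>2 * integral {t1..b} cm"
    proof -
      have "(\<lambda>t. 1/2 * ((p t)\<^sup>2 / m t)) integrable_on {t1..b}" "(\<lambda>t. al\<^sup>2 * cm t) integrable_on {t1..b}"
        by (intro integrable_on_mult_right inti integrable_continuous_real cm1; use t1 in simp)+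
      from Henstock_Kurzweil_Integration.integral_add[OF this] show ?thesis
        by (simp only: Henstock_Kurzweil_Integration.integral_mult_right)
    qed
    also have "integral {t1..b} F' = F b - F t1" using prim_on_diff[OF pF, of t1 b] t1 by auto
    finally have A: "F b - F t1 \<le> 1/2 * integral {t1..b} (\<lambda>t. (p t)\<^sup>2 / m t) + al\<^sup>2 * integral {t1..b} cm" .
    \<comment> \<open>At the free end cos (am K) = 0, so \<open>r\<close> vanishes and the unknown
      end angle drops out.\<close>
    have Fb: "F b = al * Cal q (ellK q)" unfolding F_def s_b r_def using q by (simp add: am_K(1))
    \<comment> \<open>The mean of p / m with respect to the weight \<open>m\<close> on the first
      piece, which is the optimal constant for obtaining the Cauchy-Schwarz inequality from (p - c
      m)^2 / m >= 0.\<close>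
    define c where "c = al * th t1 / s t1"
    have st1: "0 < s t1" "s t1 \<le> ellK q" using s_pos[of t1] t1 by auto
    have B: "al * (th t1)\<^sup>2 / s t1 \<le> integral {a..t1} (\<lambda>t. (p t)\<^sup>2 / m t)"
    proof -
      have pi: "p integrable_on {a..t1}" using prim_on_integrable(2)[OF th(1)] t1 by auto
      have "integral {a..t1} (\<lambda>t. 2 * c * p t - c\<^sup>2 * m t) \<le> integral {a..t1} (\<lambda>t. (p t)\<^sup>2 / m t)"
      proof (rule integral_le)
        show "(\<lambda>t. 2 * c * p t - c\<^sup>2 * m t) integrable_on {a..t1}"
          using t1 by (intro integrable_diff integrable_on_mult_right mi pi) auto
        show "(\<lambda>t. (p t)\<^sup>2 / m t) integrable_on {a..t1}" using t1 by (intro inti) auto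
        fix t assume t: "t \<in> {a..t1}"
        have mt: "m t > 0" using m(2)[of t] t t1 by auto
        have "0 \<le> (p t - c * m t)\<^sup>2 / m t" using mt by simp
        also have "\<dots> = (p t)\<^sup>2 / m t - (2 * c * p t - c\<^sup>2 * m t)"
          using mt by (simp add: power2_diff field_simps power2_eq_square)
        finally show "2 * c * p t - c\<^sup>2 * m t \<le> (p t)\<^sup>2 / m t" by simp
      qed
      also have "integral {a..t1} (\<lambda>t. 2 * c * p t - c\<^sup>2 * m t) = 2 * c * integral {a..t1} p - c\<^sup>2 * integral {a..t1} m"
        using t1 by (subst Henstock_Kurzweil_Integration.integral_diff)
          (auto intro!: integrable_on_mult_right mi pi)
      also have "integral {a..t1} p = th t1" using prim_on_diff[OF th(1), of a t1] t1 th(2) by auto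
      also have "integral {a..t1} m = s t1 / al" using al by (simp add: s_def)
      also have "2 * c * th t1 - c\<^sup>2 * (s t1 / al) = al * (th t1)\<^sup>2 / s t1"
        unfolding c_def using al st1 by (simp add: field_simps power2_eq_square)
      finally show ?thesis .
    qed
    have "r (s t1) \<le> 1 / s t1"
      using Om_slope_le[OF q st1] Om_bounds(1)[OF q st1] st1 by (simp add: r_def field_simps)
    then have "al * (th t1)\<^sup>2 * r (s t1) \<le> al * (th t1)\<^sup>2 * (1 / s t1)" using al by (intro mult_left_mono) auto
    with B have B': "al * (th t1)\<^sup>2 * r (s t1) \<le> integral {a..t1} (\<lambda>t. (p t)\<^sup>2 / m t)" by simp
    have "integral {a..t1} (\<lambda>t. (p t)\<^sup>2 / m t) + integral {t1..b} (\<lambda>t. (p t)\<^sup>2 / m t) = ?I"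
      using t1 by (intro Henstock_Kurzweil_Integration.integral_combine inti) auto
    moreover have "integral {a..t1} cm + integral {t1..b} cm = integral {a..b} cm"
      using t1 ccm by (intro Henstock_Kurzweil_Integration.integral_combine integrable_continuous_real) auto
    then have "integral {t1..b} cm = integral {a..b} cm - integral {a..t1} cm" by linarith
    moreover have "F t1 = 1/2 * (al * (th t1)\<^sup>2 * r (s t1)) + al * Cal q (s t1)"
      by (simp add: F_def power2_eq_square)
    ultimately show ?thesis using A B' Fb by simp
  qed
  define Psi where "Psi t1 = 1/2 * ?I + al\<^sup>2 * (integral {a..b} cm - integral {a..t1} cm)
      - al * Cal q (ellK q) + al * Cal q (s t1)" for t1
  have "0 \<le> Psi a"
  proof (rule continuous_ge_on_closure[where f = Psi and S = "{a<..<b}" and x = a and a = 0])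
    have "continuous_on UNIV (\<lambda>u. Cal q u)"
      by (rule DERIV_continuous_on[OF has_field_derivative_at_within[OF DERIV_Cal[OF q]]])
    then have "continuous_on {a..b} (\<lambda>t. Cal q (s t))"
      using cs by (rule continuous_on_compose2) simp
    moreover have "continuous_on {a..b} (\<lambda>t. integral {a..t} cm)"
      using ccm by (intro indefinite_integral_continuous_1 integrable_continuous_real)
    ultimately show "continuous_on (closure {a<..<b}) Psi"
      unfolding Psi_def closure_greaterThanLessThan[OF ab] by (intro continuous_intros)
    show "a \<in> closure {a<..<b}" using ab by simp
    show "0 \<le> Psi t" if "t \<in> {a<..<b}" for t unfolding Psi_def by (rule main[OF that])
  qed
  then show ?thesis unfolding Psi_def s_a Cal_0[OF q] Cal_K[OF q] cm_def by simp
qed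

section \<open>The lower bound for the bending energy\<close>

text \<open>Coordinates and explicit witnesses for \<open>W22\<close>, so that the scalar calculus
  of primitives applies to each component of the velocity.\<close>

definition W22_data :: "curve \<Rightarrow> (real \<Rightarrow> real) \<Rightarrow> (real \<Rightarrow> real) \<Rightarrow> (real \<Rightarrow> real) \<Rightarrow> (real \<Rightarrow> real) \<Rightarrow> bool" where
  "W22_data \<gamma> v1 v2 h1 h2 \<longleftrightarrow>
     (\<forall>t\<in>{0..1}. (\<gamma> has_vector_derivative (v1 t, v2 t)) (at t within {0..1})) \<and>
     prim_on 0 1 v1 h1 \<and> prim_on 0 1 v2 h2 \<and> L2_on 0 1 h1 \<and> L2_on 0 1 h2"

lemma W22_imp_data:
  assumes "W22 \<gamma>"
  obtains v1 v2 h1 h2 where "W22_data \<gamma> v1 v2 h1 h2"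
proof -
  obtain v h where vh: "\<And>t. t \<in> {0..1} \<Longrightarrow> (\<gamma> has_vector_derivative v t) (at t within {0..1})"
    "h absolutely_integrable_on {0..1}" "(\<lambda>t. (norm (h t))\<^sup>2) integrable_on {0..1}"
    "\<And>t. t \<in> {0..1} \<Longrightarrow> v t = v 0 + integral {0..t} h"
    using assms unfolding W22_def by blast
  have *: "prim_on 0 1 (\<lambda>t. g (v t)) (\<lambda>t. g (h t)) \<and> L2_on 0 1 (\<lambda>t. g (h t))"
    if g: "bounded_linear g" "\<And>x. \<bar>g x\<bar> \<le> norm x" for g :: "real \<times> real \<Rightarrow> real"
  proof -
    have ai: "(\<lambda>t. g (h t)) absolutely_integrable_on {0..1}"
      using absolutely_integrable_linear[OF vh(2) g(1)] by (simp add: o_def)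
    have "prim_on 0 1 (\<lambda>t. g (v t)) (\<lambda>t. g (h t))"
      unfolding prim_on_def
    proof (intro conjI ballI ai)
      fix t :: real assume t: "t \<in> {0..1}"
      have "h absolutely_integrable_on {0..t}"
        using t by (intro absolutely_integrable_on_subinterval[OF vh(2)]) auto
      then have "h integrable_on {0..t}" by (rule set_lebesgue_integral_eq_integral(1))
      from integral_linear[OF this g(1)] show "g (v t) = g (v 0) + integral {0..t} (\<lambda>t. g (h t))"
        using vh(4)[OF t] linear_add[OF bounded_linear.linear[OF g(1)]] by (simp add: o_def)
    qed
    moreover have "(\<lambda>t. (g (h t))\<^sup>2) absolutely_integrable_on {0..1}"
    proof (rule measurable_bounded_by_integrable_imp_absolutely_integrable[OF _ _ vh(3)])
      have "(\<lambda>t. g (h t)) \<in> borel_measurable (lebesgue_on {0..1})"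
        using ai absolutely_integrable_measurable[of "{0..1}" "\<lambda>t. g (h t)"] by simp
      then show "(\<lambda>t. (g (h t))\<^sup>2) \<in> borel_measurable (lebesgue_on {0..1})" by simp
      show "norm ((g (h t))\<^sup>2) \<le> (norm (h t))\<^sup>2" for t
        using power_mono[OF g(2), of "h t" 2] by simp
    qed simp
    then have "L2_on 0 1 (\<lambda>t. g (h t))"
      unfolding L2_on_def using ai set_lebesgue_integral_eq_integral(1) by blast
    ultimately show ?thesis by blast
  qed
  have "W22_data \<gamma> (\<lambda>t. fst (v t)) (\<lambda>t. snd (v t)) (\<lambda>t. fst (h t)) (\<lambda>t. snd (h t))"
    unfolding W22_data_def
    using *[OF bounded_linear_fst] *[OF bounded_linear_snd] vh(1)
    by (auto simp: norm_fst_le norm_snd_le real_norm_def[symmetric] simp del: real_norm_def)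
  then show ?thesis by (rule that)
qed

lemma W22_dataD:
  assumes "W22_data \<gamma> v1 v2 h1 h2"
  shows "\<And>t. t \<in> {0..1} \<Longrightarrow> (\<gamma> has_vector_derivative (v1 t, v2 t)) (at t within {0..1})"
    "prim_on 0 1 v1 h1" "prim_on 0 1 v2 h2" "L2_on 0 1 h1" "L2_on 0 1 h2"
    "continuous_on {0..1} v1" "continuous_on {0..1} v2"
  using assms prim_on_continuous unfolding W22_data_def by blast+

lemma data_imp_W22:
  assumes "W22_data \<gamma> v1 v2 h1 h2"
  shows "W22 \<gamma>"
proof -
  note d = W22_dataD[OF assms]
  have L: "bounded_linear (\<lambda>x::real. (x, 0::real))" "bounded_linear (\<lambda>x::real. (0::real, x))"
    by (intro bounded_linear_Pair bounded_linear_ident bounded_linear_zero)+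
  have eq: "(h1 t, h2 t) = (h1 t, 0) + (0, h2 t)" for t by simp
  have ai: "(\<lambda>t. (h1 t, h2 t)) absolutely_integrable_on {0..1}"
    unfolding eq using absolutely_integrable_linear[OF prim_onD(1)[OF d(2)] L(1)]
      absolutely_integrable_linear[OF prim_onD(1)[OF d(3)] L(2)]
    by (intro set_integral_add(1)) (simp_all add: o_def)
  have sq: "(\<lambda>t. (norm (h1 t, h2 t))\<^sup>2) integrable_on {0..1}"
    using d(4,5) unfolding L2_on_def by (simp add: norm_Pair) (intro integrable_add; blast)
  have "(v1 t, v2 t) = (v1 0, v2 0) + integral {0..t} (\<lambda>t. (h1 t, h2 t))" if t: "t \<in> {0..1}" for t
  proof -
    have i: "h1 integrable_on {0..t}" "h2 integrable_on {0..t}"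
      using prim_on_integrable(2)[OF d(2)] prim_on_integrable(2)[OF d(3)] t by auto
    have "integral {0..t} (\<lambda>t. (h1 t, h2 t)) = integral {0..t} (\<lambda>t. (h1 t, 0)) + integral {0..t} (\<lambda>t. (0, h2 t))"
      unfolding eq using integrable_linear[OF i(1) L(1)] integrable_linear[OF i(2) L(2)]
      by (intro Henstock_Kurzweil_Integration.integral_add) (auto simp: o_def)
    then show ?thesis
      using integral_linear[OF i(1) L(1)] integral_linear[OF i(2) L(2)]
        prim_onD(3)[OF d(2) t] prim_onD(3)[OF d(3) t] by (simp add: o_def)
  qed
  then show ?thesis unfolding W22_def
    using ai sq d(1)
    by (intro exI[of _ "\<lambda>t. (v1 t, v2 t)"] exI[of _ "\<lambda>t. (h1 t, h2 t)"] conjI ballI) assumption+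
qed

lemma data_d1:
  assumes "W22_data \<gamma> v1 v2 h1 h2" "t \<in> {0..1}"
  shows "d1 \<gamma> t = (v1 t, v2 t)"
  unfolding d1_def using assms
  by (intro vector_derivative_within_closed_interval W22_dataD(1)) auto

lemma data_d2:
  assumes "W22_data \<gamma> v1 v2 h1 h2"
  obtains N where "negligible N" "\<And>t. t \<in> {0..1} - N \<Longrightarrow> d2 \<gamma> t = (h1 t, h2 t)"
proof -
  note d = W22_dataD[OF assms]
  obtain N1 where N1: "negligible N1"
    "\<And>t. t \<in> {0..1} - N1 \<Longrightarrow> (v1 has_real_derivative h1 t) (at t within {0..1})"
    using prim_on_ae_derivative[OF d(2)] by blast
  obtain N2 where N2: "negligible N2"
    "\<And>t. t \<in> {0..1} - N2 \<Longrightarrow> (v2 has_real_derivative h2 t) (at t within {0..1})"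
    using prim_on_ae_derivative[OF d(3)] by blast
  show ?thesis
  proof
    show "negligible (N1 \<union> N2)" using N1 N2 by simp
    fix t assume t: "t \<in> {0..1} - (N1 \<union> N2)"
    have "((\<lambda>t. (v1 t, v2 t)) has_vector_derivative (h1 t, h2 t)) (at t within {0..1})"
      using N1(2)[of t] N2(2)[of t] t
      by (intro has_vector_derivative_Pair) (auto simp: has_real_derivative_iff_has_vector_derivative)
    then have "(d1 \<gamma> has_vector_derivative (h1 t, h2 t)) (at t within {0..1})"
      by (rule has_vector_derivative_transform[rotated 2]) (use t in \<open>auto simp: data_d1[OF assms]\<close>)
    then show "d2 \<gamma> t = (h1 t, h2 t)"
      unfolding d2_def using t by (intro vector_derivative_within_closed_interval) auto
  qed
qed

lemma data_length:
  assumes "W22_data \<gamma> v1 v2 h1 h2"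
  shows "curve_length \<gamma> = integral {0..1} (\<lambda>t. sqrt ((v1 t)\<^sup>2 + (v2 t)\<^sup>2))"
  unfolding curve_length_def by (intro integral_cong) (simp add: data_d1[OF assms] norm_Pair)

lemma data_bending:
  assumes "W22_data \<gamma> v1 v2 h1 h2"
  shows "bending \<gamma> = integral {0..1} (\<lambda>t. (v1 t * h2 t - v2 t * h1 t)\<^sup>2 / sqrt ((v1 t)\<^sup>2 + (v2 t)\<^sup>2) ^ 5)"
proof -
  obtain N where N: "negligible N" "\<And>t. t \<in> {0..1} - N \<Longrightarrow> d2 \<gamma> t = (h1 t, h2 t)"
    using data_d2[OF assms] by blast
  show ?thesis unfolding bending_def
  proof (rule integral_spike[OF N(1)])
    fix t :: real assume t: "t \<in> {0..1} - N"
    define m where "m = sqrt ((v1 t)\<^sup>2 + (v2 t)\<^sup>2)"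
    define w where "w = v1 t * h2 t - v2 t * h1 t"
    have "(curv \<gamma> t)\<^sup>2 * norm (d1 \<gamma> t) = (w / m ^ 3)\<^sup>2 * m"
      using t unfolding curv_def by (simp add: N(2)[OF t] data_d1[OF assms] norm_Pair m_def w_def)
    also have "\<dots> = w\<^sup>2 / m ^ 5"
      \<comment> \<open>Where the speed vanishes both sides are 0, by the convention for division by
        zero.\<close>
      by (cases "m = 0") (auto simp: power_divide field_simps eval_nat_numeral)
    finally show "(v1 t * h2 t - v2 t * h1 t)\<^sup>2 / sqrt ((v1 t)\<^sup>2 + (v2 t)\<^sup>2) ^ 5 = (curv \<gamma> t)\<^sup>2 * norm (d1 \<gamma> t)"
      by (simp add: m_def w_def)
  qed
qed

text \<open>It lets the left half of a curve be run backwards from the midpoint, so that one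
  half-arc estimate serves both halves.\<close>

lemma prim_on_reflect:
  assumes "prim_on a b f h"
  shows "prim_on (- b) (- a) (\<lambda>t. f (- t)) (\<lambda>t. - h (- t))"
  unfolding prim_on_def
proof (intro conjI ballI)
  have "(\<lambda>t. h (- t)) absolutely_integrable_on {-b..-a}" using prim_onD(1)[OF assms] by simp
  then show "(\<lambda>t. - h (- t)) absolutely_integrable_on {-b..-a}"
    using absolutely_integrable_continuous_mult[of "-b" "-a" "\<lambda>_. -1"] by auto
  fix t assume t: "t \<in> {-b..-a}"
  have "integral {-b..t} (\<lambda>t. h (- t)) = integral {-t..b} h"
    using Henstock_Kurzweil_Integration.integral_reflect_real[of b "-t" h] by simp
  also have "\<dots> = f b - f (- t)" using prim_on_diff[OF assms, of "-t" b] t by auto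
  finally show "f (- t) = f (- (- b)) + integral {-b..t} (\<lambda>t. - h (- t))" by simp
qed

lemma A_ell_data:
  assumes "\<eta> \<in> A_ell l"
  obtains v1 v2 h1 h2 where "W22_data \<eta> v1 v2 h1 h2" "\<And>t. t \<in> {0..1} \<Longrightarrow> 0 < (v1 t)\<^sup>2 + (v2 t)\<^sup>2"
    "integral {0..1} v1 = l" "integral {0..1} v2 = 0"
proof -
  obtain v1 v2 h1 h2 where d: "W22_data \<eta> v1 v2 h1 h2"
    using assms W22_imp_data unfolding A_ell_def by blast
  have pos: "0 < (v1 t)\<^sup>2 + (v2 t)\<^sup>2" if "t \<in> {0..1}" for t
    using assms that data_d1[OF d that] unfolding A_ell_def
    by (auto simp: sum_power2_gt_zero_iff zero_prod_def)
  have "((\<lambda>t. (v1 t, v2 t)) has_integral (\<eta> 1 - \<eta> 0)) {0..1}"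
    using W22_dataD(1)[OF d] by (intro fundamental_theorem_of_calculus) auto
  then have i: "((\<lambda>t. (v1 t, v2 t)) has_integral (l, 0)) {0..1}" using assms by (simp add: A_ell_def)
  have "integral {0..1} v1 = l" "integral {0..1} v2 = 0"
    using has_integral_linear[OF i bounded_linear_fst] has_integral_linear[OF i bounded_linear_snd]
    by (auto simp: o_def integral_unique)
  then show ?thesis using d pos that by blast
qed

text \<open>Rotating so that the tangent angle vanishes at the midpoint of the curve decouples the two
  halves; the rotated chord has horizontal extent at most \<open>l\<close>, which replaces the constraint.\<close>

lemma bending_lower_bound:
  assumes eta: "\<eta> \<in> A_ell l" and l: "0 < l" and q: "0 < q" "q < qstar"
    and len: "curve_length \<eta> = l * (ellK q / ellP q)"
  shows "16 / l * (ellP q * ellH q) \<le> bending \<eta>"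
proof -
  have q1: "q < 1" using q qstar_props by auto
  have Kpos: "0 < ellK q" using ellK_pos[of q] q q1 by auto
  have Ppos: "0 < ellP q" using ellP_pos q by auto
  obtain v1 v2 h1 h2 where d: "W22_data \<eta> v1 v2 h1 h2"
    and pos: "\<And>t. t \<in> {0..1} \<Longrightarrow> 0 < (v1 t)\<^sup>2 + (v2 t)\<^sup>2"
    and iv: "integral {0..1} v1 = l" "integral {0..1} v2 = 0"
    using A_ell_data[OF eta] by blast
  note dd = W22_dataD[OF d]
  define n where "n t = v1 t * v1 t + v2 t * v2 t" for t
  define n' where "n' t = (v1 t * h1 t + h1 t * v1 t) + (v2 t * h2 t + h2 t * v2 t)" for t
  define m where "m t = sqrt (n t)" for t
  have npos: "0 < n t" if "t \<in> {0..1}" for t using pos[OF that] by (simp add: n_def power2_eq_square)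
  have mpos: "0 < m t" if "t \<in> {0..1}" for t using npos[OF that] by (simp add: m_def)
  have m2: "m t * m t = n t" if "t \<in> {0..1}" for t using npos[OF that] by (simp add: m_def)
  have pn: "prim_on 0 1 n n'" unfolding n_def n'_def by (intro prim_on_add prim_on_mult dd)
  have cn: "continuous_on {0..1} n" by (rule prim_on_continuous[OF pn])
  have cm: "continuous_on {0..1} m" unfolding m_def by (intro continuous_intros cn)
  have pim: "prim_on 0 1 (\<lambda>t. 1 / sqrt (n t)) (\<lambda>t. - 1 / (2 * n t * sqrt (n t)) * n' t)"
  proof (rule prim_on_chain[OF pn, of "\<lambda>x. 1 / sqrt x" "\<lambda>x. - 1 / (2 * x * sqrt x)"])
    show "((\<lambda>x. 1 / sqrt x) has_real_derivative - 1 / (2 * x * sqrt x)) (at x within n ` {0..1})"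
      if "x \<in> n ` {0..1}" for x
    proof -
      have "x > 0" using that npos by auto
      then show ?thesis by (auto intro!: derivative_eq_intros simp: field_simps)
    qed
    show "continuous_on (n ` {0..1}) (\<lambda>x. - 1 / (2 * x * sqrt x))"
      using npos by (intro continuous_intros) force
  qed
  \<comment> \<open>The rate at which the tangent turns in the parameter \<open>t\<close>, that is,
    curvature times speed; the bending integrand becomes k^2 / m.\<close>
  define k where "k t = (v1 t * h2 t - v2 t * h1 t) / n t" for t
  have L2k: "L2_on 0 1 k"
  proof -
    have "L2_on 0 1 (\<lambda>t. (v1 t / n t) * h2 t - (v2 t / n t) * h1 t)"
      using npos by (intro L2_on_diff L2_on_mult dd continuous_intros cn) force+
    then show ?thesis unfolding k_def by (simp add: diff_divide_distrib)
  qed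
  define L where "L = curve_length \<eta>"
  have Lm: "L = integral {0..1} m"
    unfolding L_def data_length[OF d] m_def n_def by (simp add: power2_eq_square)
  have L: "L = l * (ellK q / ellP q)" using len by (simp add: L_def)
  have Lpos: "0 < L" unfolding L using l Kpos Ppos by simp
  \<comment> \<open>The scale that takes half the length to \<open>ellK q\<close>. The assumption on
    the length then makes the scaled chord \<open>al * l\<close> equal to that of the arc,
    \<open>2 * ellP q\<close>.\<close>
  define al where "al = 2 * ellK q / L"
  have al: "0 < al" using Kpos Lpos by (simp add: al_def)
  have all: "al * l = 2 * ellP q" unfolding al_def L using l Kpos Ppos by simp
  have mi: "m integrable_on {c..d}" if "0 \<le> c" "d \<le> 1" for c d
    using that by (intro integrable_continuous_real continuous_on_subset[OF cm]) auto
  have "\<exists>t0\<ge>0. t0 \<le> 1 \<and> integral {0..t0} m = L / 2"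
    using Lm Lpos mi by (intro IVT' indefinite_integral_continuous_1) auto
  then obtain t0 where t0: "0 \<le> t0" "t0 \<le> 1" "integral {0..t0} m = L / 2" by blast
  have t0': "0 < t0" "t0 < 1" using t0 Lpos Lm by (auto simp: order.order_iff_strict)
  have "integral {0..t0} m + integral {t0..1} m = integral {0..1} m"
    using t0 by (intro Henstock_Kurzweil_Integration.integral_combine mi) auto
  then have right: "integral {t0..1} m = L / 2" using t0 Lm by simp
  define th where "th t = integral {0..t} k - integral {0..t0} k" for t
  have pth: "prim_on 0 1 th k" unfolding prim_on_def th_def using L2k by (auto simp: L2_on_def)
  have th0: "th t0 = 0" by (simp add: th_def)
  define u1 where "u1 t = v1 t * (1 / sqrt (n t))" for t
  define u2 where "u2 t = v2 t * (1 / sqrt (n t))" for t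
  define u1' where "u1' t = v1 t * (- 1 / (2 * n t * sqrt (n t)) * n' t) + h1 t * (1 / sqrt (n t))" for t
  define u2' where "u2' t = v2 t * (- 1 / (2 * n t * sqrt (n t)) * n' t) + h2 t * (1 / sqrt (n t))" for t
  have pu: "prim_on 0 1 u1 u1'" "prim_on 0 1 u2 u2'"
    unfolding u1_def u2_def u1'_def u2'_def by (intro prim_on_mult pim dd)+
  have u': "u1' t = - u2 t * k t" "u2' t = u1 t * k t" if t: "t \<in> {0..1}" for t
  proof -
    define s where "s = m t"
    have s: "s > 0" "sqrt (n t) = s" "n t = s * s" "s * s = v1 t * v1 t + v2 t * v2 t"
      using mpos[OF t] m2[OF t] by (auto simp: s_def m_def n_def)
    have "u1' t = (h1 t * (s * s) - v1 t * (v1 t * h1 t + v2 t * h2 t)) / s ^ 3"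
      unfolding u1'_def n'_def s(2) s(3) using s(1) by (simp add: field_simps eval_nat_numeral)
    also have "h1 t * (s * s) - v1 t * (v1 t * h1 t + v2 t * h2 t) = - v2 t * (v1 t * h2 t - v2 t * h1 t)"
      unfolding s(4) by (simp add: algebra_simps)
    also have "\<dots> / s ^ 3 = - u2 t * k t"
      unfolding u2_def k_def s(2) s(3) using s(1) by (simp add: field_simps eval_nat_numeral)
    finally show "u1' t = - u2 t * k t" .
    have "u2' t = (h2 t * (s * s) - v2 t * (v1 t * h1 t + v2 t * h2 t)) / s ^ 3"
      unfolding u2'_def n'_def s(2) s(3) using s(1) by (simp add: field_simps eval_nat_numeral)
    also have "h2 t * (s * s) - v2 t * (v1 t * h1 t + v2 t * h2 t) = v1 t * (v1 t * h2 t - v2 t * h1 t)"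
      unfolding s(4) by (simp add: algebra_simps)
    also have "\<dots> / s ^ 3 = u1 t * k t"
      unfolding u1_def k_def s(2) s(3) using s(1) by (simp add: field_simps eval_nat_numeral)
    finally show "u2' t = u1 t * k t" .
  qed
  have pc: "prim_on 0 1 (\<lambda>t. cos (th t)) (\<lambda>t. - sin (th t) * k t)"
    by (rule prim_on_chain_UNIV[OF pth]) (auto intro!: derivative_eq_intros continuous_intros)
  have ps: "prim_on 0 1 (\<lambda>t. sin (th t)) (\<lambda>t. cos (th t) * k t)"
    by (rule prim_on_chain_UNIV[OF pth]) (auto intro!: derivative_eq_intros continuous_intros)
  \<comment> \<open>\<open>(A, B)\<close> is the unit tangent rotated back by the angle
    \<open>th\<close>. Both turn at the rate \<open>k\<close>, so it is constant and equals the unit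
    tangent at the midpoint. In this way no continuous choice of argument for the tangent has to be
    made.\<close>
  define A where "A = u1 0 * cos (th 0) + u2 0 * sin (th 0)"
  define B where "B = u2 0 * cos (th 0) + (-1) * (u1 0 * sin (th 0))"
  have cA: "u1 t * cos (th t) + u2 t * sin (th t) = A" if t: "t \<in> {0..1}" for t
    unfolding A_def
    by (rule prim_on_zero[OF prim_on_add[OF prim_on_mult[OF pu(1) pc] prim_on_mult[OF pu(2) ps]] _ t])
      (simp add: u' algebra_simps)
  have cB: "u2 t * cos (th t) + (-1) * (u1 t * sin (th t)) = B" if t: "t \<in> {0..1}" for t
    unfolding B_def
    by (rule prim_on_zero[OF prim_on_add[OF prim_on_mult[OF pu(2) pc] prim_on_cmult[OF prim_on_mult[OF pu(1) ps]]] _ t])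
      (simp add: u' algebra_simps)
  have unit: "u1 t * u1 t + u2 t * u2 t = 1" if t: "t \<in> {0..1}" for t
  proof -
    have "u1 t * u1 t + u2 t * u2 t = (v1 t * v1 t + v2 t * v2 t) / (m t * m t)"
      by (simp add: u1_def u2_def m_def add_divide_distrib)
    then show ?thesis unfolding m2[OF t] n_def[symmetric] using npos[OF t] by simp
  qed
  have costh: "cos (th t) * m t = A * v1 t + B * v2 t" if t: "t \<in> {0..1}" for t
  proof -
    have "A * u1 t + B * u2 t = (u1 t * u1 t + u2 t * u2 t) * cos (th t)"
      unfolding cA[OF t, symmetric] cB[OF t, symmetric] by (simp add: algebra_simps)
    then have "cos (th t) = A * u1 t + B * u2 t" unfolding unit[OF t] by simp
    moreover have "u1 t * m t = v1 t" "u2 t * m t = v2 t"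
      using mpos[OF t] by (auto simp: u1_def u2_def m_def)
    ultimately show ?thesis by (simp add: algebra_simps)
  qed
  have "A\<^sup>2 + B\<^sup>2 = (u1 0 * u1 0 + u2 0 * u2 0) * ((sin (th 0))\<^sup>2 + (cos (th 0))\<^sup>2)"
  proof -
    have "(a * c + b * s)\<^sup>2 + (b * c + (-1) * (a * s))\<^sup>2 = (a * a + b * b) * (s\<^sup>2 + c\<^sup>2)" for a b c s :: real
      by (simp add: algebra_simps power2_eq_square)
    then show ?thesis unfolding A_def B_def .
  qed
  then have "A\<^sup>2 + B\<^sup>2 = 1" unfolding sin_cos_squared_add using unit[of 0] by simp
  then have "A\<^sup>2 \<le> 1" using zero_le_power2[of B] by linarith
  then have A1: "A \<le> 1" using power2_le_imp_le[of A 1] by simp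
  have X: "integral {0..1} (\<lambda>t. cos (th t) * m t) \<le> l"
  proof -
    have "integral {0..1} (\<lambda>t. cos (th t) * m t) = integral {0..1} (\<lambda>t. A * v1 t + B * v2 t)"
      using costh by (intro integral_cong)
    also have "\<dots> = A * integral {0..1} v1 + B * integral {0..1} v2"
      using dd(6,7) by (subst Henstock_Kurzweil_Integration.integral_add)
        (auto intro!: integrable_continuous_real continuous_intros)
    finally show ?thesis unfolding iv using A1 l by simp
  qed
  have ikm: "(\<lambda>t. (k t)\<^sup>2 / m t) integrable_on {0..1}"
  proof -
    have "(\<lambda>t. (k t)\<^sup>2) absolutely_integrable_on {0..1}"
      using L2k by (auto simp: L2_on_def intro!: nonnegative_absolutely_integrable_1)
    then have "(\<lambda>t. (1 / m t) * (k t)\<^sup>2) absolutely_integrable_on {0..1}"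
      using mpos by (intro absolutely_integrable_continuous_mult continuous_intros cm) force+
    then show ?thesis using set_lebesgue_integral_eq_integral(1) by fastforce
  qed
  have ikm': "(\<lambda>t. (k t)\<^sup>2 / m t) integrable_on {c..d}" if "0 \<le> c" "d \<le> 1" for c d
    using integrable_on_subinterval[OF ikm, of c d] that by auto
  have icm: "(\<lambda>t. cos (th t) * m t) integrable_on {c..d}" if "0 \<le> c" "d \<le> 1" for c d
    using that by (intro integrable_continuous_real continuous_intros
      continuous_on_subset[OF cm] continuous_on_subset[OF prim_on_continuous[OF pth]]) auto
  let ?c = "al * (4 * ellEc q - (3 - 2 * q\<^sup>2) * ellK q)"
  have R: "?c \<le> 1/2 * integral {t0..1} (\<lambda>t. (k t)\<^sup>2 / m t) + al\<^sup>2 * integral {t0..1} (\<lambda>t. cos (th t) * m t)"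
    using t0' al q q1 mpos Lpos
    by (intro half_arc_bound prim_on_subset[OF pth] th0 continuous_on_subset[OF cm] ikm')
      (auto simp: right al_def)
  have "?c \<le> 1/2 * integral {-t0..0} (\<lambda>t. (- k (- t))\<^sup>2 / m (- t)) + al\<^sup>2 * integral {-t0..0} (\<lambda>t. cos (th (- t)) * m (- t))"
  proof (rule half_arc_bound)
    show "prim_on (- t0) 0 (\<lambda>t. th (- t)) (\<lambda>t. - k (- t))"
      using prim_on_reflect[OF prim_on_subset[OF pth, of 0 t0]] t0' by simp
    show "continuous_on {- t0..0} (\<lambda>t. m (- t))"
      by (rule continuous_on_compose2[OF cm]) (use t0' in \<open>auto intro!: continuous_intros\<close>)
    show "(\<lambda>t. (- k (- t))\<^sup>2 / m (- t)) integrable_on {- t0..0}"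
      using ikm'[of 0 t0] t0' Henstock_Kurzweil_Integration.integrable_reflect_real[of "\<lambda>t. (k t)\<^sup>2 / m t" t0 0] by simp
    have e: "integral {- t0..0} (\<lambda>t. m (- t)) = L / 2"
      using t0(3) Henstock_Kurzweil_Integration.integral_reflect_real[of t0 0 m] by simp
    show "al * integral {- t0..0} (\<lambda>t. m (- t)) = ellK q"
      unfolding e using Lpos by (simp add: al_def)
  qed (use t0' th0 al q q1 mpos in auto)
  then have Lf: "?c \<le> 1/2 * integral {0..t0} (\<lambda>t. (k t)\<^sup>2 / m t) + al\<^sup>2 * integral {0..t0} (\<lambda>t. cos (th t) * m t)"
    using Henstock_Kurzweil_Integration.integral_reflect_real[of t0 0 "\<lambda>t. (k t)\<^sup>2 / m t"]
      Henstock_Kurzweil_Integration.integral_reflect_real[of t0 0 "\<lambda>t. cos (th t) * m t"] by simp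
  have c1: "integral {0..t0} (\<lambda>t. (k t)\<^sup>2 / m t) + integral {t0..1} (\<lambda>t. (k t)\<^sup>2 / m t) = integral {0..1} (\<lambda>t. (k t)\<^sup>2 / m t)"
    using t0' by (intro Henstock_Kurzweil_Integration.integral_combine ikm) auto
  have c2: "integral {0..t0} (\<lambda>t. cos (th t) * m t) + integral {t0..1} (\<lambda>t. cos (th t) * m t) = integral {0..1} (\<lambda>t. cos (th t) * m t)"
    using t0' by (intro Henstock_Kurzweil_Integration.integral_combine icm) auto
  have bend: "bending \<eta> = integral {0..1} (\<lambda>t. (k t)\<^sup>2 / m t)"
    unfolding data_bending[OF d]
  proof (rule integral_cong)
    fix t :: real assume t: "t \<in> {0..1}"
    have "sqrt ((v1 t)\<^sup>2 + (v2 t)\<^sup>2) = m t" by (simp add: m_def n_def power2_eq_square)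
    moreover have "(k t)\<^sup>2 / m t = (v1 t * h2 t - v2 t * h1 t)\<^sup>2 / m t ^ 5"
      unfolding k_def m2[OF t, symmetric] using mpos[OF t]
      by (simp add: power_divide field_simps eval_nat_numeral)
    ultimately show "(v1 t * h2 t - v2 t * h1 t)\<^sup>2 / sqrt ((v1 t)\<^sup>2 + (v2 t)\<^sup>2) ^ 5 = (k t)\<^sup>2 / m t" by simp
  qed
  have "al\<^sup>2 * integral {0..1} (\<lambda>t. cos (th t) * m t) \<le> al\<^sup>2 * l" using X by (intro mult_left_mono) auto
  then have "2 * ?c \<le> 1/2 * bending \<eta> + al\<^sup>2 * l"
    using R Lf unfolding bend c1[symmetric] c2[symmetric] by (simp add: algebra_simps)
  moreover have "al\<^sup>2 * l = al * (2 * ellP q)" using all by (simp add: power2_eq_square)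
  \<comment> \<open>The constants combine because 4E - (3 - 2 q^2) K minus \<open>ellP q\<close>
    equals \<open>2 * ellH q\<close>.\<close>
  ultimately have "8 * al * ellH q \<le> bending \<eta>"
    unfolding ellP_def ellH_def by (simp add: algebra_simps)
  moreover have "8 * al * ellH q = 16 / l * (ellP q * ellH q)"
  proof -
    have "al = 2 * ellP q / l" using all l by (simp add: field_simps)
    then show ?thesis by simp
  qed
  ultimately show ?thesis by simp
qed

section \<open>Curves parametrized by the amplitude\<close>

definition C2_fun :: "(real \<Rightarrow> real) \<Rightarrow> (real \<Rightarrow> real) \<Rightarrow> (real \<Rightarrow> real) \<Rightarrow> bool" where
  "C2_fun X X1 X2 \<longleftrightarrow> (\<forall>x. (X has_real_derivative X1 x) (at x)) \<and>
     (\<forall>x. (X1 has_real_derivative X2 x) (at x)) \<and> continuous_on UNIV X2"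

lemma C2_funD:
  assumes "C2_fun X X1 X2"
  shows "\<And>x. (X has_real_derivative X1 x) (at x)" "\<And>x. (X1 has_real_derivative X2 x) (at x)"
    "continuous_on S X1" "continuous_on S X2"
proof -
  show "\<And>x. (X has_real_derivative X1 x) (at x)" and d: "\<And>x. (X1 has_real_derivative X2 x) (at x)"
    using assms unfolding C2_fun_def by auto
  show "continuous_on S X1" by (rule DERIV_continuous_on[OF has_field_derivative_at_within[OF d]])
  show "continuous_on S X2" using assms continuous_on_subset unfolding C2_fun_def by blast
qed

lemma C2_fun_diff:
  assumes "C2_fun X X1 X2" "C2_fun Y Y1 Y2"
  shows "C2_fun (\<lambda>x. X x - Y x) (\<lambda>x. X1 x - Y1 x) (\<lambda>x. X2 x - Y2 x)"
  using assms unfolding C2_fun_def by (auto intro!: derivative_intros continuous_intros)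

text \<open>\<open>\<psi>\<close> is the derivative and \<open>\<omega>\<close> the weak second
  derivative of the amplitude \<open>\<phi>\<close> as a function of the parameter. The range is the
  same for all moduli, so one reparametrization serves the whole family of competitors.\<close>

definition amp_param :: "(real \<Rightarrow> real) \<Rightarrow> (real \<Rightarrow> real) \<Rightarrow> (real \<Rightarrow> real) \<Rightarrow> bool" where
  "amp_param \<phi> \<psi> \<omega> \<longleftrightarrow> \<phi> 0 = - (pi/2) \<and> \<phi> 1 = pi/2 \<and>
     (\<forall>t\<in>{0..1}. (\<phi> has_real_derivative \<psi> t) (at t within {0..1}) \<and> 0 < \<psi> t \<and> \<phi> t \<in> {-(pi/2)..pi/2}) \<and>
     prim_on 0 1 \<psi> \<omega> \<and> L2_on 0 1 \<omega>"

lemma amp_paramD: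
  assumes "amp_param \<phi> \<psi> \<omega>"
  shows "\<phi> 0 = - (pi/2)" "\<phi> 1 = pi/2"
    "\<And>t. t \<in> {0..1} \<Longrightarrow> (\<phi> has_real_derivative \<psi> t) (at t within {0..1})"
    "\<And>t. t \<in> {0..1} \<Longrightarrow> 0 < \<psi> t" "\<And>t. t \<in> {0..1} \<Longrightarrow> \<phi> t \<in> {-(pi/2)..pi/2}"
    "prim_on 0 1 \<psi> \<omega>" "L2_on 0 1 \<omega>" "continuous_on {0..1} \<phi>" "continuous_on {0..1} \<psi>"
proof -
  show d: "\<And>t. t \<in> {0..1} \<Longrightarrow> (\<phi> has_real_derivative \<psi> t) (at t within {0..1})"
    and p: "prim_on 0 1 \<psi> \<omega>"
    using assms unfolding amp_param_def by blast+
  show "continuous_on {0..1} \<phi>" by (rule DERIV_continuous_on[OF d])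
  show "continuous_on {0..1} \<psi>" by (rule prim_on_continuous[OF p])
qed (use assms in \<open>unfold amp_param_def, blast+\<close>)

lemma comp_data:
  assumes p: "amp_param \<phi> \<psi> \<omega>" and X: "C2_fun X X1 X2" and Y: "C2_fun Y Y1 Y2"
    and g: "\<forall>t\<in>{0..1}. \<gamma> t = (X (\<phi> t), Y (\<phi> t))"
  shows "W22_data \<gamma> (\<lambda>t. X1 (\<phi> t) * \<psi> t) (\<lambda>t. Y1 (\<phi> t) * \<psi> t)
     (\<lambda>t. X1 (\<phi> t) * \<omega> t + X2 (\<phi> t) * \<psi> t * \<psi> t) (\<lambda>t. Y1 (\<phi> t) * \<omega> t + Y2 (\<phi> t) * \<psi> t * \<psi> t)"
proof -
  note pp = amp_paramD[OF p]
  have cc: "continuous_on {0..1} (\<lambda>t. Z (\<phi> t))" if "continuous_on UNIV Z" for Z :: "real \<Rightarrow> real"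
    by (rule continuous_on_compose2[OF that pp(8)]) simp
  have *: "prim_on 0 1 (\<lambda>t. Z1 (\<phi> t) * \<psi> t) (\<lambda>t. Z1 (\<phi> t) * \<omega> t + Z2 (\<phi> t) * \<psi> t * \<psi> t)
       \<and> L2_on 0 1 (\<lambda>t. Z1 (\<phi> t) * \<omega> t + Z2 (\<phi> t) * \<psi> t * \<psi> t)"
    if Z: "C2_fun Z Z1 Z2" for Z Z1 Z2
  proof
    note z = C2_funD[OF Z]
    have "prim_on 0 1 (\<lambda>t. Z1 (\<phi> t)) (\<lambda>t. Z2 (\<phi> t) * \<psi> t)"
      by (intro prim_on_C1 DERIV_chain2[OF z(2)] pp continuous_intros cc z)
    then show "prim_on 0 1 (\<lambda>t. Z1 (\<phi> t) * \<psi> t) (\<lambda>t. Z1 (\<phi> t) * \<omega> t + Z2 (\<phi> t) * \<psi> t * \<psi> t)"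
      by (rule prim_on_mult[OF _ pp(6)])
    show "L2_on 0 1 (\<lambda>t. Z1 (\<phi> t) * \<omega> t + Z2 (\<phi> t) * \<psi> t * \<psi> t)"
      by (intro L2_on_add L2_on_mult L2_on_continuous pp continuous_intros cc z)
  qed
  have "(\<gamma> has_vector_derivative (X1 (\<phi> t) * \<psi> t, Y1 (\<phi> t) * \<psi> t)) (at t within {0..1})"
    if t: "t \<in> {0..1}" for t
  proof -
    have "((\<lambda>t. (X (\<phi> t), Y (\<phi> t))) has_vector_derivative (X1 (\<phi> t) * \<psi> t, Y1 (\<phi> t) * \<psi> t)) (at t within {0..1})"
      using DERIV_chain2[OF C2_funD(1)[OF X] pp(3)[OF t]] DERIV_chain2[OF C2_funD(1)[OF Y] pp(3)[OF t]]
      by (intro has_vector_derivative_Pair) (auto simp: has_real_derivative_iff_has_vector_derivative)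
    then show ?thesis
      by (rule has_vector_derivative_transform[rotated 2]) (use t g in auto)
  qed
  then show ?thesis unfolding W22_data_def using *[OF X] *[OF Y] by blast
qed

lemma comp_integral:
  assumes p: "amp_param \<phi> \<psi> \<omega>" and f: "continuous_on {-(pi/2)..pi/2} f"
  shows "integral {0..1} (\<lambda>t. \<psi> t * f (\<phi> t)) = integral {-(pi/2)..pi/2} (f :: real \<Rightarrow> real)"
proof -
  note pp = amp_paramD[OF p]
  have "((\<lambda>t. \<psi> t *\<^sub>R f (\<phi> t)) has_integral integral {\<phi> 0..\<phi> 1} f) {0..1}"
    using pp f by (intro has_integral_substitution) auto
  then show ?thesis using pp(1,2) by (simp add: integral_unique)
qed

lemma comp_length:
  assumes p: "amp_param \<phi> \<psi> \<omega>" and X: "C2_fun X X1 X2" and Y: "C2_fun Y Y1 Y2"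
    and g: "\<forall>t\<in>{0..1}. \<gamma> t = (X (\<phi> t), Y (\<phi> t))"
  shows "curve_length \<gamma> = integral {-(pi/2)..pi/2} (\<lambda>x. sqrt ((X1 x)\<^sup>2 + (Y1 x)\<^sup>2))"
proof -
  have "curve_length \<gamma> = integral {0..1} (\<lambda>t. \<psi> t * sqrt ((X1 (\<phi> t))\<^sup>2 + (Y1 (\<phi> t))\<^sup>2))"
    unfolding data_length[OF comp_data[OF assms]]
  proof (rule integral_cong)
    fix t :: real assume t: "t \<in> {0..1}"
    have "(X1 (\<phi> t) * \<psi> t)\<^sup>2 + (Y1 (\<phi> t) * \<psi> t)\<^sup>2 = (\<psi> t)\<^sup>2 * ((X1 (\<phi> t))\<^sup>2 + (Y1 (\<phi> t))\<^sup>2)"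
      by (simp add: power_mult_distrib algebra_simps)
    then show "sqrt ((X1 (\<phi> t) * \<psi> t)\<^sup>2 + (Y1 (\<phi> t) * \<psi> t)\<^sup>2) = \<psi> t * sqrt ((X1 (\<phi> t))\<^sup>2 + (Y1 (\<phi> t))\<^sup>2)"
      using amp_paramD(4)[OF p t] by (simp add: real_sqrt_mult)
  qed
  also have "\<dots> = integral {-(pi/2)..pi/2} (\<lambda>x. sqrt ((X1 x)\<^sup>2 + (Y1 x)\<^sup>2))"
    by (rule comp_integral[OF p]) (intro continuous_intros C2_funD[OF X] C2_funD[OF Y])
  finally show ?thesis .
qed

lemma comp_bending:
  assumes p: "amp_param \<phi> \<psi> \<omega>" and X: "C2_fun X X1 X2" and Y: "C2_fun Y Y1 Y2"
    and g: "\<forall>t\<in>{0..1}. \<gamma> t = (X (\<phi> t), Y (\<phi> t))"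
    and nz: "\<And>x. 0 < (X1 x)\<^sup>2 + (Y1 x)\<^sup>2"
  shows "bending \<gamma> = integral {-(pi/2)..pi/2}
      (\<lambda>x. (X1 x * Y2 x - Y1 x * X2 x)\<^sup>2 / sqrt ((X1 x)\<^sup>2 + (Y1 x)\<^sup>2) ^ 5)"
proof -
  let ?f = "\<lambda>x. (X1 x * Y2 x - Y1 x * X2 x)\<^sup>2 / sqrt ((X1 x)\<^sup>2 + (Y1 x)\<^sup>2) ^ 5"
  have "bending \<gamma> = integral {0..1} (\<lambda>t. \<psi> t * ?f (\<phi> t))"
    unfolding data_bending[OF comp_data[OF p X Y g]]
  proof (rule integral_cong)
    fix t :: real assume t: "t \<in> {0..1}"
    define w where "w = \<psi> t"
    have w: "w > 0" using amp_paramD(4)[OF p t] by (simp add: w_def)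
    define a b c d k where "a = X1 (\<phi> t)" and "b = Y1 (\<phi> t)" and "c = X2 (\<phi> t)" and "d = Y2 (\<phi> t)" and "k = \<omega> t"
    define r where "r = sqrt (a\<^sup>2 + b\<^sup>2)"
    have "(a * w)\<^sup>2 + (b * w)\<^sup>2 = w\<^sup>2 * (a\<^sup>2 + b\<^sup>2)"
      by (simp add: power_mult_distrib algebra_simps)
    then have s: "sqrt ((a * w)\<^sup>2 + (b * w)\<^sup>2) = w * r"
      using w by (simp add: real_sqrt_mult r_def)
    \<comment> \<open>The terms with the second derivative of the reparametrization cancel in the
      determinant, which is why bending does not depend on it.\<close>
    have n: "(a * w) * (b * k + d * w * w) - (b * w) * (a * k + c * w * w) = w ^ 3 * (a * d - b * c)"
      by (simp add: algebra_simps eval_nat_numeral)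
    have "((a * w) * (b * k + d * w * w) - (b * w) * (a * k + c * w * w))\<^sup>2 / sqrt ((a * w)\<^sup>2 + (b * w)\<^sup>2) ^ 5
       = w * ((a * d - b * c)\<^sup>2 / r ^ 5)"
      unfolding s n using w by (simp add: power_mult_distrib) (simp add: eval_nat_numeral)
    then show "(X1 (\<phi> t) * \<psi> t * (Y1 (\<phi> t) * \<omega> t + Y2 (\<phi> t) * \<psi> t * \<psi> t)
        - Y1 (\<phi> t) * \<psi> t * (X1 (\<phi> t) * \<omega> t + X2 (\<phi> t) * \<psi> t * \<psi> t))\<^sup>2
        / sqrt ((X1 (\<phi> t) * \<psi> t)\<^sup>2 + (Y1 (\<phi> t) * \<psi> t)\<^sup>2) ^ 5 = \<psi> t * ?f (\<phi> t)"
      by (simp only: w_def a_def b_def c_def d_def k_def r_def)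
  qed
  also have "\<dots> = integral {-(pi/2)..pi/2} ?f"
  proof (intro comp_integral[OF p] continuous_intros C2_funD[OF X] C2_funD[OF Y] ballI)
    show "sqrt ((X1 x)\<^sup>2 + (Y1 x)\<^sup>2) ^ 5 \<noteq> 0" for x
      using zero_less_power[OF real_sqrt_gt_zero[OF nz[of x]], of 5] by linarith
  qed
  finally show ?thesis .
qed

lemma comp_in_A_ell:
  assumes p: "amp_param \<phi> \<psi> \<omega>" and X: "C2_fun X X1 X2" and Y: "C2_fun Y Y1 Y2"
    and g: "\<forall>t\<in>{0..1}. \<gamma> t = (X (\<phi> t), Y (\<phi> t))"
    and nz: "\<And>x. 0 < (X1 x)\<^sup>2 + (Y1 x)\<^sup>2"
    and e: "X (-(pi/2)) = 0" "Y (-(pi/2)) = 0" "X (pi/2) = l" "Y (pi/2) = 0"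
  shows "\<gamma> \<in> A_ell l"
proof -
  note d = comp_data[OF p X Y g]
  have "d1 \<gamma> t \<noteq> 0" if t: "t \<in> {0..1}" for t
    using nz[of "\<phi> t"] amp_paramD(4)[OF p t] by (auto simp: data_d1[OF d t] zero_prod_def)
  then show ?thesis
    unfolding A_ell_def using data_imp_W22[OF d] bspec[OF g, of 0] bspec[OF g, of 1] e amp_paramD(1,2)[OF p] by auto
qed

text \<open>To be applied to the difference of two competitors with the same \<open>\<phi>\<close>,
  which is again of this form. The factor after \<open>e\<close> depends on the reparametrization
  only. The functions themselves are bounded by \<open>pi * e\<close> through the mean value
  theorem, as they vanish at -pi/2.\<close>

lemma comp_W22_norm_le:
  assumes p: "amp_param \<phi> \<psi> \<omega>" and X: "C2_fun X X1 X2" and Y: "C2_fun Y Y1 Y2"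
    and g: "\<forall>t\<in>{0..1}. \<gamma> t = (X (\<phi> t), Y (\<phi> t))"
    and e: "0 \<le> e" "X (-(pi/2)) = 0" "Y (-(pi/2)) = 0"
    and small: "\<And>x. x \<in> {-(pi/2)..pi/2} \<Longrightarrow> \<bar>X1 x\<bar> \<le> e \<and> \<bar>X2 x\<bar> \<le> e \<and> \<bar>Y1 x\<bar> \<le> e \<and> \<bar>Y2 x\<bar> \<le> e"
  shows "W22_norm \<gamma> \<le> e * sqrt (integral {0..1} (\<lambda>t. 2 * pi\<^sup>2 + 2 * (\<psi> t)\<^sup>2 + 4 * (\<omega> t)\<^sup>2 + 4 * (\<psi> t)^4))"
    (is "_ \<le> e * sqrt ?C")
proof -
  note pp = amp_paramD[OF p]
  note d = comp_data[OF p X Y g]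
  have ms: "\<bar>Z x\<bar> \<le> pi * e" if Z: "C2_fun Z Z1 Z2" and z0: "Z (-(pi/2)) = 0"
    and zs: "\<And>x. x \<in> {-(pi/2)..pi/2} \<Longrightarrow> \<bar>Z1 x\<bar> \<le> e" and x: "x \<in> {-(pi/2)..pi/2}" for Z Z1 Z2 x
  proof -
    have "norm (Z x - Z (-(pi/2))) \<le> e * norm (x - (-(pi/2)))"
    proof (rule field_differentiable_bound[where S = "{-(pi/2)..pi/2}" and f' = Z1])
      show "(Z has_field_derivative Z1 z) (at z within {- (pi / 2)..pi / 2})" for z
        by (rule has_field_derivative_at_within[OF C2_funD(1)[OF Z]])
    qed (use zs x in auto)
    also have "\<dots> \<le> e * pi" using x e by (intro mult_left_mono) auto
    finally show ?thesis using z0 by (simp add: mult.commute)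
  qed
  have sq: "z\<^sup>2 \<le> c\<^sup>2" if "\<bar>z\<bar> \<le> c" for z c :: real
    using power_mono[OF that, of 2] by simp
  let ?f = "\<lambda>t. (norm (\<gamma> t))\<^sup>2 + (norm (d1 \<gamma> t))\<^sup>2 + (norm (d2 \<gamma> t))\<^sup>2"
  let ?g = "\<lambda>t. e\<^sup>2 * (2 * pi\<^sup>2 + 2 * (\<psi> t)\<^sup>2 + 4 * (\<omega> t)\<^sup>2 + 4 * (\<psi> t)^4)"
  obtain N where N: "negligible N" "\<And>t. t \<in> {0..1} - N \<Longrightarrow> d2 \<gamma> t
      = (X1 (\<phi> t) * \<omega> t + X2 (\<phi> t) * \<psi> t * \<psi> t, Y1 (\<phi> t) * \<omega> t + Y2 (\<phi> t) * \<psi> t * \<psi> t)"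
    using data_d2[OF d] by blast
  have ae: "?f t \<le> ?g t" if t: "t \<in> {0..1} - N" for t
  proof -
    have t': "t \<in> {0..1}" using t by simp
    note sm = small[OF pp(5)[OF t']]
    have 1: "(X (\<phi> t))\<^sup>2 \<le> (pi * e)\<^sup>2" "(Y (\<phi> t))\<^sup>2 \<le> (pi * e)\<^sup>2"
      using ms[OF X e(2) _ pp(5)[OF t']] ms[OF Y e(3) _ pp(5)[OF t']] small by (auto intro!: sq)
    have 2: "(Z * \<psi> t)\<^sup>2 \<le> e\<^sup>2 * (\<psi> t)\<^sup>2" if "\<bar>Z\<bar> \<le> e" for Z
      using sq[OF that] by (simp add: power_mult_distrib mult_right_mono)
    have 3: "(Z * \<omega> t + W * \<psi> t * \<psi> t)\<^sup>2 \<le> e\<^sup>2 * (2 * (\<omega> t)\<^sup>2 + 2 * (\<psi> t)^4)" if "\<bar>Z\<bar> \<le> e" "\<bar>W\<bar> \<le> e" for Z W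
    proof -
      have "(a + b)\<^sup>2 \<le> 2 * a\<^sup>2 + 2 * b\<^sup>2" for a b :: real
        using zero_le_power2[of "a - b"] by (simp add: power2_sum power2_diff del: zero_le_power2)
      from this[of "Z * \<omega> t" "W * \<psi> t * \<psi> t"]
      have "(Z * \<omega> t + W * \<psi> t * \<psi> t)\<^sup>2 \<le> Z\<^sup>2 * (2 * (\<omega> t)\<^sup>2) + W\<^sup>2 * (2 * (\<psi> t)^4)"
        by (simp add: power_mult_distrib power2_eq_square eval_nat_numeral mult_ac)
      also have "\<dots> \<le> e\<^sup>2 * (2 * (\<omega> t)\<^sup>2) + e\<^sup>2 * (2 * (\<psi> t)^4)"
        by (intro add_mono mult_right_mono sq that) auto
      finally show ?thesis by (simp add: algebra_simps)
    qed
    have "?f t = ((X (\<phi> t))\<^sup>2 + (Y (\<phi> t))\<^sup>2) + ((X1 (\<phi> t) * \<psi> t)\<^sup>2 + (Y1 (\<phi> t) * \<psi> t)\<^sup>2)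
       + ((X1 (\<phi> t) * \<omega> t + X2 (\<phi> t) * \<psi> t * \<psi> t)\<^sup>2 + (Y1 (\<phi> t) * \<omega> t + Y2 (\<phi> t) * \<psi> t * \<psi> t)\<^sup>2)"
      unfolding N(2)[OF t] data_d1[OF d t'] bspec[OF g t'] by (simp add: norm_Pair)
    also have "\<dots> \<le> ((pi * e)\<^sup>2 + (pi * e)\<^sup>2) + (e\<^sup>2 * (\<psi> t)\<^sup>2 + e\<^sup>2 * (\<psi> t)\<^sup>2)
       + (e\<^sup>2 * (2 * (\<omega> t)\<^sup>2 + 2 * (\<psi> t)^4) + e\<^sup>2 * (2 * (\<omega> t)\<^sup>2 + 2 * (\<psi> t)^4))"
      using sm by (intro add_mono 1 2 3) auto
    also have "\<dots> = ?g t" by (simp add: power_mult_distrib algebra_simps)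
    finally show ?thesis .
  qed
  have ig: "?g integrable_on {0..1}"
    using pp(7,9) unfolding L2_on_def
    by (intro integrable_on_mult_right integrable_add) (auto intro!: integrable_continuous_real continuous_intros)
  have gnn: "0 \<le> ?g t" for t by (intro mult_nonneg_nonneg add_nonneg_nonneg) auto
  have "integral {0..1} ?f \<le> integral {0..1} ?g"
  proof (cases "?f integrable_on {0..1}")
    case True
    define f' where "f' t = (if t \<in> N then 0 else ?f t)" for t
    have "integral {0..1} ?f = integral {0..1} f'"
      by (rule integral_spike[OF N(1)]) (simp add: f'_def)
    also have "\<dots> \<le> integral {0..1} ?g"
    proof (rule integral_le)
      show "f' integrable_on {0..1}"
        by (rule integrable_spike[OF True N(1)]) (simp add: f'_def)
      show "f' t \<le> ?g t" if "t \<in> {0..1}" for t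
        using ae[of t] gnn[of t] that by (auto simp: f'_def)
    qed (rule ig)
    finally show ?thesis .
  next
    \<comment> \<open>A function that is not integrable has integral 0 by default, so nonnegativity
      of the bound is enough.\<close>
    case False
    have "0 \<le> integral {0..1} ?g" using gnn by (intro integral_nonneg ig) auto
    then show ?thesis using not_integrable_integral[OF False] by simp
  qed
  also have "integral {0..1} ?g = e\<^sup>2 * ?C" by (rule Henstock_Kurzweil_Integration.integral_mult_right)
  finally have "W22_norm \<gamma> \<le> sqrt (e\<^sup>2 * ?C)" unfolding W22_norm_def by (rule real_sqrt_le_mono)
  then show ?thesis using e(1) by (simp add: real_sqrt_mult)
qed

section \<open>The two-parameter family of competitors\<close>

text \<open>In terms of the amplitude, 2E - F and 2 q cos are the coordinates of the elastica;
  \<open>e\<close> shifts the window. Taking \<open>(A, B)\<close> for one coordinate and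
  \<open>(-B, A)\<close> for the other applies a rotation with scaling.\<close>

definition fam :: "real \<Rightarrow> real \<Rightarrow> real \<Rightarrow> real \<Rightarrow> real \<Rightarrow> real" where
  "fam q A B e x = A * (2 * ellE (x + e) q - ellF (x + e) q) + B * (2 * q * cos (x + e))"

definition fam1 :: "real \<Rightarrow> real \<Rightarrow> real \<Rightarrow> real \<Rightarrow> real \<Rightarrow> real" where
  "fam1 q A B e x = A * (2 * Del q (x + e) - 1 / Del q (x + e)) - B * (2 * q * sin (x + e))"

definition fam2 :: "real \<Rightarrow> real \<Rightarrow> real \<Rightarrow> real \<Rightarrow> real \<Rightarrow> real" where
  "fam2 q A B e x = - A * (q\<^sup>2 * sin (x + e) * cos (x + e) / Del q (x + e) * (2 + 1 / (Del q (x + e))\<^sup>2))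
     - B * (2 * q * cos (x + e))"

lemma fam_C2:
  assumes q: "\<bar>q\<bar> < 1"
  shows "C2_fun (\<lambda>x. c * (fam q A B e x - d)) (\<lambda>x. c * fam1 q A B e x) (\<lambda>x. c * fam2 q A B e x)"
  unfolding C2_fun_def
proof (intro conjI allI)
  fix x
  have D: "Del q y > 0" for y using Del_pos[OF q] .
  have sh: "((\<lambda>x. x + e) has_real_derivative 1) (at x)" by (auto intro!: derivative_eq_intros)
  have "((\<lambda>x. fam q A B e x) has_real_derivative
      A * (2 * (Del q (x + e) * 1) - 1 / Del q (x + e) * 1) + B * (2 * q * (- sin (x + e) * 1))) (at x)"
    unfolding fam_def
    by (intro DERIV_add DERIV_cmult DERIV_diff DERIV_chain2[OF DERIV_ellE] DERIV_chain2[OF DERIV_ellF[OF q]]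
        DERIV_chain2[OF DERIV_cos] sh)
  from DERIV_cmult[OF DERIV_diff[OF this DERIV_const], of c d]
  show "((\<lambda>x. c * (fam q A B e x - d)) has_real_derivative c * fam1 q A B e x) (at x)"
    by (rule DERIV_cong) (simp add: fam1_def)
  let ?D' = "- (q\<^sup>2 * sin (x + e) * cos (x + e) / Del q (x + e)) * 1"
  have dD: "((\<lambda>x. Del q (x + e)) has_real_derivative ?D') (at x)" by (rule DERIV_Del[OF q sh])
  have "((\<lambda>x. fam1 q A B e x) has_real_derivative
      A * (2 * ?D' - (0 * Del q (x + e) - 1 * ?D') / (Del q (x + e) * Del q (x + e)))
        - B * (2 * q * (cos (x + e) * 1))) (at x)"
    unfolding fam1_def using D
    by (intro DERIV_add DERIV_cmult DERIV_diff DERIV_divide DERIV_const dD DERIV_chain2[OF DERIV_sin] sh)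
      (auto simp: less_imp_neq[symmetric])
  from DERIV_cmult[OF this, of c]
  show "((\<lambda>x. c * fam1 q A B e x) has_real_derivative c * fam2 q A B e x) (at x)"
    by (rule DERIV_cong) (insert D[of "x + e"], simp add: fam2_def field_simps power2_eq_square)
next
  show "continuous_on UNIV (\<lambda>x. c * fam2 q A B e x)"
    unfolding fam2_def using Del_pos[OF q]
    by (intro continuous_intros) (auto simp: less_imp_neq[symmetric])
qed

text \<open>The unscaled elastica has unit speed in u, and du/dx = 1 / Del; the similarity
  multiplies the squared speed by A^2 + B^2.\<close>

lemma fam_speed:
  assumes q: "\<bar>q\<bar> < 1"
  shows "(fam1 q A B e x)\<^sup>2 + (fam1 q (- B) A e x)\<^sup>2 = (A\<^sup>2 + B\<^sup>2) / (Del q (x + e))\<^sup>2"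
proof -
  define D s where "D = Del q (x + e)" and "s = q * sin (x + e)"
  have D: "D > 0" using Del_pos[OF q] by (simp add: D_def)
  have D2: "s\<^sup>2 = 1 - D\<^sup>2" unfolding D_def Del_sq[OF q] s_def by (simp add: power_mult_distrib)
  have "(A * u - B * v)\<^sup>2 + (- B * u - A * v)\<^sup>2 = (A\<^sup>2 + B\<^sup>2) * (u\<^sup>2 + v\<^sup>2)" for u v :: real
    by (simp add: algebra_simps power2_eq_square)
  from this[of "2 * D - 1 / D" "2 * s"]
  have "(fam1 q A B e x)\<^sup>2 + (fam1 q (- B) A e x)\<^sup>2 = (A\<^sup>2 + B\<^sup>2) * ((2 * D - 1 / D)\<^sup>2 + (2 * s)\<^sup>2)"
    by (simp add: fam1_def D_def s_def mult_ac)
  also have "(2 * D - 1 / D)\<^sup>2 + (2 * s)\<^sup>2 = 1 / D\<^sup>2"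
    unfolding power_mult_distrib D2 using D by (simp add: field_simps power2_eq_square)
  finally show ?thesis by (simp add: D_def)
qed

text \<open>The determinant is curvature times the cube of the speed, so the unscaled elastica has
  curvature - 2 q cos. The similarity contributes A^2 + B^2.\<close>

lemma fam_det:
  assumes q: "\<bar>q\<bar> < 1"
  shows "fam1 q A B e x * fam2 q (- B) A e x - fam1 q (- B) A e x * fam2 q A B e x
     = - (A\<^sup>2 + B\<^sup>2) * (2 * q * cos (x + e)) / (Del q (x + e)) ^ 3"
proof -
  define D s c where "D = Del q (x + e)" and "s = q * sin (x + e)" and "c = q * cos (x + e)"
  have D: "D > 0" using Del_pos[OF q] by (simp add: D_def)
  have D2: "s * s = 1 - D * D" using Del_sq[OF q, of "x + e"] by (simp add: D_def s_def power2_eq_square)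
  have "(A * u - B * v) * (B * y - A * z) - (- B * u - A * v) * (- A * y - B * z) = - (A\<^sup>2 + B\<^sup>2) * (u * z + v * y)" for u v y z :: real
    by (simp add: algebra_simps power2_eq_square)
  from this[of "2 * D - 1 / D" "2 * s" "s * c / D * (2 + 1 / D\<^sup>2)" "2 * c"]
  have "fam1 q A B e x * fam2 q (- B) A e x - fam1 q (- B) A e x * fam2 q A B e x
     = - (A\<^sup>2 + B\<^sup>2) * ((2 * D - 1 / D) * (2 * c) + 2 * s * (s * c / D * (2 + 1 / D\<^sup>2)))"
    by (simp add: fam1_def fam2_def D_def s_def c_def mult_ac power2_eq_square)
  also have "(2 * D - 1 / D) * (2 * c) + 2 * s * (s * c / D * (2 + 1 / D\<^sup>2)) = 2 * c / D ^ 3"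
  proof -
    have e: "2 * s * (s * c / D * (2 + 1 / D\<^sup>2)) = 2 * c / D * (2 + 1 / D\<^sup>2) * (s * s)" by (simp add: mult_ac)
    show ?thesis unfolding e D2 using D by (simp add: field_simps eval_nat_numeral)
  qed
  finally show ?thesis by (simp add: D_def c_def mult_ac)
qed

text \<open>\<open>Del\<close> has period pi, so its integral over a window of length pi does not
  depend on the position. This and the analogue for \<open>ellF\<close> are why sliding keeps length
  and bending.\<close>

lemma ellE_shift: "ellE (pi/2 + e) q - ellE (- (pi/2) + e) q = 2 * ellEc q"
proof -
  define f where "f = (\<lambda>e. ellE (pi/2 + e) q - ellE (- (pi/2) + e) q)"
  have "(f has_real_derivative 0) (at y)" for y
  proof -
    have "(f has_real_derivative Del q (pi/2 + y) * 1 - Del q (- (pi/2) + y) * 1) (at y)"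
      unfolding f_def by (intro DERIV_diff DERIV_chain2[OF DERIV_ellE]) (auto intro!: derivative_eq_intros)
    then show ?thesis by (rule DERIV_cong) (simp add: Del_def sin_add sin_diff)
  qed
  then have "f e = f 0" using DERIV_isconst_all[of f] by blast
  then show ?thesis using ellE_minus[of "pi/2" q] by (simp add: f_def)
qed

lemma ellF_shift:
  assumes q: "\<bar>q\<bar> < 1"
  shows "ellF (pi/2 + e) q - ellF (- (pi/2) + e) q = 2 * ellK q"
proof -
  define f where "f = (\<lambda>e. ellF (pi/2 + e) q - ellF (- (pi/2) + e) q)"
  have "(f has_real_derivative 0) (at y)" for y
  proof -
    have "(f has_real_derivative 1 / Del q (pi/2 + y) * 1 - 1 / Del q (- (pi/2) + y) * 1) (at y)"
      unfolding f_def by (intro DERIV_diff DERIV_chain2[OF DERIV_ellF[OF q]]) (auto intro!: derivative_eq_intros)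
    then show ?thesis by (rule DERIV_cong) (simp add: Del_def sin_add sin_diff)
  qed
  then have "f e = f 0" using DERIV_isconst_all[of f] by blast
  then show ?thesis using ellF_minus[OF q, of "pi/2"] by (simp add: f_def)
qed

text \<open>For the unscaled elastica, sliding keeps the horizontal component
  \<open>2 * ellP q\<close> of the chord and adds a vertical one of size 4 q |sin e|. The squared
  chord is therefore \<open>4 * famS q e\<close>.\<close>

lemma fam_chord:
  assumes q: "\<bar>q\<bar> < 1"
  shows "fam q A B e (pi/2) - fam q A B e (- (pi/2)) = 2 * A * ellP q - 4 * q * B * sin e"
proof -
  have "fam q A B e (pi/2) - fam q A B e (- (pi/2))
      = A * (2 * (ellE (pi/2 + e) q - ellE (- (pi/2) + e) q) - (ellF (pi/2 + e) q - ellF (- (pi/2) + e) q))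
        + B * (2 * q) * (cos (pi/2 + e) - cos (- (pi/2) + e))"
    by (simp add: fam_def algebra_simps)
  also have "\<dots> = 2 * A * ellP q - 4 * q * B * sin e"
    unfolding ellE_shift ellF_shift[OF q] by (simp add: ellP_def cos_add cos_diff algebra_simps)
  finally show ?thesis .
qed

text \<open>Length and bending energy of the unscaled window. The second integral reduces to the
  first because 4 q^2 cos^2 = 4 Del^2 - 4 (1 - q^2).\<close>

lemma integral_inverse_Del_shift:
  assumes q: "\<bar>q\<bar> < 1"
  shows "((\<lambda>x. 1 / Del q (x + e)) has_integral 2 * ellK q) {-(pi/2)..pi/2}"
    "((\<lambda>x. (2 * q * cos (x + e))\<^sup>2 / Del q (x + e)) has_integral 8 * ellH q) {-(pi/2)..pi/2}"
proof -
  have pi: "- (pi/2) \<le> pi/2" using pi_half_ge_zero by linarith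
  have F: "((\<lambda>x. ellF (x + e) q) has_real_derivative 1 / Del q (x + e)) (at x within S)" for x S
    by (rule has_field_derivative_at_within, rule DERIV_cong[OF DERIV_chain2[OF DERIV_ellF[OF q]]])
      (auto intro!: derivative_eq_intros)
  have E: "((\<lambda>x. ellE (x + e) q) has_real_derivative Del q (x + e)) (at x within S)" for x S
    by (rule has_field_derivative_at_within, rule DERIV_cong[OF DERIV_chain2[OF DERIV_ellE]])
      (auto intro!: derivative_eq_intros)
  have "((\<lambda>x. 1 / Del q (x + e)) has_integral (ellF (pi/2 + e) q - ellF (- (pi/2) + e) q)) {-(pi/2)..pi/2}"
    using F by (intro fundamental_theorem_of_calculus pi) (auto simp: has_real_derivative_iff_has_vector_derivative)
  then show 1: "((\<lambda>x. 1 / Del q (x + e)) has_integral 2 * ellK q) {-(pi/2)..pi/2}"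
    unfolding ellF_shift[OF q] .
  have "((\<lambda>x. Del q (x + e)) has_integral (ellE (pi/2 + e) q - ellE (- (pi/2) + e) q)) {-(pi/2)..pi/2}"
    using E by (intro fundamental_theorem_of_calculus pi) (auto simp: has_real_derivative_iff_has_vector_derivative)
  then have "((\<lambda>x. 4 * Del q (x + e) - 4 * (1 - q\<^sup>2) * (1 / Del q (x + e))) has_integral
      4 * (2 * ellEc q) - 4 * (1 - q\<^sup>2) * (2 * ellK q)) {-(pi/2)..pi/2}"
    unfolding ellE_shift by (intro has_integral_diff has_integral_mult_right 1)
  moreover have "4 * Del q y - 4 * (1 - q\<^sup>2) * (1 / Del q y) = (2 * q * cos y)\<^sup>2 / Del q y" for y
  proof -
    have "4 * Del q y - 4 * (1 - q\<^sup>2) * (1 / Del q y) = (4 * (Del q y)\<^sup>2 - 4 * (1 - q\<^sup>2)) / Del q y"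
      using Del_pos[OF q, of y] by (simp add: diff_divide_distrib power2_eq_square)
    also have "4 * (Del q y)\<^sup>2 - 4 * (1 - q\<^sup>2) = (2 * q * cos y)\<^sup>2"
      unfolding Del_sq[OF q] by (simp add: power_mult_distrib cos_squared_eq algebra_simps)
    finally show ?thesis .
  qed
  moreover have "4 * (2 * ellEc q) - 4 * (1 - q\<^sup>2) * (2 * ellK q) = 8 * ellH q"
    by (simp add: ellH_def algebra_simps)
  ultimately show "((\<lambda>x. (2 * q * cos (x + e))\<^sup>2 / Del q (x + e)) has_integral 8 * ellH q) {-(pi/2)..pi/2}"
    by (simp only:)
qed

text \<open>The coefficients are those of the similarity that puts the window \<open>{e - pi/2..e + pi/2}\<close> of the
  elastica of modulus \<open>q\<close> onto the chord from the origin to \<open>(l, 0)\<close>. At \<open>e = 0\<close> the curve \<open>(GX, GY s)\<close> is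
  the arc for \<open>s = 1\<close> and the loop for \<open>s = -1\<close>.\<close>

definition famS :: "real \<Rightarrow> real \<Rightarrow> real" where
  "famS q e = (ellP q)\<^sup>2 + 4 * q\<^sup>2 * (sin e)\<^sup>2"

definition coefA :: "real \<Rightarrow> real \<Rightarrow> real \<Rightarrow> real" where
  "coefA l q e = l * ellP q / (2 * famS q e)"

definition coefB :: "real \<Rightarrow> real \<Rightarrow> real \<Rightarrow> real" where
  "coefB l q e = - (l * q * sin e / famS q e)"

text \<open>The factor 1 gives both coordinates the same shape, so that \<open>fam_C2\<close>
  matches them directly.\<close>

definition GX :: "real \<Rightarrow> real \<Rightarrow> real \<Rightarrow> real \<Rightarrow> real" where
  "GX l q e x = 1 * (fam q (coefA l q e) (coefB l q e) e x - fam q (coefA l q e) (coefB l q e) e (- (pi/2)))"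

definition GY :: "real \<Rightarrow> real \<Rightarrow> real \<Rightarrow> real \<Rightarrow> real \<Rightarrow> real" where
  "GY s l q e x = s * (fam q (- coefB l q e) (coefA l q e) e x - fam q (- coefB l q e) (coefA l q e) e (- (pi/2)))"

text \<open>The similarity has factor l / (2 sqrt S) with S = \<open>famS q e\<close>; it divides
  the bending \<open>8 * ellH q\<close> and multiplies the length \<open>2 * ellK q\<close>.\<close>

definition fam_energy :: "real \<Rightarrow> real \<Rightarrow> real \<Rightarrow> real \<Rightarrow> real" where
  "fam_energy lam l q e = 16 / l * (ellH q * sqrt (famS q e)) + lam * (l * ellK q / sqrt (famS q e))"

lemma GX_C2: "\<bar>q\<bar> < 1 \<Longrightarrow> C2_fun (GX l q e)
    (\<lambda>x. 1 * fam1 q (coefA l q e) (coefB l q e) e x) (\<lambda>x. 1 * fam2 q (coefA l q e) (coefB l q e) e x)"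
  unfolding GX_def[abs_def] by (rule fam_C2)

lemma GY_C2: "\<bar>q\<bar> < 1 \<Longrightarrow> C2_fun (GY s l q e)
    (\<lambda>x. s * fam1 q (- coefB l q e) (coefA l q e) e x) (\<lambda>x. s * fam2 q (- coefB l q e) (coefA l q e) e x)"
  unfolding GY_def[abs_def] by (rule fam_C2)

lemma coef_sq:
  assumes "0 < famS q e"
  shows "(coefA l q e)\<^sup>2 + (coefB l q e)\<^sup>2 = l\<^sup>2 / (4 * famS q e)"
proof -
  have "(coefA l q e)\<^sup>2 + (coefB l q e)\<^sup>2 = l\<^sup>2 * famS q e / (4 * (famS q e)\<^sup>2)"
    using assms unfolding coefA_def coefB_def
    by (simp add: power_divide power_mult_distrib field_simps) (simp add: famS_def algebra_simps)
  then show ?thesis using assms by (simp add: power2_eq_square)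
qed

lemma fam_comp:
  assumes p: "amp_param \<phi> \<psi> \<omega>" and q: "\<bar>q\<bar> < 1" and S: "0 < famS q e" and l: "0 < l"
    and s: "s\<^sup>2 = 1" and g: "\<forall>t\<in>{0..1}. \<gamma> t = (GX l q e (\<phi> t), GY s l q e (\<phi> t))"
  shows "\<gamma> \<in> A_ell l" "curve_length \<gamma> = l * ellK q / sqrt (famS q e)"
    "bending \<gamma> = 16 / l * (ellH q * sqrt (famS q e))"
proof -
  let ?A = "coefA l q e" and ?B = "coefB l q e"
  note X = GX_C2[OF q, of l e] and Y = GY_C2[OF q, of s l e]
  define R where "R = sqrt (famS q e)"
  define r where "r = l / (2 * R)"
  have R: "R > 0" "R\<^sup>2 = famS q e" using S by (auto simp: R_def)
  have r: "r > 0" "r\<^sup>2 = ?A\<^sup>2 + ?B\<^sup>2"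
    using R l unfolding coef_sq[OF S] r_def by (auto simp: power_divide power_mult_distrib)
  have speed: "(1 * fam1 q ?A ?B e x)\<^sup>2 + (s * fam1 q (- ?B) ?A e x)\<^sup>2 = r\<^sup>2 / (Del q (x + e))\<^sup>2" for x
    unfolding r fam_speed[OF q, symmetric] power_mult_distrib s by simp
  have D: "Del q y > 0" for y by (rule Del_pos[OF q])
  have nz: "0 < (1 * fam1 q ?A ?B e x)\<^sup>2 + (s * fam1 q (- ?B) ?A e x)\<^sup>2" for x
    unfolding speed using r(1) D[of "x + e"] by simp
  have sp: "sqrt ((1 * fam1 q ?A ?B e x)\<^sup>2 + (s * fam1 q (- ?B) ?A e x)\<^sup>2) = r / Del q (x + e)" for x
    unfolding speed using r(1) D[of "x + e"] by (simp add: real_sqrt_divide)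
  have endX: "GX l q e (pi/2) = l"
    unfolding GX_def fam_chord[OF q] using S
    by (simp add: coefA_def coefB_def field_simps) (simp add: famS_def algebra_simps power2_eq_square)
  have endY: "GY s l q e (pi/2) = 0"
    unfolding GY_def fam_chord[OF q] using S by (simp add: coefA_def coefB_def field_simps)
  show "\<gamma> \<in> A_ell l"
    by (rule comp_in_A_ell[OF p X Y g nz _ _ endX endY]) (auto simp: GX_def GY_def)
  have "curve_length \<gamma> = integral {-(pi/2)..pi/2} (\<lambda>x. r * (1 / Del q (x + e)))"
    unfolding comp_length[OF p X Y g] sp by simp
  also have "\<dots> = r * (2 * ellK q)"
    by (intro integral_unique has_integral_mult_right integral_inverse_Del_shift q)
  finally show "curve_length \<gamma> = l * ellK q / sqrt (famS q e)" by (simp add: r_def R_def)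
  have "bending \<gamma> = integral {-(pi/2)..pi/2} (\<lambda>x. 1 / r * ((2 * q * cos (x + e))\<^sup>2 / Del q (x + e)))"
    unfolding comp_bending[OF p X Y g nz] sp
  proof (rule integral_cong)
    fix x
    define d c where "d = Del q (x + e)" and "c = 2 * q * cos (x + e)"
    have d: "d > 0" using D by (simp add: d_def)
    have "1 * fam1 q ?A ?B e x * (s * fam2 q (- ?B) ?A e x) - s * fam1 q (- ?B) ?A e x * (1 * fam2 q ?A ?B e x)
        = s * (- (r\<^sup>2) * c / d ^ 3)"
      unfolding r(2) c_def d_def fam_det[OF q, symmetric] by (simp add: algebra_simps)
    moreover have "(s * (- (r\<^sup>2) * c / d ^ 3))\<^sup>2 / (r / d) ^ 5 = 1 / r * (c\<^sup>2 / d)"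
      unfolding power_mult_distrib s using r(1) d
      by (simp add: power_divide power_mult_distrib) (simp add: eval_nat_numeral field_simps)
    ultimately show "(1 * fam1 q ?A ?B e x * (s * fam2 q (- ?B) ?A e x)
        - s * fam1 q (- ?B) ?A e x * (1 * fam2 q ?A ?B e x))\<^sup>2 / (r / Del q (x + e)) ^ 5
        = 1 / r * ((2 * q * cos (x + e))\<^sup>2 / Del q (x + e))"
      by (simp only: d_def c_def)
  qed
  also have "\<dots> = 1 / r * (8 * ellH q)"
    by (intro integral_unique has_integral_mult_right integral_inverse_Del_shift q)
  finally show "bending \<gamma> = 16 / l * (ellH q * sqrt (famS q e))" by (simp add: r_def R_def)
qed

section \<open>Parameter changes as small perturbations of the curve\<close>

lemma uniform_near:
  fixes f :: "('a::metric_space) \<times> real \<Rightarrow> real"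
  assumes "continuous_on (U \<times> {a..b}) f" "compact U" "z0 \<in> U" "0 < e"
  shows "\<exists>d>0. \<forall>z\<in>U. dist z z0 < d \<longrightarrow> (\<forall>x\<in>{a..b}. \<bar>f (z, x) - f (z0, x)\<bar> < e)"
proof -
  have "uniformly_continuous_on (U \<times> {a..b}) f"
    by (intro compact_uniformly_continuous assms compact_Times compact_Icc)
  then obtain d where d: "d > 0"
    "\<And>p p'. p \<in> U \<times> {a..b} \<Longrightarrow> p' \<in> U \<times> {a..b} \<Longrightarrow> dist p' p < d \<Longrightarrow> dist (f p') (f p) < e"
    unfolding uniformly_continuous_on_def using assms(4) by metis
  have "\<bar>f (z, x) - f (z0, x)\<bar> < e" if "z \<in> U" "dist z z0 < d" "x \<in> {a..b}" for z x
    using d(2)[of "(z0, x)" "(z, x)"] that assms(3) by (auto simp: dist_Pair_Pair dist_real_def)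
  then show ?thesis using d(1) by blast
qed

text \<open>Instability is reduced to the failure of a local minimum of a function of the two real
  parameters \<open>q\<close> and \<open>e\<close>. The competitor is composed with the same
  \<open>\<phi>\<close> as the given curve, so uniform closeness of the outer curves makes it close
  in norm.\<close>

lemma not_stable_fam:
  assumes p: "amp_param \<phi> \<psi> \<omega>" and q0: "0 < q0" "q0 < 1" "ellP q0 \<noteq> 0" and l: "0 < l"
    and s: "s\<^sup>2 = 1" and g: "\<forall>t\<in>{0..1}. \<gamma> t = (GX l q0 0 (\<phi> t), GY s l q0 0 (\<phi> t))"
    and lower: "\<And>d. 0 < d \<Longrightarrow> \<exists>q e. \<bar>q - q0\<bar> < d \<and> \<bar>e\<bar> < d \<and> fam_energy lam l q e < fam_energy lam l q0 0"
  shows "\<not> stable lam l \<gamma>"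
proof
  assume "stable lam l \<gamma>"
  then obtain \<delta> where \<delta>: "0 < \<delta>"
    "\<And>\<eta>. \<eta> \<in> A_ell l \<Longrightarrow> W22_norm (\<lambda>t. \<eta> t - \<gamma> t) < \<delta> \<Longrightarrow> energy lam \<gamma> \<le> energy lam \<eta>"
    unfolding stable_def by blast
  define C where "C = sqrt (integral {0..1} (\<lambda>t. 2 * pi\<^sup>2 + 2 * (\<psi> t)\<^sup>2 + 4 * (\<omega> t)\<^sup>2 + 4 * (\<psi> t)^4))"
  \<comment> \<open>Adding 1 to \<open>\<bar>C\<bar>\<close> guards against a zero denominator; the
    choice yields \<open>e0 * C <= \<delta> / 2\<close>.\<close>
  define e0 where "e0 = \<delta> / (2 * (\<bar>C\<bar> + 1))"
  have e0: "0 < e0" using \<delta>(1) by (simp add: e0_def)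
  have "e0 * C \<le> e0 * \<bar>C\<bar>" using e0 by (intro mult_left_mono) auto
  also have "\<dots> \<le> e0 * (\<bar>C\<bar> + 1)" using e0 by (intro mult_left_mono) auto
  also have "\<dots> = \<delta> / 2" by (simp add: e0_def field_simps)
  finally have e0C: "e0 * C < \<delta>" using \<delta>(1) by simp
  have "isCont ellP q0" by (rule isCont_ell(1)[OF q0(1,2)])
  then obtain d1 where d1: "0 < d1" "\<And>q. \<bar>q - q0\<bar> < d1 \<Longrightarrow> ellP q \<noteq> 0"
    using continuous_at_avoid[of q0 ellP 0] q0(3) unfolding dist_real_def by (metis abs_minus_commute)
  \<comment> \<open>The compact box of parameters has to stay where 0 < q < 1 and
    \<open>ellP q\<close> is nonzero; the latter keeps \<open>famS\<close> away from 0 and the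
    coefficients continuous.\<close>
  define d2 where "d2 = min (d1 / 2) (min (q0 / 2) ((1 - q0) / 2))"
  have "0 < d2" using d1 q0 by (simp add: d2_def)
  moreover have "d2 \<le> d1 / 2" "d2 \<le> q0 / 2" "d2 \<le> (1 - q0) / 2"
    unfolding d2_def by (auto simp only: min.cobounded1 min.cobounded2 intro: min.coboundedI1 min.coboundedI2)
  ultimately have d2: "0 < d2" "d2 < d1" "d2 < q0" "d2 < 1 - q0" using d1(1) q0(1,2) by simp_all
  define U where "U = {q0 - d2..q0 + d2} \<times> {-1..(1::real)}"
  have U: "compact U" "(q0, 0) \<in> U" using d2 by (auto simp: U_def intro!: compact_Times)
  have Uq: "0 < fst z" "fst z < 1" "ellP (fst z) \<noteq> 0" if "z \<in> U" for z
  proof -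
    have "q0 - d2 \<le> fst z" "fst z \<le> q0 + d2" using that by (auto simp: U_def mem_Times_iff)
    moreover have "\<bar>fst z - q0\<bar> < d1" using calculation d2 by linarith
    ultimately show "0 < fst z" "fst z < 1" "ellP (fst z) \<noteq> 0" using d1(2) d2 by auto
  qed
  have US: "famS (fst z) (snd z) \<noteq> 0" if "z \<in> U" for z
  proof -
    have "0 < famS (fst z) (snd z)" unfolding famS_def using Uq[OF that] by (intro add_pos_nonneg) auto
    then show ?thesis by simp
  qed
  let ?I = "{-(pi/2)..pi/2}"
  have cP: "continuous_on (U \<times> ?I) (\<lambda>y. ellP (fst (fst y)))"
    by (rule continuous_on_compose2[OF continuous_on_ell(1)[of "fst ` U"]])
      (auto intro!: continuous_intros Uq)
  have cS: "continuous_on (U \<times> ?I) (\<lambda>y. famS (fst (fst y)) (snd (fst y)))"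
    unfolding famS_def by (intro continuous_intros cP)
  have cA: "continuous_on (U \<times> ?I) (\<lambda>y. coefA l (fst (fst y)) (snd (fst y)))"
    unfolding coefA_def using US by (intro continuous_intros cP cS) auto
  have cB: "continuous_on (U \<times> ?I) (\<lambda>y. coefB l (fst (fst y)) (snd (fst y)))"
    unfolding coefB_def using US by (intro continuous_intros cS) auto
  have Dn: "Del (fst (fst y)) (snd y + snd (fst y)) \<noteq> 0" if "y \<in> U \<times> ?I" for y
    using Del_pos[of "fst (fst y)" "snd y + snd (fst y)"] Uq[of "fst y"] that by (auto simp: mem_Times_iff)
  have cf1: "continuous_on (U \<times> ?I) (\<lambda>y. c * fam1 (fst (fst y)) (a y) (b y) (snd (fst y)) (snd y))"
    and cf2: "continuous_on (U \<times> ?I) (\<lambda>y. c * fam2 (fst (fst y)) (a y) (b y) (snd (fst y)) (snd y))"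
    if "continuous_on (U \<times> ?I) a" "continuous_on (U \<times> ?I) b" for a b :: "(real \<times> real) \<times> real \<Rightarrow> real" and c
    unfolding fam1_def fam2_def using Dn by (intro continuous_intros that; simp)+
  have near: "\<exists>d>0. \<forall>z x. z \<in> U \<longrightarrow> dist z (q0, 0) < d \<longrightarrow> x \<in> ?I \<longrightarrow> \<bar>f z x - f (q0, 0) x\<bar> < e0"
    if "continuous_on (U \<times> ?I) (\<lambda>y. f (fst y) (snd y))" for f :: "real \<times> real \<Rightarrow> real \<Rightarrow> real"
    using uniform_near[OF that U e0] unfolding fst_conv snd_conv by blast
  let ?A = "\<lambda>z. coefA l (fst z) (snd z)" and ?B = "\<lambda>z. coefB l (fst z) (snd z)"
  let ?X1 = "\<lambda>z x. 1 * fam1 (fst z) (?A z) (?B z) (snd z) x"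
  let ?X2 = "\<lambda>z x. 1 * fam2 (fst z) (?A z) (?B z) (snd z) x"
  let ?Y1 = "\<lambda>z x. s * fam1 (fst z) (- ?B z) (?A z) (snd z) x"
  let ?Y2 = "\<lambda>z x. s * fam2 (fst z) (- ?B z) (?A z) (snd z) x"
  obtain m1 where m1: "m1 > 0" "\<And>z x. z \<in> U \<Longrightarrow> dist z (q0, 0) < m1 \<Longrightarrow> x \<in> ?I \<Longrightarrow> \<bar>?X1 z x - ?X1 (q0, 0) x\<bar> < e0"
    using near[of ?X1, OF cf1[OF cA cB]] by blast
  obtain m2 where m2: "m2 > 0" "\<And>z x. z \<in> U \<Longrightarrow> dist z (q0, 0) < m2 \<Longrightarrow> x \<in> ?I \<Longrightarrow> \<bar>?X2 z x - ?X2 (q0, 0) x\<bar> < e0"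
    using near[of ?X2, OF cf2[OF cA cB]] by blast
  obtain m3 where m3: "m3 > 0" "\<And>z x. z \<in> U \<Longrightarrow> dist z (q0, 0) < m3 \<Longrightarrow> x \<in> ?I \<Longrightarrow> \<bar>?Y1 z x - ?Y1 (q0, 0) x\<bar> < e0"
    using near[of ?Y1, OF cf1[OF continuous_on_minus[OF cB] cA, of s]] by blast
  obtain m4 where m4: "m4 > 0" "\<And>z x. z \<in> U \<Longrightarrow> dist z (q0, 0) < m4 \<Longrightarrow> x \<in> ?I \<Longrightarrow> \<bar>?Y2 z x - ?Y2 (q0, 0) x\<bar> < e0"
    using near[of ?Y2, OF cf2[OF continuous_on_minus[OF cB] cA, of s]] by blast
  define m where "m = min (min m1 m2) (min m3 m4)"
  have m: "0 < m" using m1 m2 m3 m4 by (simp add: m_def)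
  obtain q e where qe: "\<bar>q - q0\<bar> < min (min d2 1) (m / 2)" "\<bar>e\<bar> < min (min d2 1) (m / 2)"
    "fam_energy lam l q e < fam_energy lam l q0 0"
    using lower[of "min (min d2 1) (m / 2)"] d2 m by auto
  have zU: "(q, e) \<in> U" using qe by (auto simp: U_def abs_less_iff)
  have "dist (q, e) (q0, 0) \<le> \<bar>q - q0\<bar> + \<bar>e\<bar>"
    by (simp add: dist_Pair_Pair dist_real_def sqrt_sum_squares_le_sum_abs[THEN order_trans])
  then have zd: "dist (q, e) (q0, 0) < m" using qe by linarith
  have q: "\<bar>q\<bar> < 1" and q0': "\<bar>q0\<bar> < 1" using Uq[OF zU] q0 by auto
  have Spos: "0 < famS q e" "0 < famS q0 0"
    unfolding famS_def using Uq[OF zU] q0 by (auto intro!: add_pos_nonneg)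
  define \<eta> where "\<eta> t = (GX l q e (\<phi> t), GY s l q e (\<phi> t))" for t
  have eta: "\<forall>t\<in>{0..1}. \<eta> t = (GX l q e (\<phi> t), GY s l q e (\<phi> t))" by (simp add: \<eta>_def)
  note fe = fam_comp[OF p q Spos(1) l s eta] and fg = fam_comp[OF p q0' Spos(2) l s g]
  have "W22_norm (\<lambda>t. \<eta> t - \<gamma> t) \<le> e0 * C"
    unfolding C_def
  proof (rule comp_W22_norm_le[OF p C2_fun_diff[OF GX_C2[OF q] GX_C2[OF q0']] C2_fun_diff[OF GY_C2[OF q] GY_C2[OF q0']]])
    show "\<forall>t\<in>{0..1}. \<eta> t - \<gamma> t = (GX l q e (\<phi> t) - GX l q0 0 (\<phi> t), GY s l q e (\<phi> t) - GY s l q0 0 (\<phi> t))"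
      using g by (simp add: \<eta>_def)
    fix x assume x: "x \<in> ?I"
    show "\<bar>1 * fam1 q (coefA l q e) (coefB l q e) e x - 1 * fam1 q0 (coefA l q0 0) (coefB l q0 0) 0 x\<bar> \<le> e0 \<and>
         \<bar>1 * fam2 q (coefA l q e) (coefB l q e) e x - 1 * fam2 q0 (coefA l q0 0) (coefB l q0 0) 0 x\<bar> \<le> e0 \<and>
         \<bar>s * fam1 q (- coefB l q e) (coefA l q e) e x - s * fam1 q0 (- coefB l q0 0) (coefA l q0 0) 0 x\<bar> \<le> e0 \<and>
         \<bar>s * fam2 q (- coefB l q e) (coefA l q e) e x - s * fam2 q0 (- coefB l q0 0) (coefA l q0 0) 0 x\<bar> \<le> e0"
      using m1(2)[OF zU _ x] m2(2)[OF zU _ x] m3(2)[OF zU _ x] m4(2)[OF zU _ x] zd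
      by (simp add: m_def)
  qed (use e0 in \<open>auto simp: GX_def GY_def\<close>)
  then have "W22_norm (\<lambda>t. \<eta> t - \<gamma> t) < \<delta>" using e0C by linarith
  then have "energy lam \<gamma> \<le> energy lam \<eta>" using \<delta>(2) fe(1) by blast
  then show False using qe(3) unfolding energy_def fe(2,3) fg(2,3) fam_energy_def by linarith
qed

text \<open>The arclength \<sigma> of the curve is strictly increasing, so the curve is its
  arclength parametrization composed with \<sigma>, and am (a \<sigma> - K) is the required
  reparametrization. Its derivative is a smooth function of it times the speed, and so inherits from
  the speed a square-integrable weak derivative.\<close>

lemma ex_amp_param:
  assumes gam: "\<gamma> \<in> A_ell l" and q: "0 < q" "q < 1" and a: "0 < a"
    and par: "arclength_param_is \<gamma> c (2 * ellK q / a)"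
    and c: "\<And>u. c u = (X (am (a * u - ellK q) q), Y (am (a * u - ellK q) q))"
  shows "\<exists>\<phi> \<psi> \<omega>. amp_param \<phi> \<psi> \<omega> \<and> (\<forall>t\<in>{0..1}. \<gamma> t = (X (\<phi> t), Y (\<phi> t)))"
proof -
  have q1: "\<bar>q\<bar> < 1" using q by simp
  obtain v1 v2 h1 h2 where d: "W22_data \<gamma> v1 v2 h1 h2"
    and pos: "\<And>t. t \<in> {0..1} \<Longrightarrow> 0 < (v1 t)\<^sup>2 + (v2 t)\<^sup>2"
    and "integral {0..1} v1 = l" "integral {0..1} v2 = 0"
    using A_ell_data[OF gam] by blast
  note dd = W22_dataD[OF d]
  define n where "n t = v1 t * v1 t + v2 t * v2 t" for t
  define n' where "n' t = (v1 t * h1 t + h1 t * v1 t) + (v2 t * h2 t + h2 t * v2 t)" for t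
  define m where "m t = sqrt (n t)" for t
  define m' where "m' t = 1 / (2 * sqrt (n t)) * n' t" for t
  have npos: "0 < n t" if "t \<in> {0..1}" for t using pos[OF that] by (simp add: n_def power2_eq_square)
  have mpos: "0 < m t" if "t \<in> {0..1}" for t using npos[OF that] by (simp add: m_def)
  have pn: "prim_on 0 1 n n'" unfolding n_def n'_def by (intro prim_on_add prim_on_mult dd)
  have cn: "continuous_on {0..1} n" by (rule prim_on_continuous[OF pn])
  have pm: "prim_on 0 1 m m'" unfolding m_def m'_def
  proof (rule prim_on_chain[OF pn, of sqrt "\<lambda>x. 1 / (2 * sqrt x)"])
    show "(sqrt has_real_derivative 1 / (2 * sqrt x)) (at x within n ` {0..1})" if "x \<in> n ` {0..1}" for x
    proof -
      have "x > 0" using that npos by auto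
      then show ?thesis by (auto intro!: derivative_eq_intros simp: field_simps)
    qed
    show "continuous_on (n ` {0..1}) (\<lambda>x. 1 / (2 * sqrt x))"
      using npos by (intro continuous_intros) force
  qed
  have L2m': "L2_on 0 1 m'"
  proof -
    have "L2_on 0 1 n'" unfolding n'_def
      using L2_on_mult[OF dd(6) dd(4)] L2_on_mult[OF dd(7) dd(5)] by (intro L2_on_add) (simp_all add: mult.commute)
    then show ?thesis unfolding m'_def using npos by (intro L2_on_mult continuous_intros cn) force
  qed
  have cm: "continuous_on {0..1} m" by (rule prim_on_continuous[OF pm])
  have dm: "norm (d1 \<gamma> t) = m t" if "t \<in> {0..1}" for t
    by (simp add: data_d1[OF d that] norm_Pair m_def n_def power2_eq_square)
  define \<sigma> where "\<sigma> t = integral {0..t} m" for t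
  have sig: "arclen_fun \<gamma> t = \<sigma> t" if "t \<in> {0..1}" for t
    unfolding arclen_fun_def \<sigma>_def using that by (intro integral_cong dm) auto
  have ds: "(\<sigma> has_real_derivative m t) (at t within {0..1})" if "t \<in> {0..1}" for t
    unfolding \<sigma>_def using that by (intro integral_has_real_derivative cm)
  have smono: "\<sigma> x < \<sigma> y" if "0 \<le> x" "x < y" "y \<le> 1" for x y
  proof (rule DERIV_pos_imp_increasing_open[OF that(2)])
    fix z assume z: "x < z" "z < y"
    have "(\<sigma> has_real_derivative m z) (at z)" using ds[of z] z that by (simp add: at_within_Icc_at)
    then show "\<exists>d. (\<sigma> has_real_derivative d) (at z) \<and> 0 < d" using mpos[of z] z that by auto
  next
    have "continuous_on {0..1} \<sigma>" by (rule DERIV_continuous_on[OF ds])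
    then show "continuous_on {x..y} \<sigma>" by (rule continuous_on_subset) (use that in auto)
  qed
  have s0: "\<sigma> 0 = 0" by (simp add: \<sigma>_def)
  have s1: "\<sigma> 1 = 2 * ellK q / a"
    using par sig[of 1] unfolding arclength_param_is_def curve_length_def arclen_fun_def by simp
  have inj: "inj_on (arclen_fun \<gamma>) {0..1}"
  proof (rule inj_onI)
    fix x y assume xy: "x \<in> {0..1}" "y \<in> {0..1::real}" "arclen_fun \<gamma> x = arclen_fun \<gamma> y"
    then have "\<sigma> x = \<sigma> y" using sig by simp
    then show "x = y" using smono[of x y] smono[of y x] xy by (cases x y rule: linorder_cases) auto
  qed
  have sr: "\<sigma> t \<in> {0..2 * ellK q / a}" if t: "t \<in> {0..1}" for t
    using smono[of 0 t] smono[of t 1] t s0 s1 by (cases "t = 0"; cases "t = 1") auto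
  have gc: "\<gamma> t = c (\<sigma> t)" if t: "t \<in> {0..1}" for t
  proof -
    have "arclength_param \<gamma> (\<sigma> t) = c (\<sigma> t)"
      using par sr[OF t] unfolding arclength_param_is_def by blast
    moreover have "inv_into {0..1} (arclen_fun \<gamma>) (\<sigma> t) = t"
      using inv_into_f_f[OF inj t] sig[OF t] by simp
    ultimately show ?thesis by (simp add: arclength_param_def)
  qed
  define \<phi> where "\<phi> t = am (a * \<sigma> t - ellK q) q" for t
  define \<psi> where "\<psi> t = Del q (\<phi> t) * (a * m t)" for t
  define \<omega> where "\<omega> t = Del q (\<phi> t) * (a * m' t) + (- (q\<^sup>2 * sin (\<phi> t) * cos (\<phi> t) / Del q (\<phi> t)) * \<psi> t) * (a * m t)" for t
  have D: "Del q x > 0" for x by (rule Del_pos[OF q1])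
  have dphi: "(\<phi> has_real_derivative \<psi> t) (at t within {0..1})" if "t \<in> {0..1}" for t
  proof -
    have "((\<lambda>t. a * \<sigma> t - ellK q) has_real_derivative a * m t - 0) (at t within {0..1})"
      by (intro DERIV_diff DERIV_cmult ds that DERIV_const)
    from DERIV_chain2[OF DERIV_am[OF q1] this] show ?thesis
      unfolding \<phi>_def[abs_def] \<psi>_def by simp
  qed
  have cphi: "continuous_on {0..1} \<phi>" by (rule DERIV_continuous_on[OF dphi])
  have cpsi: "continuous_on {0..1} \<psi>" unfolding \<psi>_def by (intro continuous_intros cphi cm)
  have cD': "continuous_on {0..1} (\<lambda>t. - (q\<^sup>2 * sin (\<phi> t) * cos (\<phi> t) / Del q (\<phi> t)) * \<psi> t)"
    using D by (intro continuous_intros cphi cpsi) (auto simp: less_imp_neq[symmetric])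
  have "prim_on 0 1 (\<lambda>t. Del q (\<phi> t)) (\<lambda>t. - (q\<^sup>2 * sin (\<phi> t) * cos (\<phi> t) / Del q (\<phi> t)) * \<psi> t)"
    by (intro prim_on_C1 cD' DERIV_Del[OF q1] dphi)
  from prim_on_mult[OF this prim_on_cmult[OF pm, of a]] have ppsi: "prim_on 0 1 \<psi> \<omega>"
    unfolding \<psi>_def[abs_def, symmetric] \<omega>_def[abs_def] .
  have L2w: "L2_on 0 1 \<omega>" unfolding \<omega>_def[abs_def]
    by (intro L2_on_add L2_on_mult[OF _ L2_on_cmult] L2m' L2_on_continuous continuous_intros cphi cD' cm)
  have "amp_param \<phi> \<psi> \<omega>" unfolding amp_param_def
  proof (intro conjI ballI dphi ppsi L2w)
    show "\<phi> 0 = - (pi/2)" by (simp add: \<phi>_def s0 am_K(2)[OF q1])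
    show "\<phi> 1 = pi/2" using a by (simp add: \<phi>_def s1 am_K(1)[OF q1])
    fix t :: real assume t: "t \<in> {0..1}"
    show "0 < \<psi> t" unfolding \<psi>_def using D mpos[OF t] a by simp
    have "a * \<sigma> t - ellK q \<in> {- ellK q..ellK q}" using sr[OF t] a by (auto simp: field_simps)
    then show "\<phi> t \<in> {- (pi/2)..pi/2}"
      unfolding \<phi>_def using am_mono[OF q1, of "- ellK q" "a * \<sigma> t - ellK q"]
        am_mono[OF q1, of "a * \<sigma> t - ellK q" "ellK q"] am_K[OF q1] by auto
  qed
  moreover have "\<forall>t\<in>{0..1}. \<gamma> t = (X (\<phi> t), Y (\<phi> t))" using gc by (simp add: c \<phi>_def)
  ultimately show ?thesis by blast
qed

text \<open>The lengths differ by at most the integral of the norm of the velocity difference. On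
  the unit interval this is at most its L^2 norm, which is one of the parts of
  \<open>W22_norm\<close>.\<close>

lemma length_W22_bound:
  assumes "W22 \<eta>" "W22 \<gamma>"
  shows "\<bar>curve_length \<eta> - curve_length \<gamma>\<bar> \<le> W22_norm (\<lambda>t. \<eta> t - \<gamma> t)"
proof -
  obtain v1 v2 h1 h2 where dE: "W22_data \<eta> v1 v2 h1 h2" using W22_imp_data[OF assms(1)] by blast
  obtain u1 u2 k1 k2 where dG: "W22_data \<gamma> u1 u2 k1 k2" using W22_imp_data[OF assms(2)] by blast
  note E = W22_dataD[OF dE] and G = W22_dataD[OF dG]
  have pd: "prim_on 0 1 (\<lambda>t. f t - g t) (\<lambda>t. h t - k t)" if "prim_on 0 1 f h" "prim_on 0 1 g k" for f g h k
    using prim_on_add[OF that(1) prim_on_cmult[OF that(2), of "-1"]] by simp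
  have dD: "W22_data (\<lambda>t. \<eta> t - \<gamma> t) (\<lambda>t. v1 t - u1 t) (\<lambda>t. v2 t - u2 t) (\<lambda>t. h1 t - k1 t) (\<lambda>t. h2 t - k2 t)"
    unfolding W22_data_def
    using has_vector_derivative_diff[OF E(1) G(1)] by (auto intro!: pd L2_on_diff E G)
  define m where "m t = norm (v1 t - u1 t, v2 t - u2 t)" for t
  have cE: "continuous_on {0..1} (\<lambda>t. norm (v1 t, v2 t))" by (intro continuous_intros E)
  have cG: "continuous_on {0..1} (\<lambda>t. norm (u1 t, u2 t))" by (intro continuous_intros G)
  have cm: "continuous_on {0..1} m" unfolding m_def by (intro continuous_intros E G)
  have "curve_length \<eta> = integral {0..1} (\<lambda>t. norm (v1 t, v2 t))"
    "curve_length \<gamma> = integral {0..1} (\<lambda>t. norm (u1 t, u2 t))"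
    unfolding data_length[OF dE] data_length[OF dG] by (simp_all add: norm_Pair)
  then have "curve_length \<eta> - curve_length \<gamma> = integral {0..1} (\<lambda>t. norm (v1 t, v2 t) - norm (u1 t, u2 t))"
    using cE cG by (subst Henstock_Kurzweil_Integration.integral_diff) (auto intro: integrable_continuous_real)
  also have "norm \<dots> \<le> integral {0..1} m"
  proof (rule integral_norm_bound_integral)
    show "norm (norm (v1 t, v2 t) - norm (u1 t, u2 t)) \<le> m t" for t
      using norm_triangle_ineq3[of "(v1 t, v2 t)" "(u1 t, u2 t)"] by (simp add: m_def)
  qed (intro integrable_continuous_real continuous_intros cE cG cm)+
  finally have 1: "\<bar>curve_length \<eta> - curve_length \<gamma>\<bar> \<le> integral {0..1} m" by simp
  define c where "c = integral {0..1} m"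
  have im: "m integrable_on {0..1}" "(\<lambda>t. (m t)\<^sup>2) integrable_on {0..1}"
    by (intro integrable_continuous_real continuous_intros cm)+
  \<comment> \<open>Cauchy-Schwarz against the constant 1, obtained by integrating (m - c)^2 >= 0
    with \<open>c\<close> the mean of \<open>m\<close>.\<close>
  have "integral {0..1} (\<lambda>t. 2 * c * m t - c\<^sup>2) \<le> integral {0..1} (\<lambda>t. (m t)\<^sup>2)"
  proof (rule integral_le[OF _ im(2)])
    show "(\<lambda>t. 2 * c * m t - c\<^sup>2) integrable_on {0..1}" by (intro integrable_continuous_real continuous_intros cm)
    show "2 * c * m t - c\<^sup>2 \<le> (m t)\<^sup>2" for t
      using zero_le_power2[of "m t - c"] by (simp add: power2_diff mult_ac del: zero_le_power2)
  qed
  also have "integral {0..1} (\<lambda>t. 2 * c * m t - c\<^sup>2) = 2 * c * c - c\<^sup>2"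
    unfolding c_def using im(1)
    by (subst Henstock_Kurzweil_Integration.integral_diff) (auto intro!: integrable_on_mult_right)
  finally have 2: "c\<^sup>2 \<le> integral {0..1} (\<lambda>t. (m t)\<^sup>2)" by (simp add: power2_eq_square)
  let ?D = "\<lambda>t. \<eta> t - \<gamma> t"
  let ?f = "\<lambda>t. (norm (?D t))\<^sup>2 + (norm (d1 ?D t))\<^sup>2 + (norm (d2 ?D t))\<^sup>2"
  obtain N where N: "negligible N" "\<And>t. t \<in> {0..1} - N \<Longrightarrow> d2 ?D t = (h1 t - k1 t, h2 t - k2 t)"
    using data_d2[OF dD] by blast
  have cD: "continuous_on {0..1} ?D"
    by (rule continuous_on_vector_derivative, rule W22_dataD(1)[OF dD])
  have "(\<lambda>t. (norm (?D t))\<^sup>2 + (m t)\<^sup>2 + ((h1 t - k1 t)\<^sup>2 + (h2 t - k2 t)\<^sup>2)) integrable_on {0..1}"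
    using L2_on_diff[OF E(4) G(4)] L2_on_diff[OF E(5) G(5)] unfolding L2_on_def
    by (intro integrable_add im(2)) (auto intro!: integrable_continuous_real continuous_intros cD)
  \<comment> \<open>Integrability has to be established: for a non-integrable integrand the norm
    would be 0 by default and could not bound anything.\<close>
  then have if_: "?f integrable_on {0..1}"
    by (rule integrable_spike[OF _ N(1)]) (auto simp: data_d1[OF dD] N(2) m_def norm_Pair)
  have "integral {0..1} (\<lambda>t. (m t)\<^sup>2) \<le> integral {0..1} ?f"
    by (rule integral_le[OF im(2) if_]) (auto simp: data_d1[OF dD] m_def)
  with 2 have "c \<le> W22_norm ?D" unfolding W22_norm_def by (intro real_le_rsqrt) linarith
  then show ?thesis using 1 by (simp add: c_def)
qed

section \<open>Stability and instability\<close>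

lemma famS_0: "famS q 0 = (ellP q)\<^sup>2" by (simp add: famS_def)

lemma coef_0: "ellP q \<noteq> 0 \<Longrightarrow> coefA l q 0 = l / (2 * ellP q)" "coefB l q 0 = 0"
  by (auto simp: coefA_def coefB_def famS_0 power2_eq_square)

lemma arc_curve_eq:
  assumes q: "0 < q" "q < qstar" and l: "0 < l"
  shows "arc_curve l q u = (GX l q 0 (am (arc_alpha l q * u - ellK q) q), GY 1 l q 0 (am (arc_alpha l q * u - ellK q) q))"
proof -
  have q1: "\<bar>q\<bar> < 1" using q qstar_props by auto
  have P: "ellP q > 0" using ellP_pos q by simp
  define a where "a = arc_alpha l q"
  have a: "l / (2 * ellP q) = 1 / a" using P l by (simp add: a_def arc_alpha_def ellP_def)
  have P0: "ellP q \<noteq> 0" using P by simp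
  show ?thesis
    unfolding arc_curve_def Let_def a_def[symmetric] GX_def GY_def fam_def coef_0(1)[OF P0] coef_0(2) a
    using ellE_minus[of "pi/2" q] ellF_minus[OF q1, of "pi/2"] ellF_am[OF q1, of "a * u - ellK q"]
    by (simp add: cn_def diff_divide_distrib add_divide_distrib)
qed

text \<open>For a loop \<open>ellP q\<close> is negative, hence so is \<open>coefA\<close>, and the
  similarity turns the elastica by pi. The mirror factor -1 makes the second coordinate positive
  again.\<close>

lemma loop_curve_eq:
  assumes q: "qstar < q" "q < 1" and l: "0 < l"
  shows "loop_curve l q u = (GX l q 0 (am (loop_alpha l q * u - ellK q) q), GY (-1) l q 0 (am (loop_alpha l q * u - ellK q) q))"
proof -
  have q1: "\<bar>q\<bar> < 1" using q qstar_pos by auto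
  have P: "ellP q < 0" using ellP_neg q by simp
  define a where "a = loop_alpha l q"
  have a: "l / (2 * ellP q) = - (1 / a)"
    using P l by (simp add: a_def loop_alpha_def ellP_def minus_divide_right[symmetric] del: minus_divide_right)
      (simp add: minus_divide_right)
  have P0: "ellP q \<noteq> 0" using P by simp
  show ?thesis
    unfolding loop_curve_def Let_def a_def[symmetric] GX_def GY_def fam_def coef_0(1)[OF P0] coef_0(2) a
    using ellE_minus[of "pi/2" q] ellF_minus[OF q1, of "pi/2"] ellF_am[OF q1, of "a * u - ellK q"]
    by (simp add: cn_def diff_divide_distrib add_divide_distrib)
qed

lemma fam_energy_0:
  assumes "0 < q" "q < qstar"
  shows "fam_energy lam l q 0 = arc_energy lam l q"
  using ellP_pos[OF assms] by (simp add: fam_energy_def arc_energy_def famS_0 mult_ac)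

lemma arc_energy_mono:
  assumes l: "0 < l" and xy: "0 < x" "x < y" "y < qstar"
    and less: "\<And>z. x < z \<Longrightarrow> z < y \<Longrightarrow> gq z < lam * l\<^sup>2"
  shows "arc_energy lam l x < arc_energy lam l y"
proof (rule DERIV_pos_imp_increasing_open[OF xy(2)])
  fix z assume z: "x < z" "z < y"
  have z': "0 < z" "z < qstar" using z xy by auto
  have "0 < 2 * ((ellH z)\<^sup>2 + (1 - z\<^sup>2) * z\<^sup>2 * (ellK z)\<^sup>2) / (z * (1 - z\<^sup>2) * (ellP z)\<^sup>2) * (lam * l\<^sup>2 - gq z) / l"
    by (rule divide_pos_pos[OF mult_pos_pos[OF ellK_ellP_deriv_pos[OF z']] l]) (use less z in auto)
  then show "\<exists>d. (arc_energy lam l has_real_derivative d) (at z) \<and> 0 < d"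
    using DERIV_arc_energy[OF z' l] by blast
next
  show "continuous_on {x..y} (arc_energy lam l)"
    by (rule DERIV_continuous_on, rule has_field_derivative_at_within, rule DERIV_arc_energy) (use xy l in auto)
qed

lemma arc_energy_anti:
  assumes l: "0 < l" and xy: "0 < x" "x < y" "y < qstar"
    and less: "\<And>z. x < z \<Longrightarrow> z < y \<Longrightarrow> lam * l\<^sup>2 < gq z"
  shows "arc_energy lam l y < arc_energy lam l x"
proof (rule DERIV_neg_imp_decreasing_open[OF xy(2)])
  fix z assume z: "x < z" "z < y"
  have z': "0 < z" "z < qstar" using z xy by auto
  have "2 * ((ellH z)\<^sup>2 + (1 - z\<^sup>2) * z\<^sup>2 * (ellK z)\<^sup>2) / (z * (1 - z\<^sup>2) * (ellP z)\<^sup>2) * (lam * l\<^sup>2 - gq z) / l < 0"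
    by (rule divide_neg_pos[OF mult_pos_neg[OF ellK_ellP_deriv_pos[OF z']] l]) (use less z in auto)
  then show "\<exists>d. (arc_energy lam l has_real_derivative d) (at z) \<and> d < 0"
    using DERIV_arc_energy[OF z' l] by blast
next
  show "continuous_on {x..y} (arc_energy lam l)"
    by (rule DERIV_continuous_on, rule has_field_derivative_at_within, rule DERIV_arc_energy) (use xy l in auto)
qed

lemma arc_amp_param:
  assumes gam: "\<gamma> \<in> A_ell l" and l: "0 < l" and q: "0 < q" "q < qstar"
    and par: "arclength_param_is \<gamma> (arc_curve l q) (2 * ellK q / arc_alpha l q)"
  shows "\<exists>\<phi> \<psi> \<omega>. amp_param \<phi> \<psi> \<omega> \<and> (\<forall>t\<in>{0..1}. \<gamma> t = (GX l q 0 (\<phi> t), GY 1 l q 0 (\<phi> t)))"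
proof (rule ex_amp_param[OF gam q(1) _ _ par])
  show "q < 1" using q qstar_props by simp
  show "0 < arc_alpha l q" using ellP_pos[OF q] l by (simp add: arc_alpha_def ellP_def)
qed (rule arc_curve_eq[OF q l])

text \<open>Only moduli to the left of \<open>q0\<close> are compared, where \<open>gq\<close> lies
  below its value at \<open>q0\<close>. Hence the case \<open>q0 = qhat\<close>, in which short and
  long arc coincide, needs no separate argument.\<close>

lemma sarc_unstable:
  assumes gam: "\<gamma> \<in> A_ell l" and l: "0 < l" and q0: "1 / sqrt 2 < q0" "q0 \<le> qhat" "gq q0 = lam * l\<^sup>2"
    and par: "arclength_param_is \<gamma> (arc_curve l q0) (2 * ellK q0 / arc_alpha l q0)"
  shows "\<not> stable lam l \<gamma>"
proof -
  have q0': "0 < q0" "q0 < qstar" "q0 < 1"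
    using q0 qhat_props qstar_props inverse_sqrt2_le_pos[of q0] by auto
  obtain \<phi> \<psi> \<omega> where p: "amp_param \<phi> \<psi> \<omega>" "\<forall>t\<in>{0..1}. \<gamma> t = (GX l q0 0 (\<phi> t), GY 1 l q0 0 (\<phi> t))"
    using arc_amp_param[OF gam l q0'(1,2) par] by blast
  show ?thesis
  proof (rule not_stable_fam[OF p(1) q0'(1,3) _ l _ p(2)])
    show "ellP q0 \<noteq> 0" using ellP_pos[OF q0'(1,2)] by simp
    fix d :: real assume d: "0 < d"
    define h where "h = 1 / sqrt 2"
    have h: "h < q0" using q0 by (simp add: h_def)
    \<comment> \<open>The first entry keeps \<open>q\<close> within \<open>d\<close> of
      \<open>q0\<close>, the second keeps it above \<open>1 / sqrt 2\<close>.\<close>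
    define q where "q = max (q0 - d / 2) ((h + q0) / 2)"
    have q: "1 / sqrt 2 < q" "q < q0" "\<bar>q - q0\<bar> < d"
      unfolding h_def[symmetric] using h d by (auto simp: q_def max_def field_simps abs_if)
    have qp: "0 < q" using q inverse_sqrt2_le_pos[of q] by simp
    have "arc_energy lam l q < arc_energy lam l q0"
    proof (rule arc_energy_mono[OF l qp q(2) q0'(2)])
      fix z assume "q < z" "z < q0"
      then show "gq z < lam * l\<^sup>2" using gq_increasing_left[of z q0] q q0 by auto
    qed
    then have "fam_energy lam l q 0 < fam_energy lam l q0 0"
      using fam_energy_0[of q] fam_energy_0[of q0] qp q q0' by simp
    then show "\<exists>q e. \<bar>q - q0\<bar> < d \<and> \<bar>e\<bar> < d \<and> fam_energy lam l q e < fam_energy lam l q0 0"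
      using q d by (intro exI[of _ q] exI[of _ 0]) auto
  qed simp
qed

text \<open>Sliding the window of the elastica keeps bending and length but lengthens the chord, so
  scaling back shortens the curve; for loops the length term gains more than the bending loses.\<close>

lemma loop_unstable:
  assumes gam: "\<gamma> \<in> A_ell l" and l: "0 < l" and q0: "qstar < q0" "q0 < 1" "gq q0 = lam * l\<^sup>2"
    and par: "arclength_param_is \<gamma> (loop_curve l q0) (2 * ellK q0 / loop_alpha l q0)"
  shows "\<not> stable lam l \<gamma>"
proof -
  have qp: "0 < q0" using q0 qstar_pos by simp
  have P: "ellP q0 < 0" using ellP_neg q0 by simp
  have K: "0 < ellK q0" using ellK_pos[of q0] qp q0 by simp
  have a: "0 < loop_alpha l q0" using P l by (simp add: loop_alpha_def ellP_def)
  obtain \<phi> \<psi> \<omega> where p: "amp_param \<phi> \<psi> \<omega>" "\<forall>t\<in>{0..1}. \<gamma> t = (GX l q0 0 (\<phi> t), GY (-1) l q0 0 (\<phi> t))"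
    using ex_amp_param[OF gam qp q0(2) a par loop_curve_eq[OF q0(1,2) l]] by blast
  define S where "S e = sqrt (famS q0 e)" for e
  define m where "m = - ellP q0"
  have m: "0 < m" "S 0 = m" using P by (auto simp: m_def S_def famS_0)
  show ?thesis
  proof (rule not_stable_fam[OF p(1) qp q0(2) _ l _ p(2)])
    show "ellP q0 \<noteq> 0" using P by simp
    fix d :: real assume d: "0 < d"
    \<comment> \<open>Right side minus left side is \<open>- ellP q0\<close>, positive for a loop.
      This strict gap survives for small nonzero \<open>e\<close>.\<close>
    have "2 * ellH q0 < (2 * q0\<^sup>2 - 1) * ellK q0"
      using P unfolding ellH_def ellP_def by (simp add: algebra_simps)
    then have "m * (2 * ellH q0) < m * ((2 * q0\<^sup>2 - 1) * ellK q0)" using m by simp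
    then have gap: "2 * ellH q0 * S 0 < m * ((2 * q0\<^sup>2 - 1) * ellK q0)" using m by (simp add: mult_ac)
    have "continuous (at 0) (\<lambda>e. 2 * ellH q0 * S e)"
      unfolding S_def famS_def by (intro continuous_intros)
    then have "((\<lambda>e. 2 * ellH q0 * S e) \<longlongrightarrow> 2 * ellH q0 * S 0) (at 0)"
      by (simp add: isCont_def)
    then have "\<forall>\<^sub>F e in at 0. 2 * ellH q0 * S e < m * ((2 * q0\<^sup>2 - 1) * ellK q0)"
      using gap by (rule order_tendstoD(2))
    then obtain r where r: "0 < r" "\<And>e. e \<noteq> 0 \<Longrightarrow> \<bar>e\<bar> < r \<Longrightarrow> 2 * ellH q0 * S e < m * ((2 * q0\<^sup>2 - 1) * ellK q0)"
      unfolding eventually_at dist_real_def by auto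
    define e where "e = min (min d r) 1 / 2"
    have e: "0 < e" "e < d" "e < r" "e < 1" using d r(1) by (auto simp: e_def min_def)
    have "sin e > 0" using e pi_gt3 by (intro sin_gt_zero) auto
    then have "m\<^sup>2 < famS q0 e" using qp by (simp add: famS_def m_def)
    then have mS: "m < S e" unfolding S_def using m by (intro real_less_rsqrt)
    have ineq: "2 * ellH q0 * S e < m * ((2 * q0\<^sup>2 - 1) * ellK q0)" using r(2)[of e] e by simp
    have lam: "lam * l\<^sup>2 = 8 * m\<^sup>2 * (2 * q0\<^sup>2 - 1)" using q0(3) by (simp add: gq_eq m_def)
    have "16 * ellH q0 * S e * m < lam * l\<^sup>2 * ellK q0"
      unfolding lam using mult_strict_left_mono[OF ineq, of "8 * m"] m by (simp add: mult_ac power2_eq_square)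
    then have "16 / l * ellH q0 < lam * l * ellK q0 / (S e * m)"
      using l m mS by (simp add: field_simps power2_eq_square)
    then have "(S e - m) * (16 / l * ellH q0 - lam * l * ellK q0 / (S e * m)) < 0"
      using mS by (intro mult_pos_neg) auto
    \<comment> \<open>For fixed modulus the energy is a linear term in \<open>S\<close> plus a
      multiple of 1/S, so its increment contains the factor \<open>S e - m\<close>; the gap fixes
      the sign of the other factor.\<close>
    moreover have "fam_energy lam l q0 e - fam_energy lam l q0 0
        = (S e - m) * (16 / l * ellH q0 - lam * l * ellK q0 / (S e * m))"
      unfolding fam_energy_def S_def[symmetric] m(2) using m mS l by (simp add: field_simps)
    ultimately have "fam_energy lam l q0 e < fam_energy lam l q0 0" by linarith
    then show "\<exists>q e. \<bar>q - q0\<bar> < d \<and> \<bar>e\<bar> < d \<and> fam_energy lam l q e < fam_energy lam l q0 0"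
      using e d by (intro exI[of _ q0] exI[of _ e]) auto
  qed simp
qed

lemma larc_stable:
  assumes gam: "\<gamma> \<in> A_ell l" and l: "0 < l" and r: "qhat < r" "r < qstar" "gq r = lam * l\<^sup>2"
    and par: "arclength_param_is \<gamma> (arc_curve l r) (2 * ellK r / arc_alpha l r)"
  shows "stable lam l \<gamma>"
proof -
  have r': "0 < r" "r < 1" using r qhat_bounds qstar_props by auto
  have P: "ellP r > 0" by (rule ellP_pos[OF r'(1) r(2)])
  obtain \<phi> \<psi> \<omega> where p: "amp_param \<phi> \<psi> \<omega>" "\<forall>t\<in>{0..1}. \<gamma> t = (GX l r 0 (\<phi> t), GY 1 l r 0 (\<phi> t))"
    using arc_amp_param[OF gam l r'(1) r(2) par] by blast
  have S: "0 < famS r 0" using P by (simp add: famS_0)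
  have "energy lam \<gamma> = fam_energy lam l r 0"
    using fam_comp(2,3)[OF p(1) _ S l _ p(2)] r' by (simp add: energy_def fam_energy_def)
  then have eg: "energy lam \<gamma> = arc_energy lam l r" using fam_energy_0 r' r by simp
  define Len where "Len q = l * (ellK q / ellP q)" for q
  have lg: "curve_length \<gamma> = Len r"
    using fam_comp(2)[OF p(1) _ S l _ p(2)] r' P by (simp add: Len_def famS_0)
  have dLen: "(Len has_real_derivative l * (2 * ((ellH q)\<^sup>2 + (1 - q\<^sup>2) * q\<^sup>2 * (ellK q)\<^sup>2) / (q * (1 - q\<^sup>2) * (ellP q)\<^sup>2))) (at q)"
    if "0 < q" "q < qstar" for q
    unfolding Len_def[abs_def] by (intro DERIV_cmult ellK_ellP_deriv that)
  have Len_mono: "Len x < Len y" if "0 < x" "x < y" "y < qstar" for x y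
  proof (rule DERIV_pos_imp_increasing[OF that(2)])
    fix z assume "x \<le> z" "z \<le> y"
    then have z: "0 < z" "z < qstar" using that by auto
    show "\<exists>d. (Len has_real_derivative d) (at z) \<and> 0 < d"
      using dLen[OF z] mult_pos_pos[OF l ellK_ellP_deriv_pos[OF z]] by blast
  qed
  define qb where "qb = (r + qstar) / 2"
  have qb: "r < qb" "qb < qstar" using r by (auto simp: qb_def)
  \<comment> \<open>It confines the length of a competitor to the values of \<open>Len\<close>
    between \<open>qhat\<close> and \<open>qb\<close>. On this range \<open>gq\<close> decreases, so
    \<open>arc_energy\<close> is minimal at \<open>r\<close>.\<close>
  define \<delta> where "\<delta> = min (Len r - Len qhat) (Len qb - Len r)"
  have \<delta>: "0 < \<delta>" using Len_mono[of qhat r] Len_mono[of r qb] r qb qhat_bounds r' by (simp add: \<delta>_def)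
  have "energy lam \<gamma> \<le> energy lam \<eta>" if eta: "\<eta> \<in> A_ell l" and n: "W22_norm (\<lambda>t. \<eta> t - \<gamma> t) < \<delta>" for \<eta>
  proof -
    have "\<bar>curve_length \<eta> - curve_length \<gamma>\<bar> < \<delta>"
      using length_W22_bound[of \<eta> \<gamma>] eta gam n by (auto simp: A_ell_def)
    then have "Len qhat \<le> curve_length \<eta>" "curve_length \<eta> \<le> Len qb"
      unfolding lg \<delta>_def by auto
    moreover have "continuous_on {qhat..qb} Len"
      by (rule DERIV_continuous_on, rule has_field_derivative_at_within, rule dLen) (use qhat_bounds qb in auto)
    ultimately have "\<exists>q\<ge>qhat. q \<le> qb \<and> Len q = curve_length \<eta>"
      using r qb by (intro IVT') auto
    then obtain q where q: "qhat \<le> q" "q \<le> qb" "Len q = curve_length \<eta>" by blast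
    have q': "0 < q" "q < qstar" using q qb qhat_bounds by auto
    have "arc_energy lam l r \<le> arc_energy lam l q"
    proof (cases q r rule: linorder_cases)
      case less
      have "arc_energy lam l r < arc_energy lam l q"
      proof (rule arc_energy_anti[OF l q'(1) less r(2)])
        fix z assume "q < z" "z < r"
        then show "lam * l\<^sup>2 < gq z" using gq_decreasing_mid[of z r] q r by auto
      qed
      then show ?thesis by simp
    next
      case greater
      have "arc_energy lam l r < arc_energy lam l q"
      proof (rule arc_energy_mono[OF l r'(1) greater q'(2)])
        fix z assume "r < z" "z < q"
        then show "gq z < lam * l\<^sup>2" using gq_decreasing_mid[of r z] q' r by auto
      qed
      then show ?thesis by simp
    qed simp
    also have "\<dots> \<le> energy lam \<eta>"
      using bending_lower_bound[OF eta l q'] q(3)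
      unfolding energy_def arc_energy_def q(3)[symmetric] by (simp add: Len_def mult_ac)
    finally show ?thesis unfolding eg .
  qed
  then show ?thesis unfolding stable_def using \<delta> by blast
qed

theorem theorem3p6:
  fixes lam l :: real and \<gamma> :: curve
  assumes "lam > 0" and "l > 0"
    and "penalized_pinned_elastica lam l \<gamma>"
  shows "(0 < lam * l\<^sup>2 \<and> lam * l\<^sup>2 < lamhat \<and>
           arclength_param_is \<gamma> (gamma_larc lam l) (larc_len lam l)
             \<longrightarrow> stable lam l \<gamma>)
       \<and> (0 < lam * l\<^sup>2 \<and> lam * l\<^sup>2 < lamhat \<and>
           arclength_param_is \<gamma> (gamma_sarc lam l) (sarc_len lam l)
             \<longrightarrow> \<not> stable lam l \<gamma>)
       \<and> (lam * l\<^sup>2 = lamhat \<and>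
           arclength_param_is \<gamma> (gamma_sarc lam l) (sarc_len lam l) \<and>
           arclength_param_is \<gamma> (gamma_larc lam l) (larc_len lam l)
             \<longrightarrow> \<not> stable lam l \<gamma>)
       \<and> (arclength_param_is \<gamma> (gamma_loop lam l) (loop_len lam l)
             \<longrightarrow> \<not> stable lam l \<gamma>)"
proof -
  have l: "0 < l" by fact
  have gam: "\<gamma> \<in> A_ell l" using assms(3) by (simp add: penalized_pinned_elastica_def)
  have c: "0 < lam * l\<^sup>2" using assms by simp
  \<comment> \<open>Stated with a weak inequality so that it serves both the subcritical short arc
    and the case of equality.\<close>
  have sarc: "\<not> stable lam l \<gamma>"
    if "lam * l\<^sup>2 \<le> lamhat" "arclength_param_is \<gamma> (gamma_sarc lam l) (sarc_len lam l)"
    using sarc_unstable[OF gam l q1_props[OF c that(1)]] that(2)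
    by (simp add: gamma_sarc_def sarc_len_def)
  have larc: "stable lam l \<gamma>"
    if "lam * l\<^sup>2 < lamhat" "arclength_param_is \<gamma> (gamma_larc lam l) (larc_len lam l)"
    using larc_stable[OF gam l q2_props[OF c that(1)]] that(2)
    by (simp add: gamma_larc_def larc_len_def)
  have loop: "\<not> stable lam l \<gamma>" if "arclength_param_is \<gamma> (gamma_loop lam l) (loop_len lam l)"
    using loop_unstable[OF gam l q3_props[OF c]] that
    by (simp add: gamma_loop_def loop_len_def)
  show ?thesis using sarc larc loop by auto
qed

end
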